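(* Consider structures $(M,[\lambda,\mu])$ of an oriented congruence with nonvanishing twist, vanishing shear, $K_1\neq 0$, $K_2\equiv 0$ and $A_1\neq 0$ everywhere. The functions $A_1>0$ (real) and $B_1$ (complex) on $M$ constitute the full system of basic scalar invariants of such structures; that is, the structure determines an invariant coframe $(\omega,\omega_1,\bar\omega_1)$ on $M$ ($\omega$ real, $\omega=f\lambda$, $\omega_1=h\mu$) whose differentials are given by $$d\omega=i\omega_1\wedge\bar\omega_1+2A_1(\omega_1+\bar\omega_1)\wedge\omega,\qquad d\omega_1=-(A_1+i\bar B_1)\,\omega_1\wedge\bar\omega_1,\qquad d(B_1\omega_1+\bar B_1\bar\omega_1)=-\varepsilon\, i\,\omega_1\wedge\bar\omega_1,$$ with $\varepsilon=\pm1$ the sign of $K_1$. Two such structures $(M,[\lambda,\mu])$ and $(M',[\lambda',\mu'])$ are (locally) equivalent if and only if there exists a (local) diffeomorphism between $M$ and $M'$ which transforms the corresponding forms $(\omega,\omega_1,\bar\omega_1)$ to $(\omega',\omega_1',\bar\omega_1')$. This in particular implies that the invariants $A_1$ and $B_1$ must be transformed to $A_1'$ and $B_1'$.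
   Context: All objects are smooth. A structure of an oriented congruence $(M,[\lambda,\mu])$ on a 3-manifold $M$ is an equivalence class of pairs of 1-forms $(\lambda,\mu)$, $\lambda$ real, $\mu$ complex, with $\lambda\wedge\mu\wedge\bar\mu\neq 0$ everywhere, where $(\lambda,\mu)\sim(\lambda',\mu')$ iff $\lambda'=f\lambda$, $\mu'=h\mu$ for nonvanishing functions $f$ (real), $h$ (complex). Two structures are (locally) equivalent iff there is a (local) diffeomorphism $\varphi:M\to M'$ with $\varphi^*\lambda'=f\lambda$, $\varphi^*\mu'=h\mu$ for such $f,h$. For a representative write $d\lambda=ia\,\mu\wedge\bar\mu+b\,\mu\wedge\lambda+\bar b\,\bar\mu\wedge\lambda$, $d\mu=p\,\mu\wedge\bar\mu+q\,\mu\wedge\lambda+s\,\bar\mu\wedge\lambda$; $a$ is the twist, $s$ the shear. If $a\ne0$, $s\equiv0$, then on $P$, locally $M\times\mathbb{C}^*$ with fibre coordinate $\rho e^{i\phi}$, there is a unique coframe $(\omega,\omega_1,\bar\omega_1,\Omega,\bar\Omega)$, with $\omega=\frac{\rho^2}{a}\lambda$, $\omega_1=\rho e^{i\phi}\mu$, satisfying $d\omega=i\omega_1\wedge\bar\omega_1+(\Omega+\bar\Omega)\wedge\omega$, $d\omega_1=\Omega\wedge\omega_1$, $d\Omega=K_1\omega_1\wedge\bar\omega_1+K_2\omega_1\wedge\omega$, with $K_1=\rho^{-2}k_1$ real, $K_2=\rho^{-3}e^{-i\phi}k_2$, and $k_1,k_2$ functions on $M$. If $K_2\equiv0$ and $K_1\neq0$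 (i.e. $k_1$ nowhere zero), restrict to $N_0=\{\rho^2=|k_1|\}\subset P$, where $K_1=\varepsilon=\pm1$. There $\Omega+\bar\Omega$ is closed, locally $\Omega+\bar\Omega=2dA$ with $dA=A_1\omega_1+\bar A_1\bar\omega_1$, and $$A_1=\tfrac12\,|k_1|^{-1/2}e^{-i\phi}\Big(\big(\log\tfrac{|k_1|}{|a|}\big)_\mu+b\Big),$$ where $u_\mu$ denotes the $\mu$-coefficient of $du$ in the coframe $(\lambda,\mu,\bar\mu)$. Put $\Sigma=\frac1{2i}(\Omega-\bar\Omega)$. If $A_1\neq0$ everywhere, choose $\phi$ as a function on $M$ so that $A_1$ is real and positive, and pull everything back to $M$ by the resulting section of $N_0\to M$; then $\Sigma=B_1\omega_1+\bar B_1\bar\omega_1$, which defines $B_1$. *)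

theory Defs
  imports "HOL-Analysis.Analysis"
begin

section \<open>Smooth functions and smooth manifolds\<close>

text \<open>Smoothness on an open subset of a Euclidean space.  The derivative is required to be
  smooth in each fixed direction, which in finite dimension is the usual condition.\<close>

primrec Ck_on :: "nat \<Rightarrow> ('e::euclidean_space \<Rightarrow> 'f::real_normed_vector) \<Rightarrow> 'e set \<Rightarrow> bool" where
  "Ck_on 0 f S \<longleftrightarrow> continuous_on S f"
| "Ck_on (Suc k) f S \<longleftrightarrow>
     f differentiable_on S \<and> (\<forall>v. Ck_on k (\<lambda>x. frechet_derivative f (at x) v) S)"

definition smooth_on :: "('e::euclidean_space \<Rightarrow> 'f::real_normed_vector) \<Rightarrow> 'e set \<Rightarrow> bool" where
  "smooth_on f S \<longleftrightarrow> (\<forall>k. Ck_on k f S)"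

text \<open>A chart is a pair of its domain and its coordinate map.  The atlas of a manifold need not
  be maximal.\<close>

type_synonym ('a, 'e) chart = "'a set \<times> ('a \<Rightarrow> 'e)"

record ('a, 'e) mfd =
  mfd_top :: "'a topology"
  atlas :: "('a, 'e) chart set"

abbreviation points :: "('a, 'e) mfd \<Rightarrow> 'a set" where
  "points M \<equiv> topspace (mfd_top M)"

definition chart_inv :: "('a, 'e) chart \<Rightarrow> 'e \<Rightarrow> 'a" where
  "chart_inv c = inv_into (fst c) (snd c)"

definition smooth_manifold :: "('a, 'e::euclidean_space) mfd \<Rightarrow> bool" where
  "smooth_manifold M \<longleftrightarrow>
     Hausdorff_space (mfd_top M) \<and> second_countable (mfd_top M) \<and>
     points M = \<Union> (fst ` atlas M) \<and>
     (\<forall>c\<in>atlas M. openin (mfd_top M) (fst c) \<and> open (snd c ` fst c) \<and>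
        homeomorphic_map (subtopology (mfd_top M) (fst c)) (top_of_set (snd c ` fst c)) (snd c)) \<and>
     (\<forall>c\<in>atlas M. \<forall>d\<in>atlas M. smooth_on (snd d \<circ> chart_inv c) (snd c ` (fst c \<inter> fst d)))"

definition smooth_fun_on ::
  "('a, 'e::euclidean_space) mfd \<Rightarrow> 'a set \<Rightarrow> ('a \<Rightarrow> 'f::real_normed_vector) \<Rightarrow> bool" where
  "smooth_fun_on M W f \<longleftrightarrow> (\<forall>c\<in>atlas M. smooth_on (f \<circ> chart_inv c) (snd c ` (fst c \<inter> W)))"

abbreviation smooth_fun ::
  "('a, 'e::euclidean_space) mfd \<Rightarrow> ('a \<Rightarrow> 'f::real_normed_vector) \<Rightarrow> bool" where
  "smooth_fun M f \<equiv> smooth_fun_on M (points M) f"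

definition smooth_map_on :: "('a, 'e::euclidean_space) mfd \<Rightarrow> 'a set \<Rightarrow>
    ('b, 'f::euclidean_space) mfd \<Rightarrow> ('a \<Rightarrow> 'b) \<Rightarrow> bool" where
  "smooth_map_on M W N F \<longleftrightarrow>
     continuous_map (subtopology (mfd_top M) W) (mfd_top N) F \<and>
     (\<forall>c\<in>atlas M. \<forall>d\<in>atlas N.
        smooth_on (snd d \<circ> F \<circ> chart_inv c) (snd c ` (fst c \<inter> W \<inter> F -` fst d)))"

definition diffeo_between :: "('a, 'e::euclidean_space) mfd \<Rightarrow> 'a set \<Rightarrow>
    ('b, 'f::euclidean_space) mfd \<Rightarrow> 'b set \<Rightarrow> ('a \<Rightarrow> 'b) \<Rightarrow> bool" where
  "diffeo_between M W N W' F \<longleftrightarrow>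
     openin (mfd_top M) W \<and> openin (mfd_top N) W' \<and> bij_betw F W W' \<and>
     smooth_map_on M W N F \<and> smooth_map_on N W' M (inv_into W F)"

section \<open>Complex-valued differential forms\<close>

text \<open>
  A 1-form \<open>\<alpha>\<close> is given by its local expressions: \<open>\<alpha> c x v\<close> is the value of the form at the
  point \<open>x\<close> on the tangent vector whose components in the chart \<open>c\<close> are \<open>v\<close>.  Values for \<open>c\<close>
  outside the atlas, or \<open>x\<close> outside the domain of \<open>c\<close>, are irrelevant; hence equality of
  forms on \<open>W\<close> is \<open>form_eq\<close> rather than \<open>=\<close>.  2-forms are represented likewise.
\<close>

type_synonym ('a, 'e) form1 = "('a, 'e) chart \<Rightarrow> 'a \<Rightarrow> 'e \<Rightarrow> complex"
type_synonym ('a, 'e) form2 = "('a, 'e) chart \<Rightarrow> 'a \<Rightarrow> 'e \<Rightarrow> 'e \<Rightarrow> complex"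

definition one_form :: "('a, 'e::euclidean_space) mfd \<Rightarrow> ('a, 'e) form1 \<Rightarrow> bool" where
  "one_form M \<alpha> \<longleftrightarrow>
     (\<forall>c\<in>atlas M. (\<forall>x\<in>fst c. linear (\<alpha> c x)) \<and>
        (\<forall>v. smooth_on (\<lambda>y. \<alpha> c (chart_inv c y) v) (snd c ` fst c)) \<and>
        (\<forall>d\<in>atlas M. \<forall>x\<in>fst c \<inter> fst d. \<forall>v.
           \<alpha> c x v = \<alpha> d x (frechet_derivative (snd d \<circ> chart_inv c) (at (snd c x)) v)))"

definition real_form :: "('a, 'e) mfd \<Rightarrow> ('a, 'e) form1 \<Rightarrow> bool" where
  "real_form M \<alpha> \<longleftrightarrow> (\<forall>c\<in>atlas M. \<forall>x\<in>fst c. \<forall>v. \<alpha> c x v \<in> \<real>)"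

definition form_eq :: "('a, 'e) mfd \<Rightarrow> 'a set \<Rightarrow>
    (('a, 'e) chart \<Rightarrow> 'a \<Rightarrow> 'r) \<Rightarrow> (('a, 'e) chart \<Rightarrow> 'a \<Rightarrow> 'r) \<Rightarrow> bool" where
  "form_eq M W \<alpha> \<beta> \<longleftrightarrow> (\<forall>c\<in>atlas M. \<forall>x\<in>fst c \<inter> W. \<alpha> c x = \<beta> c x)"

definition cnj_form :: "('a, 'e) form1 \<Rightarrow> ('a, 'e) form1" where
  "cnj_form \<alpha> = (\<lambda>c x v. cnj (\<alpha> c x v))"

definition wedge :: "('a, 'e) form1 \<Rightarrow> ('a, 'e) form1 \<Rightarrow> ('a, 'e) form2"
    (infixl "\<^bold>\<and>" 70) where
  "\<alpha> \<^bold>\<and> \<beta> = (\<lambda>c x u v. \<alpha> c x u * \<beta> c x v - \<alpha> c x v * \<beta> c x u)"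

definition wedge21 ::
    "('a, 'e) form2 \<Rightarrow> ('a, 'e) form1 \<Rightarrow> ('a, 'e) chart \<Rightarrow> 'a \<Rightarrow> 'e \<Rightarrow> 'e \<Rightarrow> 'e \<Rightarrow> complex" where
  "wedge21 \<theta> \<gamma> = (\<lambda>c x u v w. \<theta> c x u v * \<gamma> c x w + \<theta> c x v w * \<gamma> c x u + \<theta> c x w u * \<gamma> c x v)"

definition d0 :: "('a \<Rightarrow> 'f::real_normed_vector) \<Rightarrow> ('a, 'e::euclidean_space) chart \<Rightarrow> 'a \<Rightarrow> 'e \<Rightarrow> 'f" where
  "d0 f = (\<lambda>c x v. frechet_derivative (f \<circ> chart_inv c) (at (snd c x)) v)"

definition d1 :: "('a, 'e::euclidean_space) form1 \<Rightarrow> ('a, 'e) form2" where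
  "d1 \<alpha> = (\<lambda>c x u v.
     frechet_derivative (\<lambda>y. \<alpha> c (chart_inv c y) v) (at (snd c x)) u -
     frechet_derivative (\<lambda>y. \<alpha> c (chart_inv c y) u) (at (snd c x)) v)"

text \<open>Pullback of a form on \<open>N\<close> along \<open>F\<close>.  By the compatibility condition in
  \<open>one_form\<close> it does not depend on the chart chosen around \<open>F x\<close>.\<close>

definition pullback :: "('b, 'f::euclidean_space) mfd \<Rightarrow> ('a \<Rightarrow> 'b) \<Rightarrow> ('b, 'f) form1 \<Rightarrow>
    ('a, 'e::euclidean_space) form1" where
  "pullback N F \<theta> = (\<lambda>c x v.
     let d = (SOME d. d \<in> atlas N \<and> F x \<in> fst d)
     in \<theta> d (F x) (frechet_derivative (snd d \<circ> F \<circ> chart_inv c) (at (snd c x)) v))"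

text \<open>A coframe (of complex-valued forms): a basis of the complexified cotangent space at
  each point.\<close>

definition coframe :: "('a, 'e::euclidean_space) mfd \<Rightarrow> ('a, 'e) form1 list \<Rightarrow> bool" where
  "coframe M \<alpha>s \<longleftrightarrow>
     length \<alpha>s = DIM('e) \<and> (\<forall>\<alpha>\<in>set \<alpha>s. one_form M \<alpha>) \<and>
     (\<forall>c\<in>atlas M. \<forall>x\<in>fst c. \<forall>k :: nat \<Rightarrow> complex.
        (\<forall>v. (\<Sum>i<length \<alpha>s. k i * (\<alpha>s ! i) c x v) = 0) \<longrightarrow> (\<forall>i<length \<alpha>s. k i = 0))"

section \<open>Structures of an oriented congruence\<close>

type_synonym 'a form_pair = "('a, real^3) form1 \<times> ('a, real^3) form1"

definition oc_pair :: "('a, real^3) mfd \<Rightarrow> ('a, real^3) form1 \<Rightarrow> ('a, real^3) form1 \<Rightarrow> bool" where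
  "oc_pair M lam \<mu> \<longleftrightarrow>
     one_form M lam \<and> real_form M lam \<and> one_form M \<mu> \<and>
     (\<forall>c\<in>atlas M. \<forall>x\<in>fst c. \<exists>u v w. wedge21 (lam \<^bold>\<and> \<mu>) (cnj_form \<mu>) c x u v w \<noteq> 0)"

text \<open>\<open>lam' = f lam\<close> and \<open>\<mu>' = h \<mu>\<close> on \<open>W\<close>, with nonvanishing smooth \<open>f\<close> (real) and \<open>h\<close> (complex).\<close>

definition proportional_on :: "('a, real^3) mfd \<Rightarrow> 'a set \<Rightarrow> ('a, real^3) form1 \<Rightarrow> ('a, real^3) form1 \<Rightarrow>
    ('a, real^3) form1 \<Rightarrow> ('a, real^3) form1 \<Rightarrow> bool" where
  "proportional_on M W lam \<mu> lam' \<mu>' \<longleftrightarrow>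
     (\<exists>(f :: 'a \<Rightarrow> real) (h :: 'a \<Rightarrow> complex).
        smooth_fun_on M W f \<and> smooth_fun_on M W h \<and> (\<forall>x\<in>W. f x \<noteq> 0 \<and> h x \<noteq> 0) \<and>
        form_eq M W lam' (\<lambda>c x v. of_real (f x) * lam c x v) \<and>
        form_eq M W \<mu>' (\<lambda>c x v. h x * \<mu> c x v))"

definition oc_rel :: "('a, real^3) mfd \<Rightarrow> ('a form_pair \<times> 'a form_pair) set" where
  "oc_rel M = {((lam, \<mu>), (lam', \<mu>')). oc_pair M lam \<mu> \<and> oc_pair M lam' \<mu>' \<and>
     proportional_on M (points M) lam \<mu> lam' \<mu>'}"

definition oriented_congruence :: "('a, real^3) mfd \<Rightarrow> 'a form_pair set \<Rightarrow> bool" where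
  "oriented_congruence M S \<longleftrightarrow>
     smooth_manifold M \<and> S \<in> {(lam, \<mu>). oc_pair M lam \<mu>} // oc_rel M"

definition equivalence_between :: "('a, real^3) mfd \<Rightarrow> 'a set \<Rightarrow> 'a form_pair set \<Rightarrow>
    ('b, real^3) mfd \<Rightarrow> 'b set \<Rightarrow> 'b form_pair set \<Rightarrow> ('a \<Rightarrow> 'b) \<Rightarrow> bool" where
  "equivalence_between M W S M' W' S' \<phi> \<longleftrightarrow>
     diffeo_between M W M' W' \<phi> \<and>
     (\<exists>(lam, \<mu>)\<in>S. \<exists>(lam', \<mu>')\<in>S'.
        proportional_on M W lam \<mu> (pullback M' \<phi> lam') (pullback M' \<phi> \<mu>'))"

definition equivalent_structures :: "('a, real^3) mfd \<Rightarrow> 'a form_pair set \<Rightarrow>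
    ('b, real^3) mfd \<Rightarrow> 'b form_pair set \<Rightarrow> bool" where
  "equivalent_structures M S M' S' \<longleftrightarrow>
     (\<exists>\<phi>. equivalence_between M (points M) S M' (points M') S' \<phi>)"

definition locally_equivalent_at :: "('a, real^3) mfd \<Rightarrow> 'a form_pair set \<Rightarrow> 'a \<Rightarrow>
    ('b, real^3) mfd \<Rightarrow> 'b form_pair set \<Rightarrow> 'b \<Rightarrow> bool" where
  "locally_equivalent_at M S x M' S' x' \<longleftrightarrow>
     (\<exists>W W' \<phi>. x \<in> W \<and> x' \<in> W' \<and> \<phi> x = x' \<and> equivalence_between M W S M' W' S' \<phi>)"

text \<open>\<open>a\<close> is the twist and \<open>s\<close> the shear of the representative \<open>(lam, \<mu>)\<close>.\<close>

definition structure_functions :: "('a, real^3) mfd \<Rightarrow> ('a, real^3) form1 \<Rightarrow> ('a, real^3) form1 \<Rightarrow>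
    ('a \<Rightarrow> real) \<Rightarrow> ('a \<Rightarrow> complex) \<Rightarrow> ('a \<Rightarrow> complex) \<Rightarrow> ('a \<Rightarrow> complex) \<Rightarrow> ('a \<Rightarrow> complex) \<Rightarrow> bool" where
  "structure_functions M lam \<mu> a b p q s \<longleftrightarrow>
     smooth_fun M a \<and> smooth_fun M b \<and> smooth_fun M p \<and> smooth_fun M q \<and> smooth_fun M s \<and>
     form_eq M (points M) (d1 lam)
       (\<lambda>c x u v. \<i> * of_real (a x) * (\<mu> \<^bold>\<and> cnj_form \<mu>) c x u v
          + b x * (\<mu> \<^bold>\<and> lam) c x u v + cnj (b x) * (cnj_form \<mu> \<^bold>\<and> lam) c x u v) \<and>
     form_eq M (points M) (d1 \<mu>)
       (\<lambda>c x u v. p x * (\<mu> \<^bold>\<and> cnj_form \<mu>) c x u v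
          + q x * (\<mu> \<^bold>\<and> lam) c x u v + s x * (cnj_form \<mu> \<^bold>\<and> lam) c x u v)"

section \<open>The Cartan coframe on the bundle \<open>P\<close>\<close>

text \<open>Once a representative \<open>(lam, \<mu>)\<close> is chosen, \<open>P = M \<times> \<complex>\<^sup>*\<close>, with fibre coordinate
  \<open>z = \<rho> e\<^sup>i\<^sup>\<phi>\<close>.\<close>

definition bundle_P :: "('a, 'e::euclidean_space) mfd \<Rightarrow> ('a \<times> complex, 'e \<times> complex) mfd" where
  "bundle_P M = \<lparr> mfd_top = prod_topology (mfd_top M) (top_of_set (- {0})),
     atlas = (\<lambda>c. (fst c \<times> (- {0}), map_prod (snd c) id)) ` atlas M \<rparr>"

definition omega_P :: "('a, real^3) mfd \<Rightarrow> ('a \<Rightarrow> real) \<Rightarrow> ('a, real^3) form1 \<Rightarrow>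
    ('a \<times> complex, (real^3) \<times> complex) form1" where
  "omega_P M a lam = (\<lambda>c (x, z) v. of_real ((cmod z)\<^sup>2 / a x) * pullback M fst lam c (x, z) v)"

definition omega1_P :: "('a, real^3) mfd \<Rightarrow> ('a, real^3) form1 \<Rightarrow>
    ('a \<times> complex, (real^3) \<times> complex) form1" where
  "omega1_P M \<mu> = (\<lambda>c (x, z) v. z * pullback M fst \<mu> c (x, z) v)"

text \<open>\<open>K\<^sub>1 = \<rho>\<^sup>-\<^sup>2 k\<^sub>1\<close> and \<open>K\<^sub>2 = \<rho>\<^sup>-\<^sup>3 e\<^sup>-\<^sup>i\<^sup>\<phi> k\<^sub>2\<close>.\<close>

definition K1_P :: "('a \<Rightarrow> real) \<Rightarrow> 'a \<times> complex \<Rightarrow> real" where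
  "K1_P k1 = (\<lambda>(x, z). k1 x / (cmod z)\<^sup>2)"

definition K2_P :: "('a \<Rightarrow> complex) \<Rightarrow> 'a \<times> complex \<Rightarrow> complex" where
  "K2_P k2 = (\<lambda>(x, z). k2 x / (of_real ((cmod z)\<^sup>2) * z))"

definition cartan_coframe :: "('a, real^3) mfd \<Rightarrow> ('a, real^3) form1 \<Rightarrow> ('a, real^3) form1 \<Rightarrow>
    ('a \<Rightarrow> real) \<Rightarrow> ('a \<times> complex, (real^3) \<times> complex) form1 \<Rightarrow>
    ('a \<Rightarrow> real) \<Rightarrow> ('a \<Rightarrow> complex) \<Rightarrow> bool" where
  "cartan_coframe M lam \<mu> a \<Omega> k1 k2 \<longleftrightarrow>
     (let P = bundle_P M; \<omega> = omega_P M a lam; \<omega>\<^sub>1 = omega1_P M \<mu> in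
      smooth_fun M k1 \<and> smooth_fun M k2 \<and>
      coframe P [\<omega>, \<omega>\<^sub>1, cnj_form \<omega>\<^sub>1, \<Omega>, cnj_form \<Omega>] \<and>
      form_eq P (points P) (d1 \<omega>)
        (\<lambda>c y u v. \<i> * (\<omega>\<^sub>1 \<^bold>\<and> cnj_form \<omega>\<^sub>1) c y u v + (\<Omega> \<^bold>\<and> \<omega>) c y u v + (cnj_form \<Omega> \<^bold>\<and> \<omega>) c y u v) \<and>
      form_eq P (points P) (d1 \<omega>\<^sub>1) (\<Omega> \<^bold>\<and> \<omega>\<^sub>1) \<and>
      form_eq P (points P) (d1 \<Omega>)
        (\<lambda>c y u v. of_real (K1_P k1 y) * (\<omega>\<^sub>1 \<^bold>\<and> cnj_form \<omega>\<^sub>1) c y u v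
           + K2_P k2 y * (\<omega>\<^sub>1 \<^bold>\<and> \<omega>) c y u v))"

definition N0 :: "('a, real^3) mfd \<Rightarrow> ('a \<Rightarrow> real) \<Rightarrow> ('a \<times> complex) set" where
  "N0 M k1 = {(x, z). (x, z) \<in> points (bundle_P M) \<and> (cmod z)\<^sup>2 = \<bar>k1 x\<bar>}"

text \<open>Equality of the restrictions to the submanifold \<open>N\<^sub>0\<close>, whose tangent spaces are the
  kernels of \<open>d(\<rho>\<^sup>2 - |k\<^sub>1|)\<close>.\<close>

definition eq_on_N0 :: "('a, real^3) mfd \<Rightarrow> ('a \<Rightarrow> real) \<Rightarrow>
    ('a \<times> complex, (real^3) \<times> complex) form1 \<Rightarrow> ('a \<times> complex, (real^3) \<times> complex) form1 \<Rightarrow> bool" where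
  "eq_on_N0 M k1 \<alpha> \<beta> \<longleftrightarrow>
     (\<forall>c\<in>atlas (bundle_P M). \<forall>y\<in>fst c \<inter> N0 M k1. \<forall>v.
        d0 (\<lambda>(x, z). (cmod z)\<^sup>2 - \<bar>k1 x\<bar>) c y v = 0 \<longrightarrow> \<alpha> c y v = \<beta> c y v)"

text \<open>\<open>\<A>\<close> is the function \<open>A\<^sub>1\<close> on \<open>N\<^sub>0\<close>: the relation
  \<open>\<Omega> + \<Omega>\<^sup>* = 2(A\<^sub>1 \<omega>\<^sub>1 + A\<^sub>1\<^sup>* \<omega>\<^sub>1\<^sup>*)\<close> on \<open>N\<^sub>0\<close> determines it.  The local potential of
  \<open>(\<Omega> + \<Omega>\<^sup>*)/2\<close> enters only through its differential.\<close>

definition nondegenerate_data :: "('a, real^3) mfd \<Rightarrow> ('a, real^3) form1 \<Rightarrow> ('a, real^3) form1 \<Rightarrow>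
    ('a \<Rightarrow> real) \<Rightarrow> ('a \<times> complex, (real^3) \<times> complex) form1 \<Rightarrow> ('a \<Rightarrow> real) \<Rightarrow>
    ('a \<times> complex \<Rightarrow> complex) \<Rightarrow> bool" where
  "nondegenerate_data M lam \<mu> a \<Omega> k1 \<A> \<longleftrightarrow>
     (\<exists>b p q s. structure_functions M lam \<mu> a b p q s \<and>
        (\<forall>x\<in>points M. a x \<noteq> 0) \<and> (\<forall>x\<in>points M. s x = 0)) \<and>
     (\<exists>k2. cartan_coframe M lam \<mu> a \<Omega> k1 k2 \<and>
        (\<forall>y\<in>points (bundle_P M). K1_P k1 y \<noteq> 0) \<and>
        (\<forall>y\<in>points (bundle_P M). K2_P k2 y = 0)) \<and>
     eq_on_N0 M k1 (\<lambda>c y v. \<Omega> c y v + cnj (\<Omega> c y v))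
       (\<lambda>c y v. 2 * (\<A> y * omega1_P M \<mu> c y v + cnj (\<A> y) * cnj (omega1_P M \<mu> c y v))) \<and>
     (\<forall>y\<in>N0 M k1. \<A> y \<noteq> 0)"

definition nondegenerate_structure :: "('a, real^3) mfd \<Rightarrow> 'a form_pair set \<Rightarrow> bool" where
  "nondegenerate_structure M S \<longleftrightarrow>
     oriented_congruence M S \<and> (\<exists>(lam, \<mu>)\<in>S. \<exists>a \<Omega> k1 \<A>. nondegenerate_data M lam \<mu> a \<Omega> k1 \<A>)"

text \<open>
  The result of the reduction: \<open>x \<mapsto> (x, z x)\<close> is the section of \<open>N\<^sub>0 \<rightarrow> M\<close> along which \<open>A\<^sub>1\<close> is
  real and positive, and everything is pulled back along it.  \<open>\<epsilon>\<close> is the sign of \<open>K\<^sub>1\<close>, as a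
  function on \<open>M\<close> since \<open>M\<close> is not assumed to be connected.
\<close>

definition invariant_coframe :: "('a, real^3) mfd \<Rightarrow> 'a form_pair set \<Rightarrow>
    ('a, real^3) form1 \<Rightarrow> ('a, real^3) form1 \<Rightarrow> ('a \<Rightarrow> real) \<Rightarrow> ('a \<Rightarrow> complex) \<Rightarrow> ('a \<Rightarrow> real) \<Rightarrow> bool" where
  "invariant_coframe M S \<omega> \<omega>\<^sub>1 A\<^sub>1 B\<^sub>1 \<epsilon> \<longleftrightarrow>
     (\<exists>(lam, \<mu>)\<in>S. \<exists>a \<Omega> k1 \<A> z.
        nondegenerate_data M lam \<mu> a \<Omega> k1 \<A> \<and>
        smooth_fun M z \<and> (\<forall>x\<in>points M. (x, z x) \<in> N0 M k1) \<and>
        (\<forall>x\<in>points M. \<A> (x, z x) = of_real (A\<^sub>1 x) \<and> A\<^sub>1 x > 0) \<and>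
        (\<forall>x\<in>points M. \<epsilon> x = sgn (K1_P k1 (x, z x))) \<and>
        (let P = bundle_P M; \<sigma> = (\<lambda>x. (x, z x));
             \<Sigma> = (\<lambda>c y v. (\<Omega> c y v - cnj (\<Omega> c y v)) / (2 * \<i>)) in
         form_eq M (points M) \<omega> (pullback P \<sigma> (omega_P M a lam)) \<and>
         form_eq M (points M) \<omega>\<^sub>1 (pullback P \<sigma> (omega1_P M \<mu>)) \<and>
         form_eq M (points M) (pullback P \<sigma> \<Sigma>)
           (\<lambda>c x v. B\<^sub>1 x * \<omega>\<^sub>1 c x v + cnj (B\<^sub>1 x) * cnj (\<omega>\<^sub>1 c x v))))"

definition carries_coframe :: "('a, real^3) mfd \<Rightarrow> 'a set \<Rightarrow> ('a, real^3) form1 \<Rightarrow> ('a, real^3) form1 \<Rightarrow>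
    ('b, real^3) mfd \<Rightarrow> 'b set \<Rightarrow> ('b, real^3) form1 \<Rightarrow> ('b, real^3) form1 \<Rightarrow> ('a \<Rightarrow> 'b) \<Rightarrow> bool" where
  "carries_coframe M W \<omega> \<omega>\<^sub>1 M' W' \<omega>' \<omega>\<^sub>1' \<phi> \<longleftrightarrow>
     diffeo_between M W M' W' \<phi> \<and>
     form_eq M W (pullback M' \<phi> \<omega>') \<omega> \<and>
     form_eq M W (pullback M' \<phi> \<omega>\<^sub>1') \<omega>\<^sub>1 \<and>
     form_eq M W (pullback M' \<phi> (cnj_form \<omega>\<^sub>1')) (cnj_form \<omega>\<^sub>1)"

end

theory Submission
  imports Defs
begin

text \<open>
  Write \<open>\<tau>\<close> for the pullback of \<open>\<Omega>\<close> along a section of \<open>N\<^sub>0\<close>, so that \<open>\<tau> + cnj \<tau> = 2 (A\<^sub>1 \<omega>\<^sub>1 + cnj A\<^sub>1 cnj \<omega>\<^sub>1)\<close>.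
  As \<open>d\<omega>\<close> determines \<open>\<tau> + cnj \<tau>\<close> modulo \<open>\<omega>\<close>, and \<open>\<omega>\<close> depends on the section only through \<open>|z|\<close>,
  the product \<open>A\<^sub>1 z\<close> is a smooth function on the base; rotating \<open>z\<close> makes \<open>A\<^sub>1\<close> positive.  Then
  \<open>d(\<tau> + cnj \<tau>) = 0\<close> forces the \<open>\<omega>\<close>-component of \<open>Im \<tau>\<close> to vanish, which defines \<open>B\<^sub>1\<close>, and the
  structure equations are the pulled-back Cartan equations.

  Conversely, the structure equations determine the coframe.  If \<open>(f \<omega>, h \<omega>\<^sub>1)\<close> satisfies them too, then
  \<open>f = |h|\<^sup>2\<close>, and comparing the connection forms \<open>A\<^sub>1 (\<omega>\<^sub>1 + cnj \<omega>\<^sub>1) + i (B\<^sub>1 \<omega>\<^sub>1 + cnj (B\<^sub>1 \<omega>\<^sub>1))\<close> gives a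
  difference \<open>dh / h\<close>, which is closed.  Its imaginary part yields \<open>\<epsilon>' |h|\<^sup>2 = \<epsilon>\<close>, hence \<open>|h| = 1\<close>, and then
  \<open>A\<^sub>1' h = A\<^sub>1\<close> with both invariants positive gives \<open>h = 1\<close>.  Applied in charts to the pullback of the
  second coframe, this makes every equivalence carry one coframe to the other.
\<close>

section \<open>Smooth functions on open sets\<close>

text \<open>Smoothness of A1 and B1 is therefore recovered by Cramer's rule from the smooth pullback
  of \<Omega>, first along the trial section z = sqrt |k1|, then along the rotated one. The modulus
  of z is fixed by K1 = +-1, so only a phase is free; since A1 z does not depend on it, A1 turns
  against z and exactly one phase makes it positive.

  In the converse the factor h enters through dh / h, whose closedness is checked by
  differentiation, without a branch of log h. The value h = 1 then comes out pointwise from the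
  normalisations of K1 and A1, with no constant of integration, so M may be disconnected. As only
  the structure equations enter, one argument compares both the coframes built from different
  choices for one structure and a coframe with the pullback of one on another manifold.\<close>

abbreviation fd :: "('e::real_normed_vector \<Rightarrow> 'f::real_normed_vector) \<Rightarrow> 'e \<Rightarrow> 'e \<Rightarrow> 'f" where
  "fd f x \<equiv> frechet_derivative f (at x)"

lemma fd_eqI: "(f has_derivative f') (at x) \<Longrightarrow> fd f x = f'"
  by (rule frechet_derivative_at[symmetric])

lemma has_derivative_fd: "f differentiable (at x) \<Longrightarrow> (f has_derivative fd f x) (at x)"
  by (simp add: frechet_derivative_works)

lemma linear_fd: "f differentiable (at x) \<Longrightarrow> linear (fd f x)"
  by (rule linear_frechet_derivative)

text \<open>\<open>frechet_derivative\<close> chooses among the derivatives at the point, and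
  functions that agree nearby have the same candidates. The equality thus also holds where there is
  no derivative.\<close>

lemma fd_cong:
  assumes "open S" "x \<in> S" "\<And>y. y \<in> S \<Longrightarrow> f y = g y"
  shows "fd f x = fd g x"
proof -
  have "(f has_derivative F) (at x) \<longleftrightarrow> (g has_derivative F) (at x)" for F
    using assms has_derivative_transform_within_open[of f F x UNIV S g]
      has_derivative_transform_within_open[of g F x UNIV S f] by auto
  then show ?thesis by (simp add: frechet_derivative_def)
qed

text \<open>The last premise is \<open>Ck_on_cong\<close> at level \<open>k\<close>, whose own induction step uses this rule.\<close>

lemma Ck_on_SucI:
  fixes f :: "'e::euclidean_space \<Rightarrow> 'f::real_normed_vector"
  assumes "open S" "\<And>x. x \<in> S \<Longrightarrow> (f has_derivative f' x) (at x)"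
    "\<And>v. Ck_on k (\<lambda>x. f' x v) S"
    "\<And>g h :: 'e \<Rightarrow> 'f. (\<And>x. x \<in> S \<Longrightarrow> g x = h x) \<Longrightarrow> Ck_on k g S \<Longrightarrow> Ck_on k h S"
  shows "Ck_on (Suc k) f S"
proof -
  have "Ck_on k (\<lambda>x. fd f x v) S" for v
    by (rule assms(4)[where g = "\<lambda>x. f' x v"]) (simp_all add: assms(3) fd_eqI[OF assms(2)])
  moreover have "f differentiable_on S"
    using assms(2) by (meson differentiableI differentiable_at_imp_differentiable_on)
  ultimately show ?thesis by simp
qed

lemma Ck_on_cong:
  assumes "open S" "\<And>x. x \<in> S \<Longrightarrow> f x = g x" "Ck_on k f S"
  shows "Ck_on k g S"
  using assms
proof (induction k arbitrary: f g)
  case 0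
  then show ?case by (simp cong: continuous_on_cong)
next
  case (Suc k)
  have d: "(g has_derivative fd f x) (at x)" if "x \<in> S" for x
  proof -
    have "f differentiable (at x)"
      using Suc.prems that by (simp add: differentiable_on_eq_differentiable_at)
    then show ?thesis
      using has_derivative_transform_within_open[OF has_derivative_fd \<open>open S\<close> that] Suc.prems by blast
  qed
  show ?case
    by (rule Ck_on_SucI[OF \<open>open S\<close> d]) (use Suc in auto)
qed

lemma Ck_onI:
  assumes "open S" "\<And>x. x \<in> S \<Longrightarrow> (f has_derivative f' x) (at x)" "\<And>v. Ck_on k (\<lambda>x. f' x v) S"
  shows "Ck_on (Suc k) f S"
  using Ck_on_SucI[OF assms] Ck_on_cong[OF assms(1)] by blast

lemma Ck_on_has_derivative:
  "open S \<Longrightarrow> Ck_on (Suc k) f S \<Longrightarrow> x \<in> S \<Longrightarrow> (f has_derivative fd f x) (at x)"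
  by (simp add: differentiable_on_eq_differentiable_at has_derivative_fd)

text \<open>\<open>Ck_on\<close> records no lower orders, so the order is lowered by induction, with
  differentiability giving continuity at the bottom.\<close>

lemma Ck_on_Suc_imp: "Ck_on (Suc k) f S \<Longrightarrow> Ck_on k f S"
proof (induction k arbitrary: f)
  case 0
  then show ?case by (simp add: differentiable_imp_continuous_on)
next
  case (Suc k)
  then show ?case by (metis Ck_on.simps(2))
qed

lemma Ck_on_const: "Ck_on k (\<lambda>x. c) S"
  by (induction k arbitrary: c) auto

lemma Ck_on_linear_compose:
  assumes "open S" "bounded_linear L" "Ck_on k f S"
  shows "Ck_on k (\<lambda>x. L (f x)) S"
  using assms(3)
proof (induction k arbitrary: f)
  case 0
  then show ?case using bounded_linear.continuous_on[OF assms(2)] by simp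
next
  case (Suc k)
  show ?case
  proof (rule Ck_onI[OF assms(1)])
    show "((\<lambda>x. L (f x)) has_derivative (\<lambda>v. L (fd f x v))) (at x)" if "x \<in> S" for x
      using bounded_linear.has_derivative[OF assms(2) Ck_on_has_derivative[OF assms(1) Suc.prems that]] .
    show "Ck_on k (\<lambda>x. L (fd f x v)) S" for v
      using Suc by simp
  qed
qed

lemma Ck_on_add:
  assumes "open S" "Ck_on k f S" "Ck_on k g S"
  shows "Ck_on k (\<lambda>x. f x + g x) S"
  using assms(2,3)
proof (induction k arbitrary: f g)
  case 0
  then show ?case by (simp add: continuous_on_add)
next
  case (Suc k)
  show ?case
  proof (rule Ck_onI[OF assms(1)])
    show "((\<lambda>x. f x + g x) has_derivative (\<lambda>v. fd f x v + fd g x v)) (at x)" if "x \<in> S" for x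
      by (rule has_derivative_add[OF Ck_on_has_derivative[OF assms(1) Suc.prems(1) that]
            Ck_on_has_derivative[OF assms(1) Suc.prems(2) that]])
    show "Ck_on k (\<lambda>x. fd f x v + fd g x v) S" for v
      using Suc by simp
  qed
qed

lemma Ck_on_bilinear:
  assumes "open S" "bounded_bilinear p" "Ck_on k f S" "Ck_on k g S"
  shows "Ck_on k (\<lambda>x. p (f x) (g x)) S"
  using assms(3,4)
proof (induction k arbitrary: f g)
  case 0
  then show ?case using bounded_bilinear.continuous_on[OF assms(2)] by simp
next
  case (Suc k)
  show ?case
  proof (rule Ck_onI[OF assms(1)])
    show "((\<lambda>x. p (f x) (g x)) has_derivative (\<lambda>v. p (f x) (fd g x v) + p (fd f x v) (g x))) (at x)"
      if "x \<in> S" for x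
      by (rule bounded_bilinear.FDERIV[OF assms(2) Ck_on_has_derivative[OF assms(1) Suc.prems(1) that]
            Ck_on_has_derivative[OF assms(1) Suc.prems(2) that]])
    show "Ck_on k (\<lambda>x. p (f x) (fd g x v) + p (fd f x v) (g x)) S" for v
      using Suc.prems Ck_on_Suc_imp[OF Suc.prems(1)] Ck_on_Suc_imp[OF Suc.prems(2)]
      by (intro Ck_on_add[OF assms(1)] Suc.IH) auto
  qed
qed

text \<open>In the chain rule the outer derivative acts on the moving vector
  \<open>fd g x v\<close>, while \<open>Ck_on\<close> speaks of fixed directions. Expanding the
  vector in the basis leaves derivatives of \<open>f\<close> along fixed b, composed with
  \<open>g\<close>, to which the induction hypothesis applies.\<close>

lemma Ck_on_compose:
  fixes f :: "'e::euclidean_space \<Rightarrow> 'f::real_normed_vector" and g :: "'d::euclidean_space \<Rightarrow> 'e"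
  assumes "open S" "open T" "g ` S \<subseteq> T" "Ck_on k f T" "Ck_on k g S"
  shows "Ck_on k (\<lambda>x. f (g x)) S"
  using assms(4,5)
proof (induction k arbitrary: f)
  case 0
  then show ?case using continuous_on_compose2[of T f S g] assms(3) by simp
next
  case (Suc k)
  have df: "(f has_derivative fd f y) (at y)" if "y \<in> T" for y
    by (rule Ck_on_has_derivative[OF assms(2) Suc.prems(1) that])
  have dg: "(g has_derivative fd g x) (at x)" if "x \<in> S" for x
    by (rule Ck_on_has_derivative[OF assms(1) Suc.prems(2) that])
  have eq: "fd f (g x) (fd g x v) = (\<Sum>b\<in>Basis. (fd g x v \<bullet> b) *\<^sub>R fd f (g x) b)"
    if "x \<in> S" for x v
  proof -
    interpret linear "fd f (g x)"
      using df[of "g x"] that assms(3) by (auto intro: has_derivative_linear)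
    show ?thesis
      by (subst euclidean_representation[of "fd g x v", symmetric]) (simp add: sum scale)
  qed
  show ?case
  proof (rule Ck_onI[OF assms(1)])
    show "((\<lambda>x. f (g x)) has_derivative (\<lambda>v. fd f (g x) (fd g x v))) (at x)" if "x \<in> S" for x
      using has_derivative_compose[OF dg[OF that]] df[of "g x"] that assms(3) by blast
    have s: "Ck_on k (\<lambda>x. \<Sum>b\<in>B. (fd g x v \<bullet> b) *\<^sub>R fd f (g x) b) S" if "finite B" for v B
      using that
    proof (induction B)
      case empty
      then show ?case by (simp add: Ck_on_const)
    next
      case (insert b B)
      have 1: "Ck_on k (\<lambda>x. fd f (g x) b) S"
        by (rule Suc.IH) (use Suc.prems Ck_on_Suc_imp[OF Suc.prems(2)] in auto)
      have 2: "Ck_on k (\<lambda>x. fd g x v \<bullet> b) S"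
        using Suc.prems by (intro Ck_on_linear_compose[OF assms(1) bounded_linear_inner_left]) simp
      show ?case
        using insert Ck_on_add[OF assms(1) Ck_on_bilinear[OF assms(1) bounded_bilinear_scaleR 2 1]] by simp
    qed
    show "Ck_on k (\<lambda>x. fd f (g x) (fd g x v)) S" for v
      by (rule Ck_on_cong[OF assms(1) _ s[of Basis v]]) (simp_all add: eq)
  qed
qed

text \<open>The derivative contains \<open>inverse (f x)\<close> itself, so the induction is on the
  order with \<open>f\<close> fixed. The same device serves for the square root.\<close>

lemma Ck_on_inverse:
  fixes f :: "'e::euclidean_space \<Rightarrow> 'f::real_normed_field"
  assumes "open S" "\<And>x. x \<in> S \<Longrightarrow> f x \<noteq> 0" "Ck_on k f S"
  shows "Ck_on k (\<lambda>x. inverse (f x)) S"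
  using assms(3)
proof (induction k)
  case 0
  then show ?case using assms(2) by (simp add: continuous_on_inverse)
next
  case (Suc k)
  show ?case
  proof (rule Ck_onI[OF assms(1)])
    show "((\<lambda>x. inverse (f x)) has_derivative (\<lambda>v. - (inverse (f x) * fd f x v * inverse (f x)))) (at x)"
      if "x \<in> S" for x
      using Deriv.has_derivative_inverse[OF assms(2)[OF that] Ck_on_has_derivative[OF assms(1) Suc.prems that]] .
    show "Ck_on k (\<lambda>x. - (inverse (f x) * fd f x v * inverse (f x))) S" for v
      using Suc.prems Ck_on_Suc_imp[OF Suc.prems]
      by (intro Ck_on_linear_compose[OF assms(1), of uminus] Ck_on_bilinear[OF assms(1) bounded_bilinear_mult]
          Suc.IH bounded_linear_minus bounded_linear_ident) auto
  qed
qed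

lemma Ck_on_sqrt:
  fixes f :: "'e::euclidean_space \<Rightarrow> real"
  assumes "open S" "\<And>x. x \<in> S \<Longrightarrow> f x > 0" "Ck_on k f S"
  shows "Ck_on k (\<lambda>x. sqrt (f x)) S"
  using assms(3)
proof (induction k)
  case 0
  then show ?case by (simp add: continuous_on_real_sqrt)
next
  case (Suc k)
  show ?case
  proof (rule Ck_onI[OF assms(1)])
    show "((\<lambda>x. sqrt (f x)) has_derivative (\<lambda>v. fd f x v * (inverse 2 * inverse (sqrt (f x))))) (at x)"
      if "x \<in> S" for x
      using DERIV_compose_FDERIV[OF DERIV_real_sqrt[OF assms(2)[OF that]]
          Ck_on_has_derivative[OF assms(1) Suc.prems that]] by (simp add: field_simps)
    have p: "sqrt (f x) \<noteq> 0" if "x \<in> S" for x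
      using assms(2)[OF that] by simp
    show "Ck_on k (\<lambda>x. fd f x v * (inverse 2 * inverse (sqrt (f x)))) S" for v
      using Suc.prems Ck_on_Suc_imp[OF Suc.prems] p
      by (intro Ck_on_bilinear[OF assms(1) bounded_bilinear_mult] Ck_on_inverse[OF assms(1)]
          Suc.IH Ck_on_const) auto
  qed
qed

section \<open>Rules for infinitely differentiable functions\<close>

lemma smooth_on_cong:
  "open S \<Longrightarrow> (\<And>x. x \<in> S \<Longrightarrow> f x = g x) \<Longrightarrow> smooth_on f S \<Longrightarrow> smooth_on g S"
  unfolding smooth_on_def using Ck_on_cong by blast

lemma Ck_on_subset: "Ck_on k f S \<Longrightarrow> T \<subseteq> S \<Longrightarrow> Ck_on k f T"
  by (induction k arbitrary: f) (auto intro: continuous_on_subset differentiable_on_subset)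

lemma smooth_on_subset: "smooth_on f S \<Longrightarrow> T \<subseteq> S \<Longrightarrow> smooth_on f T"
  unfolding smooth_on_def using Ck_on_subset by blast

lemma smooth_on_differentiable:
  assumes "smooth_on f S" "open S" "x \<in> S"
  shows "f differentiable (at x)"
proof -
  have "Ck_on (Suc 0) f S" using assms(1) unfolding smooth_on_def by blast
  then show ?thesis using assms by (simp add: differentiable_on_eq_differentiable_at)
qed

lemma smooth_on_has_derivative:
  "smooth_on f S \<Longrightarrow> open S \<Longrightarrow> x \<in> S \<Longrightarrow> (f has_derivative fd f x) (at x)"
  by (simp add: has_derivative_fd smooth_on_differentiable)

lemma smooth_on_continuous: "smooth_on f S \<Longrightarrow> continuous_on S f"
  unfolding smooth_on_def by (metis Ck_on.simps(1))

lemma smooth_on_fd: "smooth_on f S \<Longrightarrow> smooth_on (\<lambda>x. fd f x v) S"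
  unfolding smooth_on_def by (metis Ck_on.simps(2))

lemma smooth_on_const: "smooth_on (\<lambda>x. c) S"
  by (simp add: smooth_on_def Ck_on_const)

lemma smooth_on_linear_compose:
  "open S \<Longrightarrow> bounded_linear L \<Longrightarrow> smooth_on f S \<Longrightarrow> smooth_on (\<lambda>x. L (f x)) S"
  by (simp add: smooth_on_def Ck_on_linear_compose)

lemma smooth_on_id:
  assumes "open S"
  shows "smooth_on (\<lambda>x. x) S"
  unfolding smooth_on_def
proof
  show "Ck_on k (\<lambda>x. x) S" for k
    by (cases k) (auto intro: Ck_onI[OF assms has_derivative_ident] Ck_on_const)
qed

lemma smooth_on_bounded_linear: "open S \<Longrightarrow> bounded_linear L \<Longrightarrow> smooth_on L S"
  using smooth_on_linear_compose[OF _ _ smooth_on_id] .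

lemma smooth_on_add:
  "open S \<Longrightarrow> smooth_on f S \<Longrightarrow> smooth_on g S \<Longrightarrow> smooth_on (\<lambda>x. f x + g x) S"
  by (simp add: smooth_on_def Ck_on_add)

lemma smooth_on_minus: "open S \<Longrightarrow> smooth_on f S \<Longrightarrow> smooth_on (\<lambda>x. - f x) S"
  by (rule smooth_on_linear_compose[OF _ bounded_linear_minus[OF bounded_linear_ident]])

lemma smooth_on_diff:
  "open S \<Longrightarrow> smooth_on f S \<Longrightarrow> smooth_on g S \<Longrightarrow> smooth_on (\<lambda>x. f x - g x) S"
  using smooth_on_add[OF _ _ smooth_on_minus, of S f g] by simp

lemma smooth_on_sum:
  assumes "open S" "\<And>i. i \<in> B \<Longrightarrow> smooth_on (f i) S"
  shows "smooth_on (\<lambda>x. \<Sum>i\<in>B. f i x) S"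
  using assms(2) by (induction B rule: infinite_finite_induct)
    (auto simp: smooth_on_const intro: smooth_on_add[OF assms(1)])

lemma smooth_on_scaleR:
  "open S \<Longrightarrow> smooth_on f S \<Longrightarrow> smooth_on g S \<Longrightarrow> smooth_on (\<lambda>x. f x *\<^sub>R g x) S"
  by (simp add: smooth_on_def Ck_on_bilinear bounded_bilinear_scaleR)

lemma smooth_on_mult:
  fixes f g :: "'e::euclidean_space \<Rightarrow> 'f::real_normed_algebra"
  shows "open S \<Longrightarrow> smooth_on f S \<Longrightarrow> smooth_on g S \<Longrightarrow> smooth_on (\<lambda>x. f x * g x) S"
  by (simp add: smooth_on_def Ck_on_bilinear bounded_bilinear_mult)

lemma smooth_on_divide:
  fixes f g :: "'e::euclidean_space \<Rightarrow> 'f::real_normed_field"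
  assumes "open S" "smooth_on f S" "smooth_on g S" "\<And>x. x \<in> S \<Longrightarrow> g x \<noteq> 0"
  shows "smooth_on (\<lambda>x. f x / g x) S"
proof -
  have "smooth_on (\<lambda>x. inverse (g x)) S"
    using assms by (simp add: smooth_on_def Ck_on_inverse)
  then show ?thesis
    using smooth_on_mult[OF assms(1,2)] by (simp add: divide_inverse)
qed

lemma smooth_on_sqrt: "open S \<Longrightarrow> smooth_on f S \<Longrightarrow> (\<And>x. x \<in> S \<Longrightarrow> f x > 0) \<Longrightarrow> smooth_on (\<lambda>x. sqrt (f x)) S"
  by (simp add: smooth_on_def Ck_on_sqrt)

lemma smooth_on_of_real:
  "open S \<Longrightarrow> smooth_on f S \<Longrightarrow> smooth_on (\<lambda>x. of_real (f x) :: complex) S"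
  by (rule smooth_on_linear_compose[OF _ bounded_linear_of_real])

lemma smooth_on_cnj: "open S \<Longrightarrow> smooth_on f S \<Longrightarrow> smooth_on (\<lambda>x. cnj (f x)) S"
  by (rule smooth_on_linear_compose[OF _ bounded_linear_cnj])

lemma smooth_on_compose:
  fixes f :: "'e::euclidean_space \<Rightarrow> 'f::real_normed_vector" and g :: "'d::euclidean_space \<Rightarrow> 'e"
  assumes "open S" "open T" "\<And>x. x \<in> S \<Longrightarrow> g x \<in> T" "smooth_on f T" "smooth_on g S"
  shows "smooth_on (\<lambda>x. f (g x)) S"
  using assms by (auto simp: smooth_on_def intro: Ck_on_compose)

lemma smooth_on_abs:
  fixes f :: "'e::euclidean_space \<Rightarrow> real"
  assumes "open S" "smooth_on f S" "\<And>x. x \<in> S \<Longrightarrow> f x \<noteq> 0"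
  shows "smooth_on (\<lambda>x. \<bar>f x\<bar>) S"
proof -
  have "smooth_on (\<lambda>x. sqrt (f x * f x)) S"
    using assms(3) by (intro smooth_on_sqrt smooth_on_mult assms) (auto simp: zero_less_mult_iff linorder_neq_iff)
  then show ?thesis by simp
qed

lemma smooth_on_cmod:
  assumes "open S" "smooth_on f S" "\<And>x. x \<in> S \<Longrightarrow> f x \<noteq> 0"
  shows "smooth_on (\<lambda>x. cmod (f x)) S"
proof -
  have "smooth_on (\<lambda>x. sqrt (Re (f x) * Re (f x) + Im (f x) * Im (f x))) S"
    by (intro smooth_on_sqrt smooth_on_mult smooth_on_add assms
        smooth_on_linear_compose[OF _ bounded_linear_Re] smooth_on_linear_compose[OF _ bounded_linear_Im])
      (use assms(3) in \<open>simp add: complex_eq_iff sum_squares_gt_zero_iff\<close>)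
  then show ?thesis by (simp add: cmod_def power2_eq_square)
qed

lemma smooth_on_Pair:
  fixes f :: "'d::euclidean_space \<Rightarrow> 'e::euclidean_space" and g :: "'d \<Rightarrow> 'f::euclidean_space"
  assumes "open S" "smooth_on f S" "smooth_on g S"
  shows "smooth_on (\<lambda>x. (f x, g x)) S"
proof -
  have "smooth_on (\<lambda>x. (f x, 0) + (0, g x)) S"
    by (intro smooth_on_add assms smooth_on_linear_compose[OF assms(1), of "\<lambda>y. (y, 0)"]
        smooth_on_linear_compose[OF assms(1), of "\<lambda>y. (0, y)"] bounded_linear_Pair
        bounded_linear_ident bounded_linear_zero)
  then show ?thesis by simp
qed

text \<open>The left-hand side is symmetric in \<open>u\<close> and \<open>v\<close>, hence so is the limit of the right-hand side.\<close>

lemma second_difference: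
  fixes f :: "'e::euclidean_space \<Rightarrow> real"
  assumes f: "smooth_on f S" "open S" and t: "t > 0"
    and S: "\<And>r s. 0 \<le> r \<Longrightarrow> r \<le> t \<Longrightarrow> 0 \<le> s \<Longrightarrow> s \<le> t \<Longrightarrow> x + r *\<^sub>R u + s *\<^sub>R v \<in> S"
  shows "\<exists>r s. 0 \<le> r \<and> r \<le> t \<and> 0 \<le> s \<and> s \<le> t \<and>
    f (x + t *\<^sub>R u + t *\<^sub>R v) - f (x + t *\<^sub>R u) - f (x + t *\<^sub>R v) + f x
      = t * t * fd (\<lambda>y. fd f y u) (x + r *\<^sub>R u + s *\<^sub>R v) v"
proof -
  have line: "((\<lambda>r. g (p + r *\<^sub>R w)) has_real_derivative fd g (p + r *\<^sub>R w) w) (at r)"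
    if "smooth_on g S" "p + r *\<^sub>R w \<in> S" for g :: "'e \<Rightarrow> real" and p w r
  proof -
    have d: "(g has_derivative fd g (p + r *\<^sub>R w)) (at (p + r *\<^sub>R w))"
      by (rule smooth_on_has_derivative[OF that(1) f(2) that(2)])
    have "((\<lambda>r. p + r *\<^sub>R w) has_derivative (\<lambda>h. h *\<^sub>R w)) (at r)"
      by (auto intro!: derivative_eq_intros)
    from has_derivative_compose[OF this d] show ?thesis
      by (simp add: has_field_derivative_def linear_cmul[OF has_derivative_linear[OF d]] mult_commute_abs)
  qed
  \<comment> \<open>The second difference is F t - F 0. One mean value theorem along u turns it into
    a difference of first derivatives, another along v into a mixed derivative.\<close>
  define F where "F r = f (x + t *\<^sub>R v + r *\<^sub>R u) - f (x + r *\<^sub>R u)" for r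
  have "(F has_real_derivative (fd f (x + t *\<^sub>R v + r *\<^sub>R u) u - fd f (x + r *\<^sub>R u) u)) (at r)"
    if "0 \<le> r" "r \<le> t" for r
    unfolding F_def using S[OF that, of t] S[OF that, of 0] t f(1)
    by (intro derivative_intros line) (simp_all add: algebra_simps)
  from MVT2[OF t this] obtain r where r: "0 < r" "r < t"
    "F t - F 0 = t * (fd f (x + t *\<^sub>R v + r *\<^sub>R u) u - fd f (x + r *\<^sub>R u) u)" by auto
  define G where "G s = fd f (x + r *\<^sub>R u + s *\<^sub>R v) u" for s
  have "(G has_real_derivative (fd (\<lambda>y. fd f y u) (x + r *\<^sub>R u + s *\<^sub>R v) v)) (at s)"
    if "0 \<le> s" "s \<le> t" for s
    unfolding G_def using S[of r s] that r f(1)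
    by (intro line[of "\<lambda>y. fd f y u"] smooth_on_fd) auto
  from MVT2[OF t this] obtain s where s: "0 < s" "s < t"
    "G t - G 0 = t * fd (\<lambda>y. fd f y u) (x + r *\<^sub>R u + s *\<^sub>R v) v" by auto
  show ?thesis
    by (rule exI[of _ r], rule exI[of _ s])
      (use r s in \<open>auto simp: F_def G_def algebra_simps\<close>)
qed

text \<open>Schwarz's theorem: the second difference, expanded in both orders, equates the two mixed
  derivatives at points arbitrarily close to x, and both are continuous there.\<close>

lemma fd_fd_commute_real:
  fixes f :: "'e::euclidean_space \<Rightarrow> real"
  assumes f: "smooth_on f S" "open S" "x \<in> S"
  shows "fd (\<lambda>y. fd f y u) x v = fd (\<lambda>y. fd f y v) x u"
proof -
  let ?P = "\<lambda>y. fd (\<lambda>y. fd f y u) y v" and ?Q = "\<lambda>y. fd (\<lambda>y. fd f y v) y u"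
  have "\<bar>?P x - ?Q x\<bar> \<le> e" if "e > 0" for e
  proof -
    have c: "continuous_on S ?P" "continuous_on S ?Q"
      by (intro smooth_on_continuous smooth_on_fd f(1))+
    have "isCont ?P x" "isCont ?Q x"
      using c f(2,3) by (simp_all add: continuous_on_eq_continuous_at)
    then have "(?P \<longlongrightarrow> ?P x) (nhds x)" "(?Q \<longlongrightarrow> ?Q x) (nhds x)"
      unfolding continuous_at using tendsto_at_iff_tendsto_nhds[of ?P x] tendsto_at_iff_tendsto_nhds[of ?Q x]
      by blast+
    then have "eventually (\<lambda>y. dist (?P y) (?P x) < e/2 \<and> dist (?Q y) (?Q x) < e/2 \<and> y \<in> S) (nhds x)"
      using that f(2,3) by (intro eventually_conj eventually_nhds_in_open) (auto dest!: tendstoD[of _ _ _ "e/2"])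
    then obtain d where d: "d > 0" and dP:
      "\<And>y. dist y x < d \<Longrightarrow> dist (?P y) (?P x) < e/2 \<and> dist (?Q y) (?Q x) < e/2 \<and> y \<in> S"
      unfolding eventually_nhds_metric by blast
    \<comment> \<open>With this t the whole parallelogram stays in the ball of radius d; the summand
      1 covers u = v = 0, and the factor 1/2 makes the bound strict.\<close>
    define t where "t = d / (norm u + norm v + 1) / 2"
    have t: "t > 0" unfolding t_def using d by (simp add: add_nonneg_pos)
    \<comment> \<open>Here a and b stand for u and v in either order, so one estimate serves both
      expansions.\<close>
    have near: "dist (x + r *\<^sub>R a + s *\<^sub>R b) x < d"
      if "0 \<le> r" "r \<le> t" "0 \<le> s" "s \<le> t" "norm a + norm b = norm u + norm v" for r s a b
    proof -
      have "dist (x + r *\<^sub>R a + s *\<^sub>R b) x \<le> norm (r *\<^sub>R a) + norm (s *\<^sub>R b)"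
        using norm_triangle_ineq[of "r *\<^sub>R a" "s *\<^sub>R b"] by (simp add: dist_norm)
      also have "\<dots> \<le> t * norm a + t * norm b"
        using that by (intro add_mono) (simp_all add: mult_right_mono)
      also have "\<dots> = t * (norm u + norm v)"
        using that(5) by (metis distrib_left)
      also have "\<dots> < d"
      proof -
        have "t * (norm u + norm v) \<le> t * (norm u + norm v + 1)"
          using t by simp
        also have "\<dots> = d / 2"
          unfolding t_def by (simp add: divide_simps) (smt (verit) norm_ge_zero)
        finally show ?thesis using d by simp
      qed
      finally show ?thesis .
    qed
    obtain r s where rs: "0 \<le> r" "r \<le> t" "0 \<le> s" "s \<le> t"
      "f (x + t *\<^sub>R u + t *\<^sub>R v) - f (x + t *\<^sub>R u) - f (x + t *\<^sub>R v) + f x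
      = t * t * ?P (x + r *\<^sub>R u + s *\<^sub>R v)"
      using second_difference[OF f(1,2) t, of x u v] dP near[of _ _ u v] by blast
    obtain r' s' where rs': "0 \<le> r'" "r' \<le> t" "0 \<le> s'" "s' \<le> t"
      "f (x + t *\<^sub>R v + t *\<^sub>R u) - f (x + t *\<^sub>R v) - f (x + t *\<^sub>R u) + f x
      = t * t * ?Q (x + r' *\<^sub>R v + s' *\<^sub>R u)"
      using second_difference[OF f(1,2) t, of x v u] dP near[of _ _ v u]
      by (metis add.commute)
    have "t * t * ?P (x + r *\<^sub>R u + s *\<^sub>R v) = t * t * ?Q (x + r' *\<^sub>R v + s' *\<^sub>R u)"
      using rs(5) rs'(5) by (simp add: algebra_simps)
    then have "?P (x + r *\<^sub>R u + s *\<^sub>R v) = ?Q (x + r' *\<^sub>R v + s' *\<^sub>R u)"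
      using t by simp
    moreover have "dist (?P (x + r *\<^sub>R u + s *\<^sub>R v)) (?P x) < e/2"
      using dP near[OF rs(1-4), of u v] by simp
    moreover have "dist (?Q (x + r' *\<^sub>R v + s' *\<^sub>R u)) (?Q x) < e/2"
      using dP near[OF rs'(1-4), of v u] by simp
    ultimately show ?thesis unfolding dist_real_def by linarith
  qed
  then show ?thesis
    by (metis abs_le_zero_iff eq_iff_diff_eq_0 field_le_epsilon add_0)
qed

lemma fd_linear_compose:
  assumes "bounded_linear L" "f differentiable (at x)"
  shows "fd (\<lambda>y. L (f y)) x = (\<lambda>v. L (fd f x v))"
  by (rule fd_eqI[OF bounded_linear.has_derivative[OF assms(1) has_derivative_fd[OF assms(2)]]])

lemma fd_fd_commute:
  fixes f :: "'e::euclidean_space \<Rightarrow> 'f::euclidean_space"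
  assumes f: "smooth_on f S" "open S" "x \<in> S"
  shows "fd (\<lambda>y. fd f y u) x v = fd (\<lambda>y. fd f y v) x u"
proof (rule euclidean_eqI)
  fix b :: 'f assume "b \<in> Basis"
  have 1: "fd (\<lambda>y. fd (\<lambda>z. f z \<bullet> b) y u) x v = fd (\<lambda>y. fd f y u) x v \<bullet> b" for u v
  proof -
    have "fd (\<lambda>y. fd (\<lambda>z. f z \<bullet> b) y u) x = fd (\<lambda>y. fd f y u \<bullet> b) x"
      by (rule fd_cong[OF f(2,3)])
        (simp add: fd_linear_compose[OF bounded_linear_inner_left] smooth_on_differentiable[OF f(1,2)])
    then show ?thesis
      by (simp add: fd_linear_compose[OF bounded_linear_inner_left]
          smooth_on_differentiable[OF smooth_on_fd[OF f(1)] f(2,3)])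
  qed
  have "smooth_on (\<lambda>z. f z \<bullet> b) S"
    by (rule smooth_on_linear_compose[OF f(2) bounded_linear_inner_left f(1)])
  from fd_fd_commute_real[OF this f(2,3), of u v]
  show "fd (\<lambda>y. fd f y u) x v \<bullet> b = fd (\<lambda>y. fd f y v) x u \<bullet> b"
    by (simp add: 1)
qed

lemma fd_mult:
  fixes f g :: "'e::real_normed_vector \<Rightarrow> 'f::real_normed_algebra"
  assumes "f differentiable (at x)" "g differentiable (at x)"
  shows "fd (\<lambda>y. f y * g y) x = (\<lambda>v. f x * fd g x v + fd f x v * g x)"
  by (rule fd_eqI[OF has_derivative_mult[OF assms[THEN has_derivative_fd]]])

lemma fd_add:
  assumes "f differentiable (at x)" "g differentiable (at x)"
  shows "fd (\<lambda>y. f y + g y) x = (\<lambda>v. fd f x v + fd g x v)"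
  by (rule fd_eqI[OF has_derivative_add[OF assms[THEN has_derivative_fd]]])

lemma fd_chain:
  assumes "g differentiable (at x)" "f differentiable (at (g x))"
  shows "fd (\<lambda>y. f (g y)) x = (\<lambda>v. fd f (g x) (fd g x v))"
  by (rule fd_eqI[OF has_derivative_compose[OF assms[THEN has_derivative_fd]]])

section \<open>Exterior derivatives and pullbacks in coordinates\<close>

text \<open>By \<open>d1_def\<close>, \<open>d1 \<alpha> c x\<close> is \<open>ed\<close> of the local expression of \<open>\<alpha>\<close> in \<open>c\<close>, at \<open>snd c x\<close>.\<close>

abbreviation ed :: "('e::euclidean_space \<Rightarrow> 'e \<Rightarrow> complex) \<Rightarrow> 'e \<Rightarrow> 'e \<Rightarrow> 'e \<Rightarrow> complex" where
  "ed \<alpha> y u v \<equiv> fd (\<lambda>z. \<alpha> z v) y u - fd (\<lambda>z. \<alpha> z u) y v"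

lemma linear_basis_expansion:
  fixes v :: "'e::euclidean_space" and L :: "'e \<Rightarrow> 'f::real_vector"
  assumes "linear L"
  shows "L v = (\<Sum>b\<in>Basis. (v \<bullet> b) *\<^sub>R L b)"
  by (subst euclidean_representation[of v, symmetric])
    (simp add: linear_sum[OF assms] linear_scale[OF assms])

context
  fixes \<Theta> :: "'f::euclidean_space \<Rightarrow> 'f \<Rightarrow> complex" and g :: "'e::euclidean_space \<Rightarrow> 'f" and V T
  assumes V: "open V" and T: "open T" and gVT: "\<And>y. y \<in> V \<Longrightarrow> g y \<in> T" and g: "smooth_on g V"
    and \<Theta>: "\<And>w. smooth_on (\<lambda>z. \<Theta> z w) T" and lin: "\<And>z. z \<in> T \<Longrightarrow> linear (\<Theta> z)"
begin

lemma smooth_on_pullback: "smooth_on (\<lambda>y. \<Theta> (g y) (fd g y v)) V"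
proof (rule smooth_on_cong[OF V])
  show "smooth_on (\<lambda>y. \<Sum>b\<in>Basis. (fd g y v \<bullet> b) *\<^sub>R \<Theta> (g y) b) V"
    by (intro smooth_on_sum smooth_on_scaleR V smooth_on_compose[OF V T gVT \<Theta> g]
        smooth_on_linear_compose[OF V bounded_linear_inner_left] smooth_on_fd g)
  show "(\<Sum>b\<in>Basis. (fd g y v \<bullet> b) *\<^sub>R \<Theta> (g y) b) = \<Theta> (g y) (fd g y v)" if "y \<in> V" for y
    by (rule linear_basis_expansion[OF lin[OF gVT[OF that]], symmetric])
qed

text \<open>The product rule for a form evaluated on a moving vector: one term differentiates the
  coefficients, the other inserts the Hessian of \<open>g\<close>. Expansion in the basis separates
  the two.\<close>

lemma fd_pullback:
  assumes x: "x \<in> V"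
  shows "fd (\<lambda>y. \<Theta> (g y) (fd g y v)) x u
    = fd (\<lambda>z. \<Theta> z (fd g x v)) (g x) (fd g x u) + \<Theta> (g x) (fd (\<lambda>y. fd g y v) x u)"
proof -
  let ?w = "fd g x v" and ?D = "\<lambda>b. fd (\<lambda>z. \<Theta> z b) (g x)"
  have dT: "((\<lambda>z. \<Theta> z b) has_derivative ?D b) (at (g x))" for b
    by (rule smooth_on_has_derivative[OF \<Theta> T gVT[OF x]])
  have 1: "((\<lambda>y. \<Theta> (g y) b) has_derivative (\<lambda>u. ?D b (fd g x u))) (at x)" for b
    by (rule has_derivative_compose[OF smooth_on_has_derivative[OF g V x] dT])
  have 2: "((\<lambda>y. fd g y v \<bullet> b) has_derivative (\<lambda>u. fd (\<lambda>y. fd g y v) x u \<bullet> b)) (at x)" for b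
    by (rule has_derivative_inner_left[OF smooth_on_has_derivative[OF smooth_on_fd[OF g] V x]])
  have "((\<lambda>y. \<Sum>b\<in>Basis. (fd g y v \<bullet> b) *\<^sub>R \<Theta> (g y) b) has_derivative
      (\<lambda>u. \<Sum>b\<in>Basis. (?w \<bullet> b) *\<^sub>R ?D b (fd g x u) + (fd (\<lambda>y. fd g y v) x u \<bullet> b) *\<^sub>R \<Theta> (g x) b)) (at x)"
    by (intro has_derivative_sum has_derivative_scaleR 1 2)
  moreover have "fd (\<lambda>y. \<Theta> (g y) (fd g y v)) x = fd (\<lambda>y. \<Sum>b\<in>Basis. (fd g y v \<bullet> b) *\<^sub>R \<Theta> (g y) b) x"
    by (rule fd_cong[OF V x]) (use linear_basis_expansion lin gVT in blast)
  ultimately have *: "fd (\<lambda>y. \<Theta> (g y) (fd g y v)) x u =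
     (\<Sum>b\<in>Basis. (?w \<bullet> b) *\<^sub>R ?D b (fd g x u) + (fd (\<lambda>y. fd g y v) x u \<bullet> b) *\<^sub>R \<Theta> (g x) b)"
    by (simp add: fd_eqI)
  have "((\<lambda>z. \<Sum>b\<in>Basis. (?w \<bullet> b) *\<^sub>R \<Theta> z b) has_derivative
      (\<lambda>u. \<Sum>b\<in>Basis. (?w \<bullet> b) *\<^sub>R ?D b u)) (at (g x))"
    by (intro has_derivative_sum has_derivative_scaleR_right dT)
  moreover have "fd (\<lambda>z. \<Theta> z ?w) (g x) = fd (\<lambda>z. \<Sum>b\<in>Basis. (?w \<bullet> b) *\<^sub>R \<Theta> z b) (g x)"
    by (rule fd_cong[OF T gVT[OF x]]) (use linear_basis_expansion lin in blast)
  ultimately have "fd (\<lambda>z. \<Theta> z ?w) (g x) (fd g x u) = (\<Sum>b\<in>Basis. (?w \<bullet> b) *\<^sub>R ?D b (fd g x u))"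
    by (simp add: fd_eqI)
  then show ?thesis
    unfolding * linear_basis_expansion[OF lin[OF gVT[OF x]], of "fd (\<lambda>y. fd g y v) x u"]
    by (simp add: sum.distrib)
qed

text \<open>The Hessian terms are symmetric in u and v and drop out of the antisymmetrisation, so d
  commutes with pullback.\<close>

lemma ed_pullback:
  assumes "x \<in> V"
  shows "ed (\<lambda>y v. \<Theta> (g y) (fd g y v)) x u v = ed \<Theta> (g x) (fd g x u) (fd g x v)"
  using fd_fd_commute[OF g V assms, of u v] by (simp add: fd_pullback[OF assms])

end

section \<open>Charts\<close>

text \<open>The consequences of \<open>smooth_manifold\<close> needed for the calculus of forms.  They do not mention
  the topology apart from its carrier, which makes them easy to transfer to \<open>bundle_P\<close>.\<close>

definition charted :: "('a, 'e::euclidean_space) mfd \<Rightarrow> bool" where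
  "charted M \<longleftrightarrow> points M = \<Union> (fst ` atlas M) \<and>
     (\<forall>c\<in>atlas M. open (snd c ` fst c) \<and> inj_on (snd c) (fst c)) \<and>
     (\<forall>c\<in>atlas M. \<forall>d\<in>atlas M. open (snd c ` (fst c \<inter> fst d)) \<and>
        smooth_on (snd d \<circ> chart_inv c) (snd c ` (fst c \<inter> fst d)))"

lemma chart_image_open:
  assumes "smooth_manifold M" "c \<in> atlas M" "openin (mfd_top M) T"
  shows "open (snd c ` (fst c \<inter> T))"
proof -
  have h: "homeomorphic_map (subtopology (mfd_top M) (fst c)) (top_of_set (snd c ` fst c)) (snd c)"
    and o: "open (snd c ` fst c)"
    using assms(1,2) by (auto simp: smooth_manifold_def)
  have "openin (subtopology (mfd_top M) (fst c)) (fst c \<inter> T)"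
    using assms(3) by (auto simp: openin_subtopology)
  with h have "openin (top_of_set (snd c ` fst c)) (snd c ` (fst c \<inter> T))"
    using homeomorphic_imp_open_map open_map_def by blast
  then show ?thesis using o by (auto simp: openin_open_eq)
qed

lemma smooth_manifold_charted: "smooth_manifold M \<Longrightarrow> charted M"
  unfolding charted_def
proof (intro conjI ballI)
  assume M: "smooth_manifold M"
  show "points M = \<Union> (fst ` atlas M)" using M by (simp add: smooth_manifold_def)
  fix c assume c: "c \<in> atlas M"
  show "open (snd c ` fst c)" using M c by (simp add: smooth_manifold_def)
  have h: "homeomorphic_map (subtopology (mfd_top M) (fst c)) (top_of_set (snd c ` fst c)) (snd c)"
    and o: "openin (mfd_top M) (fst c)"
    using M c by (auto simp: smooth_manifold_def)
  from homeomorphic_imp_injective_map[OF h] show "inj_on (snd c) (fst c)"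
    using openin_subset[OF o] by (simp add: inf.absorb2)
  fix d assume d: "d \<in> atlas M"
  show "open (snd c ` (fst c \<inter> fst d))"
    using M d by (intro chart_image_open[OF M c]) (auto simp: smooth_manifold_def)
  show "smooth_on (snd d \<circ> chart_inv c) (snd c ` (fst c \<inter> fst d))"
    using M c d by (auto simp: smooth_manifold_def)
qed

lemma charted_subset: "charted M \<Longrightarrow> c \<in> atlas M \<Longrightarrow> fst c \<subseteq> points M"
  by (auto simp: charted_def)

lemma charted_cover: "charted M \<Longrightarrow> x \<in> points M \<Longrightarrow> \<exists>c\<in>atlas M. x \<in> fst c"
  by (auto simp: charted_def)

lemma chart_open: "charted M \<Longrightarrow> c \<in> atlas M \<Longrightarrow> open (snd c ` fst c)"
  by (simp add: charted_def)

lemma chart_inv_chart [simp]: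
  "charted M \<Longrightarrow> c \<in> atlas M \<Longrightarrow> x \<in> fst c \<Longrightarrow> chart_inv c (snd c x) = x"
  by (simp add: charted_def chart_inv_def)

lemma chart_inv_in: "y \<in> snd c ` fst c \<Longrightarrow> chart_inv c y \<in> fst c"
  by (simp add: chart_inv_def inv_into_into)

lemma chart_chart_inv: "y \<in> snd c ` fst c \<Longrightarrow> snd c (chart_inv c y) = y"
  by (simp add: chart_inv_def f_inv_into_f)

lemma one_form_change:
  assumes "one_form M \<alpha>" "c \<in> atlas M" "d \<in> atlas M" "x \<in> fst c" "x \<in> fst d"
  shows "\<alpha> c x v = \<alpha> d x (fd (snd d \<circ> chart_inv c) (snd c x) v)"
  using assms unfolding one_form_def by blast

lemma one_form_linear: "one_form M \<alpha> \<Longrightarrow> c \<in> atlas M \<Longrightarrow> x \<in> fst c \<Longrightarrow> linear (\<alpha> c x)"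
  unfolding one_form_def by blast

lemma one_form_smooth:
  "one_form M \<alpha> \<Longrightarrow> c \<in> atlas M \<Longrightarrow> smooth_on (\<lambda>y. \<alpha> c (chart_inv c y) v) (snd c ` fst c)"
  unfolding one_form_def by blast

text \<open>A coordinate expression of \<open>F\<close>. The open set \<open>V\<close> is part of
  the data because the image of a whole chart domain need not lie in one chart \<open>d\<close>, and
  \<open>F\<close> may be smooth only on an open subset.\<close>

definition chart_rep :: "('a, 'e::euclidean_space) mfd \<Rightarrow> ('a, 'e) chart \<Rightarrow> 'e set \<Rightarrow>
    ('b, 'f::euclidean_space) mfd \<Rightarrow> ('b, 'f) chart \<Rightarrow> ('a \<Rightarrow> 'b) \<Rightarrow> bool" where
  "chart_rep M c V N d F \<longleftrightarrow> c \<in> atlas M \<and> d \<in> atlas N \<and> open V \<and> V \<subseteq> snd c ` fst c \<and>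
     (\<forall>y\<in>V. F (chart_inv c y) \<in> fst d) \<and> smooth_on (snd d \<circ> F \<circ> chart_inv c) V"

context
  fixes M :: "('a, 'e::euclidean_space) mfd" and N :: "('b, 'f::euclidean_space) mfd"
    and F :: "'a \<Rightarrow> 'b" and c d V
  assumes M: "charted M" and N: "charted N" and rep: "chart_rep M c V N d F"
begin

lemma chart_rep_point:
  assumes "x \<in> fst c" "snd c x \<in> V"
  shows "c \<in> atlas M" "d \<in> atlas N" "F x \<in> fst d"
  using rep assms chart_inv_chart[OF M _ assms(1)] unfolding chart_rep_def by metis+

text \<open>\<open>pullback\<close> evaluates in a target chart picked by \<open>SOME\<close>, which
  need not be \<open>d\<close>. On the part of \<open>V\<close> that is sent into the overlap of
  both charts, the two expressions of \<open>F\<close> differ by the transition map.\<close>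

lemma chart_rep_change:
  assumes d': "d' \<in> atlas N" and x: "x \<in> fst c" "snd c x \<in> V" "F x \<in> fst d'"
  shows "snd d' \<circ> F \<circ> chart_inv c differentiable at (snd c x)"
    and "fd (snd d' \<circ> F \<circ> chart_inv c) (snd c x) v
      = fd (snd d' \<circ> chart_inv d) (snd d (F x)) (fd (snd d \<circ> F \<circ> chart_inv c) (snd c x) v)"
proof -
  let ?g = "snd d \<circ> F \<circ> chart_inv c" and ?T = "snd d ` (fst d \<inter> fst d')"
  have c: "c \<in> atlas M" and d: "d \<in> atlas N" and V: "open V" "V \<subseteq> snd c ` fst c"
    and FV: "\<And>y. y \<in> V \<Longrightarrow> F (chart_inv c y) \<in> fst d" and g: "smooth_on ?g V"
    using rep by (auto simp: chart_rep_def)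
  have T: "open ?T" and tr: "smooth_on (snd d' \<circ> chart_inv d) ?T"
    using N d d' by (auto simp: charted_def)
  let ?U = "V \<inter> ?g -` ?T"
  have U: "open ?U"
    using continuous_open_preimage[OF smooth_on_continuous[OF g] V(1) T] .
  have gx: "?g (snd c x) = snd d (F x)" using M c x by simp
  have xU: "snd c x \<in> ?U"
    using x gx FV[OF x(2)] M c by auto
  have eq: "(snd d' \<circ> F \<circ> chart_inv c) y = (snd d' \<circ> chart_inv d) (?g y)" if "y \<in> V" for y
    using FV[OF that] N d by simp
  have h: "((\<lambda>y. (snd d' \<circ> chart_inv d) (?g y)) has_derivative
     (\<lambda>v. fd (snd d' \<circ> chart_inv d) (snd d (F x)) (fd ?g (snd c x) v))) (at (snd c x))"
    using has_derivative_compose[OF smooth_on_has_derivative[OF g V(1) x(2)]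
        smooth_on_has_derivative[OF tr T, of "?g (snd c x)"]] xU gx by auto
  then have "((snd d' \<circ> F \<circ> chart_inv c) has_derivative
     (\<lambda>v. fd (snd d' \<circ> chart_inv d) (snd d (F x)) (fd ?g (snd c x) v))) (at (snd c x))"
    using has_derivative_transform_within_open[OF h V(1) x(2)] eq by simp
  then show "snd d' \<circ> F \<circ> chart_inv c differentiable at (snd c x)"
    "fd (snd d' \<circ> F \<circ> chart_inv c) (snd c x) v
      = fd (snd d' \<circ> chart_inv d) (snd d (F x)) (fd ?g (snd c x) v)"
    by (auto simp: fd_eqI differentiable_def)
qed

lemma some_chart:
  assumes "x \<in> fst c" "snd c x \<in> V"
  shows "(SOME d. d \<in> atlas N \<and> F x \<in> fst d) \<in> atlas N"
    "F x \<in> fst (SOME d. d \<in> atlas N \<and> F x \<in> fst d)"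
proof -
  have "d \<in> atlas N \<and> F x \<in> fst d"
    using chart_rep_point[OF assms] by auto
  from someI[of "\<lambda>d. d \<in> atlas N \<and> F x \<in> fst d", OF this]
  show "(SOME d. d \<in> atlas N \<and> F x \<in> fst d) \<in> atlas N"
    "F x \<in> fst (SOME d. d \<in> atlas N \<and> F x \<in> fst d)" by auto
qed

lemma pullback_eq:
  assumes \<theta>: "one_form N \<theta>" and x: "x \<in> fst c" "snd c x \<in> V"
  shows "pullback N F \<theta> c x v = \<theta> d (F x) (fd (snd d \<circ> F \<circ> chart_inv c) (snd c x) v)"
proof -
  define d' where "d' = (SOME d. d \<in> atlas N \<and> F x \<in> fst d)"
  have d': "d' \<in> atlas N" "F x \<in> fst d'"
    using some_chart[OF x] unfolding d'_def by auto
  have d: "d \<in> atlas N" "F x \<in> fst d"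
    using chart_rep_point[OF x] by auto
  have "pullback N F \<theta> c x v = \<theta> d' (F x) (fd (snd d' \<circ> F \<circ> chart_inv c) (snd c x) v)"
    by (simp add: pullback_def Let_def d'_def)
  also have "\<dots> = \<theta> d' (F x) (fd (snd d' \<circ> chart_inv d) (snd d (F x)) (fd (snd d \<circ> F \<circ> chart_inv c) (snd c x) v))"
    using chart_rep_change(2)[OF d'(1) x d'(2)] by simp
  \<comment> \<open>The Jacobian of the transition map is absorbed by the compatibility of the local
    expressions of \<theta>.\<close>
  also have "\<dots> = \<theta> d (F x) (fd (snd d \<circ> F \<circ> chart_inv c) (snd c x) v)"
    by (rule one_form_change[OF \<theta> d(1) d'(1) d(2) d'(2), symmetric])
  finally show ?thesis .
qed

lemma chart_rep_at:
  assumes "y \<in> V"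
  shows "chart_inv c y \<in> fst c" "snd c (chart_inv c y) = y"
    "chart_inv d ((snd d \<circ> F \<circ> chart_inv c) y) = F (chart_inv c y)"
    "(snd d \<circ> F \<circ> chart_inv c) y \<in> snd d ` fst d"
  using rep assms N by (auto simp: chart_rep_def chart_inv_in chart_chart_inv subset_iff)

context
  fixes \<theta> assumes \<theta>: "one_form N \<theta>"
begin

lemma pullback_local:
  assumes "y \<in> V"
  shows "pullback N F \<theta> c (chart_inv c y) v
    = \<theta> d (chart_inv d ((snd d \<circ> F \<circ> chart_inv c) y)) (fd (snd d \<circ> F \<circ> chart_inv c) y v)"
  using pullback_eq[OF \<theta> chart_rep_at(1)[OF assms]] chart_rep_at[OF assms] assms by simp

lemma pullback_smooth: "smooth_on (\<lambda>y. pullback N F \<theta> c (chart_inv c y) v) V"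
proof -
  have d: "d \<in> atlas N" "open V" "smooth_on (snd d \<circ> F \<circ> chart_inv c) V"
    using rep by (auto simp: chart_rep_def)
  show ?thesis
    by (rule smooth_on_cong[OF d(2) pullback_local[symmetric]
          smooth_on_pullback[where T = "snd d ` fst d" and \<Theta> = "\<lambda>y. \<theta> d (chart_inv d y)"]])
      (rule d chart_open[OF N d(1)] chart_rep_at(4) one_form_smooth[OF \<theta> d(1)]
        one_form_linear[OF \<theta> d(1) chart_inv_in] | assumption)+
qed

lemma d1_pullback:
  assumes "x \<in> fst c" "snd c x \<in> V"
  shows "d1 (pullback N F \<theta>) c x u v = d1 \<theta> d (F x)
    (fd (snd d \<circ> F \<circ> chart_inv c) (snd c x) u) (fd (snd d \<circ> F \<circ> chart_inv c) (snd c x) v)"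
proof -
  let ?g = "snd d \<circ> F \<circ> chart_inv c" and ?\<Theta> = "\<lambda>y. \<theta> d (chart_inv d y)"
  have d: "d \<in> atlas N" "open V" "smooth_on ?g V" "c \<in> atlas M"
    using rep by (auto simp: chart_rep_def)
  have "d1 (pullback N F \<theta>) c x u v = ed (\<lambda>y v. ?\<Theta> (?g y) (fd ?g y v)) (snd c x) u v"
    unfolding d1_def
    by (intro arg_cong2[where f = minus] fun_cong[OF fd_cong[OF d(2) assms(2)]] pullback_local)
  also have "\<dots> = ed ?\<Theta> (?g (snd c x)) (fd ?g (snd c x) u) (fd ?g (snd c x) v)"
    by (rule ed_pullback[where T = "snd d ` fst d" and V = V and \<Theta> = ?\<Theta> and g = ?g])
      (rule d chart_open[OF N d(1)] chart_rep_at(4) one_form_smooth[OF \<theta> d(1)] assms(2)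
        one_form_linear[OF \<theta> d(1) chart_inv_in] | assumption)+
  also have "?g (snd c x) = snd d (F x)" using M d assms by simp
  finally show ?thesis by (simp only: d1_def)
qed

lemma pullback_linear:
  assumes "x \<in> fst c" "snd c x \<in> V"
  shows "linear (pullback N F \<theta> c x)"
proof -
  have d: "d \<in> atlas N" "open V" "smooth_on (snd d \<circ> F \<circ> chart_inv c) V" "F x \<in> fst d"
    using rep chart_rep_point[OF assms] by (auto simp: chart_rep_def)
  have "linear (\<theta> d (F x) \<circ> fd (snd d \<circ> F \<circ> chart_inv c) (snd c x))"
    using \<theta> d assms by (intro linear_compose linear_fd smooth_on_differentiable[OF d(3,2)]) (auto simp: one_form_def)
  moreover have "pullback N F \<theta> c x = \<theta> d (F x) \<circ> fd (snd d \<circ> F \<circ> chart_inv c) (snd c x)"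
    using pullback_eq[OF \<theta> assms] by auto
  ultimately show ?thesis by simp
qed

end

end

text \<open>The target chart chosen by \<open>SOME\<close> depends only on \<open>F x\<close> and is
  therefore the same on both sides; what remains is the chain rule in the source charts.\<close>

lemma pullback_change_chart:
  assumes M: "charted M" and N: "charted N"
    and rep: "chart_rep M c V N d F" "chart_rep M c' V' N d' F"
    and x: "x \<in> fst c" "snd c x \<in> V" "x \<in> fst c'" "snd c' x \<in> V'"
  shows "pullback N F \<theta> c x v = pullback N F \<theta> c' x (fd (snd c' \<circ> chart_inv c) (snd c x) v)"
proof -
  define e where "e = (SOME d. d \<in> atlas N \<and> F x \<in> fst d)"
  have e: "e \<in> atlas N" "F x \<in> fst e"
    using some_chart[OF M N rep(1) x(1,2)] unfolding e_def by auto
  have c: "c \<in> atlas M" "c' \<in> atlas M" using rep by (auto simp: chart_rep_def)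
  let ?T = "snd c ` (fst c \<inter> fst c')"
  have T: "open ?T" "smooth_on (snd c' \<circ> chart_inv c) ?T" "snd c x \<in> ?T"
    using M c x by (auto simp: charted_def)
  have "fd (snd e \<circ> F \<circ> chart_inv c) (snd c x) =
      fd (\<lambda>y. (snd e \<circ> F \<circ> chart_inv c') ((snd c' \<circ> chart_inv c) y)) (snd c x)"
    by (rule fd_cong[OF T(1,3)]) (use M c in auto)
  also have "\<dots> = (\<lambda>v. fd (snd e \<circ> F \<circ> chart_inv c') ((snd c' \<circ> chart_inv c) (snd c x))
      (fd (snd c' \<circ> chart_inv c) (snd c x) v))"
    by (rule fd_chain[OF smooth_on_differentiable[OF T(2,1,3)]])
      (use chart_rep_change(1)[OF M N rep(2) e(1) x(3,4) e(2)] M c x in \<open>simp add: o_def\<close>)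
  finally show ?thesis using M c x by (simp add: pullback_def Let_def e_def)
qed

lemma d1_cong:
  assumes "charted M" "c \<in> atlas M" "open V" "V \<subseteq> snd c ` fst c" "x \<in> fst c" "snd c x \<in> V"
    "\<And>x. x \<in> fst c \<Longrightarrow> snd c x \<in> V \<Longrightarrow> \<alpha> c x = \<beta> c x"
  shows "d1 \<alpha> c x u v = d1 \<beta> c x u v"
  unfolding d1_def
  by (intro arg_cong2[where f = minus] fun_cong[OF fd_cong[OF assms(3,6)]] fun_cong[OF assms(7)])
    (use assms chart_inv_in[of _ c] chart_chart_inv[of _ c] in auto)

section \<open>Coframes of a three-dimensional space\<close>

abbreviation wed :: "('e \<Rightarrow> complex) \<Rightarrow> ('e \<Rightarrow> complex) \<Rightarrow> 'e \<Rightarrow> 'e \<Rightarrow> complex" where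
  "wed \<alpha> \<beta> u v \<equiv> \<alpha> u * \<beta> v - \<alpha> v * \<beta> u"

text \<open>The determinant of the values of three forms on three vectors, grouped as in
  \<open>wedge21\<close>.\<close>

abbreviation vol :: "('e \<Rightarrow> complex) \<Rightarrow> ('e \<Rightarrow> complex) \<Rightarrow> ('e \<Rightarrow> complex) \<Rightarrow> 'e \<Rightarrow> 'e \<Rightarrow> 'e \<Rightarrow> complex" where
  "vol \<alpha> \<beta> \<gamma> u v w \<equiv> wed \<alpha> \<beta> u v * \<gamma> w + wed \<alpha> \<beta> v w * \<gamma> u + wed \<alpha> \<beta> w u * \<gamma> v"

abbreviation e1 :: "real^3" where "e1 \<equiv> axis 1 1"
abbreviation e2 :: "real^3" where "e2 \<equiv> axis 2 1"
abbreviation e3 :: "real^3" where "e3 \<equiv> axis 3 1"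

definition frame :: "(real^3 \<Rightarrow> complex) \<Rightarrow> (real^3 \<Rightarrow> complex) \<Rightarrow> (real^3 \<Rightarrow> complex) \<Rightarrow> bool" where
  "frame \<alpha> \<beta> \<gamma> \<longleftrightarrow> linear \<alpha> \<and> linear \<beta> \<and> linear \<gamma> \<and> (\<exists>u v w. vol \<alpha> \<beta> \<gamma> u v w \<noteq> 0)"

lemma linear_3:
  fixes \<alpha> :: "real^3 \<Rightarrow> complex"
  assumes "linear \<alpha>"
  shows "\<alpha> v = of_real (v $ 1) * \<alpha> e1 + of_real (v $ 2) * \<alpha> e2 + of_real (v $ 3) * \<alpha> e3"
proof -
  have "v = (v $ 1) *\<^sub>R e1 + (v $ 2) *\<^sub>R e2 + (v $ 3) *\<^sub>R e3"
    by (simp add: vec_eq_iff forall_3 axis_def)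
  then have "\<alpha> v = \<alpha> ((v $ 1) *\<^sub>R e1 + (v $ 2) *\<^sub>R e2 + (v $ 3) *\<^sub>R e3)" by simp
  moreover have "\<alpha> (r *\<^sub>R e) = of_real r * \<alpha> e" for r e
    by (simp add: linear_scale[OF assms]) (simp add: scaleR_conv_of_real)
  ultimately show ?thesis by (simp add: linear_add[OF assms])
qed

text \<open>By multilinearity \<open>vol\<close> on (u, v, w) is the coordinate determinant of these
  vectors times its value on the standard basis, so a nonzero value anywhere forces a nonzero value
  there.\<close>

lemma frame_basis:
  assumes "frame \<alpha> \<beta> \<gamma>"
  shows "vol \<alpha> \<beta> \<gamma> e1 e2 e3 \<noteq> 0"
proof
  assume 0: "vol \<alpha> \<beta> \<gamma> e1 e2 e3 = 0"
  have l: "linear \<alpha>" "linear \<beta>" "linear \<gamma>" and "\<exists>u v w. vol \<alpha> \<beta> \<gamma> u v w \<noteq> 0"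
    using assms by (auto simp: frame_def)
  then obtain u v w where n: "vol \<alpha> \<beta> \<gamma> u v w \<noteq> 0" by blast
  \<comment> \<open>Cauchy-Binet for 2 by 2 minors, with the values on the basis abstracted to
    scalars so that the expansion stays small.\<close>
  have det: "wed (\<lambda>i. r i * a1 + s i * a2 + t i * a3) (\<lambda>i. r i * b1 + s i * b2 + t i * b3) u v
      = wed r s u v * (a1 * b2 - a2 * b1) + wed s t u v * (a2 * b3 - a3 * b2)
        + wed t r u v * (a3 * b1 - a1 * b3)" for r s t :: "real^3 \<Rightarrow> complex" and a1 a2 a3 b1 b2 b3 u v
    by (simp add: algebra_simps)
  let ?r = "\<lambda>v :: real^3. complex_of_real (v $ 1)" and ?s = "\<lambda>v :: real^3. complex_of_real (v $ 2)"
    and ?t = "\<lambda>v :: real^3. complex_of_real (v $ 3)"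
  have w: "wed \<alpha> \<beta> u v = wed ?r ?s u v * (\<alpha> e1 * \<beta> e2 - \<alpha> e2 * \<beta> e1)
      + wed ?s ?t u v * (\<alpha> e2 * \<beta> e3 - \<alpha> e3 * \<beta> e2)
      + wed ?t ?r u v * (\<alpha> e3 * \<beta> e1 - \<alpha> e1 * \<beta> e3)" for u v
    using det[where r = ?r and s = ?s and t = ?t and ?a1.0 = "\<alpha> e1" and ?a2.0 = "\<alpha> e2" and ?a3.0 = "\<alpha> e3"
        and ?b1.0 = "\<beta> e1" and ?b2.0 = "\<beta> e2" and ?b3.0 = "\<beta> e3" and u = u and v = v]
    by (simp only: linear_3[OF l(1), symmetric] linear_3[OF l(2), symmetric])
  have "vol \<alpha> \<beta> \<gamma> u v w = vol ?r ?s ?t u v w * vol \<alpha> \<beta> \<gamma> e1 e2 e3"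
    unfolding w[of u v] w[of v w] w[of w u] linear_3[OF l(3), of u] linear_3[OF l(3), of v] linear_3[OF l(3), of w]
    by (simp add: axis_def) (simp add: algebra_simps)
  with 0 n show False by simp
qed

lemma frame_decomp:
  assumes "frame \<alpha> \<beta> \<gamma>" "linear X"
  obtains p q r where "\<And>v. X v = p * \<alpha> v + q * \<beta> v + r * \<gamma> v"
proof -
  let ?V = "vol \<alpha> \<beta> \<gamma> e1 e2 e3"
  define p q r where "p = vol X \<beta> \<gamma> e1 e2 e3 / ?V" and "q = vol \<alpha> X \<gamma> e1 e2 e3 / ?V"
    and "r = vol \<alpha> \<beta> X e1 e2 e3 / ?V"
  have l: "linear \<alpha>" "linear \<beta>" "linear \<gamma>" using assms by (auto simp: frame_def)
  have V: "?V \<noteq> 0" by (rule frame_basis[OF assms(1)])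
  \<comment> \<open>Each line expands a vanishing 4 by 4 determinant: the forms X, \<alpha>,
    \<beta>, \<gamma> on the three basis vectors with one of them repeated.\<close>
  have "?V * X e1 = vol X \<beta> \<gamma> e1 e2 e3 * \<alpha> e1 + vol \<alpha> X \<gamma> e1 e2 e3 * \<beta> e1 + vol \<alpha> \<beta> X e1 e2 e3 * \<gamma> e1"
    "?V * X e2 = vol X \<beta> \<gamma> e1 e2 e3 * \<alpha> e2 + vol \<alpha> X \<gamma> e1 e2 e3 * \<beta> e2 + vol \<alpha> \<beta> X e1 e2 e3 * \<gamma> e2"
    "?V * X e3 = vol X \<beta> \<gamma> e1 e2 e3 * \<alpha> e3 + vol \<alpha> X \<gamma> e1 e2 e3 * \<beta> e3 + vol \<alpha> \<beta> X e1 e2 e3 * \<gamma> e3"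
    by algebra+
  then have *: "?V * X e = vol X \<beta> \<gamma> e1 e2 e3 * \<alpha> e + vol \<alpha> X \<gamma> e1 e2 e3 * \<beta> e + vol \<alpha> \<beta> X e1 e2 e3 * \<gamma> e"
    if "e = e1 \<or> e = e2 \<or> e = e3" for e
    using that by blast
  have b: "X e = p * \<alpha> e + q * \<beta> e + r * \<gamma> e" if "e = e1 \<or> e = e2 \<or> e = e3" for e
    using *[OF that] V by (simp add: p_def q_def r_def add_divide_distrib[symmetric] eq_divide_eq mult.commute)
  have "X v = p * \<alpha> v + q * \<beta> v + r * \<gamma> v" for v
    unfolding linear_3[OF assms(2), of v] linear_3[OF l(1), of v] linear_3[OF l(2), of v] linear_3[OF l(3), of v]
    by (simp add: b) (simp add: algebra_simps)
  then show ?thesis by (rule that)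
qed

text \<open>Cramer's rule, in a form that shows smooth dependence of the coefficient on the data.\<close>

lemma frame_coeff:
  assumes "frame \<alpha> \<beta> \<gamma>" "\<And>v. X v = p * \<alpha> v + q * \<beta> v + r * \<gamma> v"
  shows "q = vol \<alpha> X \<gamma> e1 e2 e3 / vol \<alpha> \<beta> \<gamma> e1 e2 e3"
proof -
  have "vol \<alpha> X \<gamma> e1 e2 e3 = q * vol \<alpha> \<beta> \<gamma> e1 e2 e3"
    unfolding assms(2) by algebra
  then show ?thesis using frame_basis[OF assms(1)] by simp
qed

lemma frame_indep:
  assumes "frame \<alpha> \<beta> \<gamma>" "\<And>v. p * \<alpha> v + q * \<beta> v + r * \<gamma> v = 0"
  shows "p = 0" "q = 0" "r = 0"
proof -
  have n: "vol \<alpha> \<beta> \<gamma> e1 e2 e3 \<noteq> 0" by (rule frame_basis[OF assms(1)])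
  have "p * vol \<alpha> \<beta> \<gamma> e1 e2 e3 = 0" "q * vol \<alpha> \<beta> \<gamma> e1 e2 e3 = 0" "r * vol \<alpha> \<beta> \<gamma> e1 e2 e3 = 0"
    using assms(2)[of e1] assms(2)[of e2] assms(2)[of e3] by algebra+
  with n show "p = 0" "q = 0" "r = 0" by simp_all
qed

text \<open>Wedging with the form that is absent from a term leaves its coefficient times
  \<open>vol\<close>. The three 2-forms are listed as they occur in the structure equations,
  \<alpha> being the real form there.\<close>

lemma frame_indep2:
  assumes "frame \<alpha> \<beta> \<gamma>" "\<And>u v. p * wed \<beta> \<gamma> u v + q * wed \<beta> \<alpha> u v + r * wed \<gamma> \<alpha> u v = 0"
  shows "p = 0" "q = 0" "r = 0"
proof -
  have n: "vol \<alpha> \<beta> \<gamma> e1 e2 e3 \<noteq> 0" by (rule frame_basis[OF assms(1)])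
  have "p * vol \<alpha> \<beta> \<gamma> e1 e2 e3 = 0" "q * vol \<alpha> \<beta> \<gamma> e1 e2 e3 = 0" "r * vol \<alpha> \<beta> \<gamma> e1 e2 e3 = 0"
    using assms(2)[of e1 e2] assms(2)[of e2 e3] assms(2)[of e3 e1] by algebra+
  with n show "p = 0" "q = 0" "r = 0" by simp_all
qed

abbreviation cframe :: "(real^3 \<Rightarrow> complex) \<Rightarrow> (real^3 \<Rightarrow> complex) \<Rightarrow> bool" where
  "cframe \<alpha> \<beta> \<equiv> frame \<alpha> \<beta> (\<lambda>v. cnj (\<beta> v)) \<and> (\<forall>v. \<alpha> v \<in> \<real>)"

section \<open>Rules for the exterior derivative in coordinates\<close>

lemma ed_linear_compose:
  assumes "bounded_linear L" "\<And>v. (\<lambda>z. \<alpha> z v) differentiable (at y)"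
  shows "ed (\<lambda>z v. L (\<alpha> z v)) y u v = L (ed \<alpha> y u v)"
  by (simp add: fd_linear_compose[OF assms(1,2)] linear_diff[OF bounded_linear.linear[OF assms(1)]])

lemma ed_scale:
  assumes "k differentiable (at y)" "\<And>v. (\<lambda>z. \<alpha> z v) differentiable (at y)"
  shows "ed (\<lambda>z v. k z * \<alpha> z v) y u v = k y * ed \<alpha> y u v + wed (fd k y) (\<alpha> y) u v"
  using assms by (simp add: fd_mult algebra_simps)

lemma ed_cong:
  assumes "open U" "y \<in> U" "\<And>z v. z \<in> U \<Longrightarrow> \<alpha> z v = \<beta> z v"
  shows "ed \<alpha> y u v = ed \<beta> y u v"
  by (intro arg_cong2[where f = minus] fun_cong[OF fd_cong[OF assms(1,2)]] assms(3))

lemma ed_add: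
  assumes "\<And>v. (\<lambda>z. \<alpha> z v) differentiable (at y)" "\<And>v. (\<lambda>z. \<beta> z v) differentiable (at y)"
  shows "ed (\<lambda>z v. \<alpha> z v + \<beta> z v) y u v = ed \<alpha> y u v + ed \<beta> y u v"
  using assms by (simp add: fd_add)

text \<open>This is d(d log h) = 0, verified by the quotient rule and the symmetry of second
  derivatives, so that no logarithm has to be chosen.\<close>

lemma ed_log:
  fixes h :: "'e::euclidean_space \<Rightarrow> complex"
  assumes "open U" "y \<in> U" "smooth_on h U" "\<And>z. z \<in> U \<Longrightarrow> h z \<noteq> 0"
  shows "ed (\<lambda>z v. fd h z v * inverse (h z)) y u v = 0"
proof -
  have h: "h differentiable (at y)" by (rule smooth_on_differentiable[OF assms(3,1,2)])
  have i: "((\<lambda>z. inverse (h z)) has_derivative (\<lambda>v. - (inverse (h y) * fd h y v * inverse (h y)))) (at y)"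
    using Deriv.has_derivative_inverse[OF assms(4)[OF assms(2)] has_derivative_fd[OF h]] .
  have d: "(\<lambda>z. fd h z v) differentiable (at y)" for v
    by (rule smooth_on_differentiable[OF smooth_on_fd[OF assms(3)] assms(1,2)])
  have i': "(\<lambda>z. inverse (h z)) differentiable (at y)" using i by (rule differentiableI)
  have "fd (\<lambda>z. fd h z v) y u = fd (\<lambda>z. fd h z u) y v"
    by (rule fd_fd_commute[OF assms(3,1,2)])
  then show ?thesis
    using fd_mult[OF d i', of v] fd_mult[OF d i', of u] by (simp add: fd_eqI[OF i] algebra_simps)
qed

section \<open>Rigidity of the structure equations\<close>

text \<open>The equations in one chart at one point, together with the normalisations A > 0 and
  \<epsilon> = +-1: the first fixes the phase of a rescaling, the second its modulus.\<close>

definition structure_eqs :: "(real^3 \<Rightarrow> real^3 \<Rightarrow> complex) \<Rightarrow> (real^3 \<Rightarrow> real^3 \<Rightarrow> complex) \<Rightarrow>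
    (real^3 \<Rightarrow> real) \<Rightarrow> (real^3 \<Rightarrow> complex) \<Rightarrow> (real^3 \<Rightarrow> real) \<Rightarrow> real^3 \<Rightarrow> bool" where
  "structure_eqs \<alpha> \<beta> A B \<epsilon> y \<longleftrightarrow>
     A y > 0 \<and> (\<epsilon> y = 1 \<or> \<epsilon> y = - 1) \<and>
     (\<forall>u v. ed \<alpha> y u v = \<i> * wed (\<beta> y) (\<lambda>v. cnj (\<beta> y v)) u v
        + 2 * of_real (A y) * (wed (\<beta> y) (\<alpha> y) u v + wed (\<lambda>v. cnj (\<beta> y v)) (\<alpha> y) u v)) \<and>
     (\<forall>u v. ed \<beta> y u v = - (of_real (A y) + \<i> * cnj (B y)) * wed (\<beta> y) (\<lambda>v. cnj (\<beta> y v)) u v) \<and>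
     (\<forall>u v. ed (\<lambda>y v. B y * \<beta> y v + cnj (B y) * cnj (\<beta> y v)) y u v
        = - of_real (\<epsilon> y) * \<i> * wed (\<beta> y) (\<lambda>v. cnj (\<beta> y v)) u v)"

text \<open>The second coframe is (f \<alpha>, h \<beta>). An open set is fixed rather than a point,
  because df and dh occur in its equations and identities such as f = 1 are differentiated
  again.\<close>

locale two_coframes =
  fixes U :: "(real^3) set" and \<alpha> \<beta> \<eta> \<theta> :: "real^3 \<Rightarrow> real^3 \<Rightarrow> complex" and A A' :: "real^3 \<Rightarrow> real"
    and B B' :: "real^3 \<Rightarrow> complex" and \<epsilon> \<epsilon>' :: "real^3 \<Rightarrow> real"
    and f :: "real^3 \<Rightarrow> real" and h :: "real^3 \<Rightarrow> complex"
  assumes U: "open U"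
    and \<alpha>: "\<And>v. smooth_on (\<lambda>y. \<alpha> y v) U" and \<beta>: "\<And>v. smooth_on (\<lambda>y. \<beta> y v) U"
    and B: "smooth_on B U" and f: "smooth_on f U" and h: "smooth_on h U"
    and fr: "\<And>y. y \<in> U \<Longrightarrow> cframe (\<alpha> y) (\<beta> y)"
    and f0: "\<And>y. y \<in> U \<Longrightarrow> f y \<noteq> 0" and h0: "\<And>y. y \<in> U \<Longrightarrow> h y \<noteq> 0"
    and \<eta>: "\<And>y v. y \<in> U \<Longrightarrow> \<eta> y v = of_real (f y) * \<alpha> y v"
    and \<theta>: "\<And>y v. y \<in> U \<Longrightarrow> \<theta> y v = h y * \<beta> y v"
    and se: "\<And>y. y \<in> U \<Longrightarrow> structure_eqs \<alpha> \<beta> A B \<epsilon> y"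
    and se': "\<And>y. y \<in> U \<Longrightarrow> structure_eqs \<eta> \<theta> A' B' \<epsilon>' y"
begin

lemma d\<alpha>: "y \<in> U \<Longrightarrow> (\<lambda>z. \<alpha> z v) differentiable (at y)"
  and d\<beta>: "y \<in> U \<Longrightarrow> (\<lambda>z. \<beta> z v) differentiable (at y)"
  and dh: "y \<in> U \<Longrightarrow> h differentiable (at y)"
  and df: "y \<in> U \<Longrightarrow> f differentiable (at y)"
  using \<alpha> \<beta> h f U smooth_on_differentiable by blast+

lemma fd_f: "y \<in> U \<Longrightarrow> fd (\<lambda>z. complex_of_real (f z)) y = (\<lambda>v. of_real (fd f y v))"
  by (rule fd_linear_compose[OF bounded_linear_of_real df])

text \<open>Expand d(f \<alpha>) by the Leibniz rule and compare with the structure equation of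
  \<eta>: the \<beta> \<and> cnj \<beta> terms give f, the \<beta> \<and> \<alpha> terms the
  \<beta>-component q of df. The decomposition of df stays arbitrary, since \<open>fd_h\<close> and
  \<open>coframes_equal\<close> bring their own.\<close>

lemma scale_f:
  assumes y: "y \<in> U"
  shows "complex_of_real (f y) = h y * cnj (h y)"
    and "\<And>p q r. (\<And>v. of_real (fd f y v) = p * \<alpha> y v + q * \<beta> y v + r * cnj (\<beta> y v)) \<Longrightarrow>
       q = 2 * of_real (f y) * (of_real (A' y) * h y - of_real (A y))"
proof -
  have fr1: "frame (\<alpha> y) (\<beta> y) (\<lambda>v. cnj (\<beta> y v))" using fr[OF y] by blast
  have *: "\<i> * (of_real (f y) - h y * cnj (h y)) = 0 \<and>
      q - 2 * of_real (f y) * (of_real (A' y) * h y - of_real (A y)) = 0"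
    if X: "\<And>v. of_real (fd f y v) = p * \<alpha> y v + q * \<beta> y v + r * cnj (\<beta> y v)" for p q r
  proof -
    have e1: "ed \<alpha> y u v = \<i> * wed (\<beta> y) (\<lambda>v. cnj (\<beta> y v)) u v
        + 2 * of_real (A y) * (wed (\<beta> y) (\<alpha> y) u v + wed (\<lambda>v. cnj (\<beta> y v)) (\<alpha> y) u v)" for u v
      using se[OF y] unfolding structure_eqs_def by blast
    have e2: "ed \<eta> y u v = \<i> * wed (\<theta> y) (\<lambda>v. cnj (\<theta> y v)) u v
        + 2 * of_real (A' y) * (wed (\<theta> y) (\<eta> y) u v + wed (\<lambda>v. cnj (\<theta> y v)) (\<eta> y) u v)" for u v
      using se'[OF y] unfolding structure_eqs_def by blast
    have e3: "ed \<eta> y u v = of_real (f y) * ed \<alpha> y u v + wed (\<lambda>v. of_real (fd f y v)) (\<alpha> y) u v" for u v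
    proof -
      have "ed \<eta> y u v = ed (\<lambda>z v. of_real (f z) * \<alpha> z v) y u v"
        by (rule ed_cong[OF U y \<eta>])
      also have "\<dots> = of_real (f y) * ed \<alpha> y u v + wed (fd (\<lambda>z. of_real (f z)) y) (\<alpha> y) u v"
        by (rule ed_scale[OF smooth_on_differentiable[OF smooth_on_of_real[OF U f] U y] d\<alpha>[OF y]])
      finally show ?thesis by (simp add: fd_f[OF y])
    qed
    have "\<i> * (of_real (f y) - h y * cnj (h y)) * wed (\<beta> y) (\<lambda>v. cnj (\<beta> y v)) u v
       + (q - 2 * of_real (f y) * (of_real (A' y) * h y - of_real (A y))) * wed (\<beta> y) (\<alpha> y) u v
       + (r - 2 * of_real (f y) * (of_real (A' y) * cnj (h y) - of_real (A y))) * wed (\<lambda>v. cnj (\<beta> y v)) (\<alpha> y) u v = 0"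
      for u v
      using e2[of u v] unfolding e3 e1 \<eta>[OF y] \<theta>[OF y] X complex_cnj_mult by algebra
    from frame_indep2(1,2)[OF fr1 this] show ?thesis by blast
  qed
  have "linear (\<lambda>v. complex_of_real (fd f y v))"
    using bounded_linear.linear[OF has_derivative_bounded_linear[OF
        has_derivative_fd[OF smooth_on_differentiable[OF smooth_on_of_real[OF U f] U y]]]]
    by (simp add: fd_f[OF y])
  from frame_decomp[OF fr1 this] obtain p q r
    where "\<And>v. of_real (fd f y v) = p * \<alpha> y v + q * \<beta> y v + r * cnj (\<beta> y v)" by blast
  from *[OF this] show "complex_of_real (f y) = h y * cnj (h y)" by simp
  show "\<And>p q r. (\<And>v. of_real (fd f y v) = p * \<alpha> y v + q * \<beta> y v + r * cnj (\<beta> y v)) \<Longrightarrow>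
       q = 2 * of_real (f y) * (of_real (A' y) * h y - of_real (A y))"
    using * by (metis eq_iff_diff_eq_0)
qed

text \<open>In d(h \<beta>) = dh \<and> \<beta> + h d\<beta> the \<beta>-component of dh is lost, so
  this comparison fixes only the other two; the one along \<alpha> vanishes.\<close>

lemma fd_h_form:
  assumes y: "y \<in> U"
  obtains q where "\<And>v. fd h y v = q * \<beta> y v
    + h y * ((of_real (A' y) + \<i> * cnj (B' y)) * cnj (h y) - (of_real (A y) + \<i> * cnj (B y))) * cnj (\<beta> y v)"
proof -
  have fr1: "frame (\<alpha> y) (\<beta> y) (\<lambda>v. cnj (\<beta> y v))" using fr[OF y] by blast
  obtain p q r where X: "\<And>v. fd h y v = p * \<alpha> y v + q * \<beta> y v + r * cnj (\<beta> y v)"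
    using frame_decomp[OF fr1 linear_fd[OF dh[OF y]]] by blast
  have e1: "ed \<beta> y u v = - (of_real (A y) + \<i> * cnj (B y)) * wed (\<beta> y) (\<lambda>v. cnj (\<beta> y v)) u v" for u v
    using se[OF y] unfolding structure_eqs_def by blast
  have e2: "ed \<theta> y u v = - (of_real (A' y) + \<i> * cnj (B' y)) * wed (\<theta> y) (\<lambda>v. cnj (\<theta> y v)) u v" for u v
    using se'[OF y] unfolding structure_eqs_def by blast
  have e3: "ed \<theta> y u v = h y * ed \<beta> y u v + wed (fd h y) (\<beta> y) u v" for u v
  proof -
    have "ed \<theta> y u v = ed (\<lambda>z v. h z * \<beta> z v) y u v"
      by (rule ed_cong[OF U y \<theta>])
    also have "\<dots> = h y * ed \<beta> y u v + wed (fd h y) (\<beta> y) u v"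
      by (rule ed_scale[OF dh[OF y] d\<beta>[OF y]])
    finally show ?thesis .
  qed
  have "(h y * ((of_real (A' y) + \<i> * cnj (B' y)) * cnj (h y) - (of_real (A y) + \<i> * cnj (B y))) - r)
        * wed (\<beta> y) (\<lambda>v. cnj (\<beta> y v)) u v
     + (- p) * wed (\<beta> y) (\<alpha> y) u v + 0 * wed (\<lambda>v. cnj (\<beta> y v)) (\<alpha> y) u v = 0" for u v
    using e2[of u v] unfolding e3 e1 \<theta>[OF y] X complex_cnj_mult by algebra
  from frame_indep2(1,2)[OF fr1 this]
  have "r = h y * ((of_real (A' y) + \<i> * cnj (B' y)) * cnj (h y) - (of_real (A y) + \<i> * cnj (B y)))" "p = 0"
    by simp_all
  with X have "\<And>v. fd h y v = q * \<beta> y v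
    + h y * ((of_real (A' y) + \<i> * cnj (B' y)) * cnj (h y) - (of_real (A y) + \<i> * cnj (B y))) * cnj (\<beta> y v)"
    by simp
  then show ?thesis by (rule that)
qed

text \<open>The right-hand side is h times the difference of the two connection forms. The
  \<beta>-component left open by \<open>fd_h_form\<close> is obtained by differentiating f = h cnj h
  and using the known \<beta>-component of df.\<close>

lemma fd_h:
  assumes y: "y \<in> U"
  shows "fd h y v = h y * ((of_real (A' y) + \<i> * B' y) * h y - (of_real (A y) + \<i> * B y)) * \<beta> y v
    + h y * ((of_real (A' y) + \<i> * cnj (B' y)) * cnj (h y) - (of_real (A y) + \<i> * cnj (B y))) * cnj (\<beta> y v)"
proof -
  define r where "r = h y * ((of_real (A' y) + \<i> * cnj (B' y)) * cnj (h y) - (of_real (A y) + \<i> * cnj (B y)))"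
  obtain q where q: "\<And>v. fd h y v = q * \<beta> y v + r * cnj (\<beta> y v)"
    using fd_h_form[OF y] unfolding r_def by blast
  have "of_real (fd f y v) = h y * cnj (fd h y v) + fd h y v * cnj (h y)" for v
  proof -
    have "fd (\<lambda>z. complex_of_real (f z)) y = fd (\<lambda>z. h z * cnj (h z)) y"
      by (rule fd_cong[OF U y scale_f(1)])
    also have "\<dots> = (\<lambda>v. h y * fd (\<lambda>z. cnj (h z)) y v + fd h y v * cnj (h y))"
      using smooth_on_differentiable[OF smooth_on_cnj[OF U h] U y] by (intro fd_mult dh[OF y])
    also have "fd (\<lambda>z. cnj (h z)) y = (\<lambda>v. cnj (fd h y v))"
      by (rule fd_linear_compose[OF bounded_linear_cnj dh[OF y]])
    finally show ?thesis unfolding fd_f[OF y] by meson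
  qed
  \<comment> \<open>Conjugation exchanges \<beta> and cnj \<beta>, so h cnj (dh) contributes cnj r
    to the \<beta>-component.\<close>
  then have "of_real (fd f y v) = 0 * \<alpha> y v + (h y * cnj r + q * cnj (h y)) * \<beta> y v
      + (h y * cnj q + r * cnj (h y)) * cnj (\<beta> y v)" for v
    unfolding q by (simp add: algebra_simps)
  from scale_f(2)[OF y this]
  have "h y * cnj r + q * cnj (h y) = 2 * of_real (f y) * (of_real (A' y) * h y - of_real (A y))" .
  moreover have cr: "cnj r = cnj (h y) * ((of_real (A' y) - \<i> * B' y) * h y - (of_real (A y) - \<i> * B y))"
    by (simp add: r_def)
  ultimately have "cnj (h y) * q = cnj (h y) * (h y * ((of_real (A' y) + \<i> * B' y) * h y - (of_real (A y) + \<i> * B y)))"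
    using cr unfolding scale_f(1)[OF y] by algebra
  then have "q = h y * ((of_real (A' y) + \<i> * B' y) * h y - (of_real (A y) + \<i> * B y))"
    using h0[OF y] by simp
  with q show ?thesis unfolding r_def by simp
qed

text \<open>The forms B \<beta> + cnj (B \<beta>) and B' \<theta> + cnj (B' \<theta>) differ by the
  closed form Im (dh / h), hence have the same exterior derivative. The third structure equation
  evaluates it for each coframe, and \<theta> \<and> cnj \<theta> carries the factor h cnj
  h.\<close>

lemma norm_h:
  assumes y: "y \<in> U"
  shows "\<epsilon>' y = \<epsilon> y" "h y * cnj (h y) = 1"
proof -
  have fr1: "frame (\<alpha> y) (\<beta> y) (\<lambda>v. cnj (\<beta> y v))" using fr[OF y] by blast
  let ?S = "\<lambda>y v. B y * \<beta> y v + cnj (B y) * cnj (\<beta> y v)"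
    and ?K = "\<lambda>z v. complex_of_real (Im (fd h z v * inverse (h z)))"
  have bl: "bounded_linear (\<lambda>w. complex_of_real (Im w))"
    by (rule bounded_linear_compose[OF bounded_linear_of_real bounded_linear_Im])
  have K: "smooth_on (\<lambda>z. fd h z v * inverse (h z)) U" for v
    using smooth_on_divide[OF U smooth_on_fd[OF h] h h0] by (simp add: divide_inverse)
  have eq: "B' z * \<theta> z v + cnj (B' z) * cnj (\<theta> z v) = ?S z v + ?K z v" if z: "z \<in> U" for z v
  proof -
    have "fd h z v * inverse (h z) = ((of_real (A' z) + \<i> * B' z) * h z - (of_real (A z) + \<i> * B z)) * \<beta> z v
      + ((of_real (A' z) + \<i> * cnj (B' z)) * cnj (h z) - (of_real (A z) + \<i> * cnj (B z))) * cnj (\<beta> z v)"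
      unfolding fd_h[OF z] using h0[OF z] by (simp add: field_simps)
    then show ?thesis
      by (simp add: \<theta>[OF z] complex_eq_iff algebra_simps)
  qed
  have dS: "smooth_on (\<lambda>z. ?S z v) U" for v
    by (intro smooth_on_add smooth_on_mult smooth_on_cnj U B \<beta>)
  have e: "ed (\<lambda>z v. B' z * \<theta> z v + cnj (B' z) * cnj (\<theta> z v)) y u v = ed ?S y u v" for u v
  proof -
    have "ed (\<lambda>z v. B' z * \<theta> z v + cnj (B' z) * cnj (\<theta> z v)) y u v = ed (\<lambda>z v. ?S z v + ?K z v) y u v"
      by (rule ed_cong[OF U y eq])
    also have "\<dots> = ed ?S y u v + ed ?K y u v"
      by (rule ed_add[OF smooth_on_differentiable[OF dS U y]
            smooth_on_differentiable[OF smooth_on_linear_compose[OF U bl K] U y]])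
    also have "ed ?K y u v = of_real (Im (ed (\<lambda>z v. fd h z v * inverse (h z)) y u v))"
      by (rule ed_linear_compose[where \<alpha> = "\<lambda>z v. fd h z v * inverse (h z)",
            OF bl smooth_on_differentiable[OF K U y]])
    also have "ed (\<lambda>z v. fd h z v * inverse (h z)) y u v = 0"
      by (rule ed_log[OF U y h h0])
    finally show ?thesis by simp
  qed
  have e1: "ed ?S y u v = - of_real (\<epsilon> y) * \<i> * wed (\<beta> y) (\<lambda>v. cnj (\<beta> y v)) u v" for u v
    using se[OF y] unfolding structure_eqs_def by blast
  have e2: "ed (\<lambda>z v. B' z * \<theta> z v + cnj (B' z) * cnj (\<theta> z v)) y u v
      = - of_real (\<epsilon>' y) * \<i> * wed (\<theta> y) (\<lambda>v. cnj (\<theta> y v)) u v" for u v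
    using se'[OF y] unfolding structure_eqs_def by blast
  have "(\<i> * (of_real (\<epsilon> y) - of_real (\<epsilon>' y) * (h y * cnj (h y)))) * wed (\<beta> y) (\<lambda>v. cnj (\<beta> y v)) u v
      + 0 * wed (\<beta> y) (\<alpha> y) u v + 0 * wed (\<lambda>v. cnj (\<beta> y v)) (\<alpha> y) u v = 0" for u v
    using e[of u v] unfolding e1 e2 \<theta>[OF y] complex_cnj_mult by algebra
  from frame_indep2(1)[OF fr1 this]
  have \<epsilon>\<epsilon>': "complex_of_real (\<epsilon> y) = of_real (\<epsilon>' y * (cmod (h y))\<^sup>2)"
    by (simp only: of_real_mult complex_norm_square) simp
  \<comment> \<open>A nonnegative factor between two signs can only be 1.\<close>
  have aux: "e' = e \<and> t = 1" if "e = e' * t" "e = 1 \<or> e = - 1" "e' = 1 \<or> e' = - 1" "t \<ge> 0" for e e' t :: real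
    using that by auto
  from \<epsilon>\<epsilon>' have "\<epsilon> y = \<epsilon>' y * (cmod (h y))\<^sup>2" by (simp only: of_real_eq_iff)
  moreover have "\<epsilon> y = 1 \<or> \<epsilon> y = - 1" "\<epsilon>' y = 1 \<or> \<epsilon>' y = - 1"
    using se[OF y] se'[OF y] unfolding structure_eqs_def by blast+
  moreover have "(cmod (h y))\<^sup>2 \<ge> 0" by simp
  ultimately have "\<epsilon>' y = \<epsilon> y" "(cmod (h y))\<^sup>2 = 1"
    using aux[of "\<epsilon> y" "\<epsilon>' y" "(cmod (h y))\<^sup>2"] by blast+
  then show "\<epsilon>' y = \<epsilon> y" "h y * cnj (h y) = 1"
    by (simp_all add: complex_norm_square[symmetric])
qed

lemma coframes_equal:
  assumes y: "y \<in> U"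
  shows "f y = 1" "h y = 1" "A' y = A y" "B' y = B y" "\<epsilon>' y = \<epsilon> y"
proof -
  have f1: "f z = 1" if "z \<in> U" for z
    using scale_f(1)[OF that] norm_h(2)[OF that] by simp
  have h1: "h z = 1" if z: "z \<in> U" for z
  proof -
    \<comment> \<open>Since f = 1 near z, df = 0, and the formula for its \<beta>-component reads A'
      h = A.\<close>
    have "fd f z = fd (\<lambda>z. 1) z" by (rule fd_cong[OF U z f1])
    then have "of_real (fd f z v) = 0 * \<alpha> z v + 0 * \<beta> z v + 0 * cnj (\<beta> z v)" for v by simp
    from scale_f(2)[OF z this] f1[OF z] have *: "of_real (A' z) * h z = of_real (A z)" by simp
    have "A' z > 0" "A z > 0" using se[OF z] se'[OF z] by (auto simp: structure_eqs_def)
    then have "h z = of_real (A z / A' z)" using * by (simp add: field_simps)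
    moreover have "(A z / A' z) * (A z / A' z) = 1"
      using norm_h(2)[OF z] unfolding calculation
      by (metis complex_cnj_complex_of_real of_real_eq_1_iff of_real_mult)
    moreover have "A z / A' z > 0" using \<open>A' z > 0\<close> \<open>A z > 0\<close> by simp
    ultimately show ?thesis
      by (metis less_eq_real_def mult_eq_1_iff not_less of_real_1 square_eq_1_iff zero_less_one neg_0_less_iff_less less_asym)
  qed
  show "f y = 1" "h y = 1" "\<epsilon>' y = \<epsilon> y" using f1 h1 norm_h y by auto
  have fr1: "frame (\<alpha> y) (\<beta> y) (\<lambda>v. cnj (\<beta> y v))" using fr[OF y] by blast
  \<comment> \<open>As h = 1 on all of U, the connection forms agree. The real A and the complex B
    are separated by using both the \<beta>- and the cnj \<beta>-component.\<close>
  have "fd h y = fd (\<lambda>z. 1) y" by (rule fd_cong[OF U y h1])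
  then have "0 = fd h y v" for v by simp
  then have "0 * \<alpha> y v + ((of_real (A' y) + \<i> * B' y) - (of_real (A y) + \<i> * B y)) * \<beta> y v
    + ((of_real (A' y) + \<i> * cnj (B' y)) - (of_real (A y) + \<i> * cnj (B y))) * cnj (\<beta> y v) = 0" for v
    unfolding fd_h[OF y] h1[OF y] by simp
  from frame_indep(2,3)[OF fr1 this]
  have "(of_real (A' y) + \<i> * B' y) - (of_real (A y) + \<i> * B y) = 0"
     "(of_real (A' y) + \<i> * cnj (B' y)) - (of_real (A y) + \<i> * cnj (B y)) = 0" .
  then show "A' y = A y" "B' y = B y" by (simp_all add: complex_eq_iff)
qed

end

section \<open>Forms and functions on a manifold\<close>

text \<open>Openness read off in the charts, in keeping with \<open>charted\<close>, which leaves
  the topology aside.\<close>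

definition chart_opens :: "('a, 'e::euclidean_space) mfd \<Rightarrow> 'a set \<Rightarrow> bool" where
  "chart_opens M W \<longleftrightarrow> W \<subseteq> points M \<and> (\<forall>c\<in>atlas M. open (snd c ` (fst c \<inter> W)))"

lemma chart_opens_points: "charted M \<Longrightarrow> chart_opens M (points M)"
  by (simp add: chart_opens_def chart_open charted_subset inf.absorb1)

lemma smooth_fun_iff:
  "charted M \<Longrightarrow> smooth_fun M f \<longleftrightarrow> (\<forall>c\<in>atlas M. smooth_on (\<lambda>y. f (chart_inv c y)) (snd c ` fst c))"
  by (simp add: smooth_fun_on_def charted_subset inf.absorb1 o_def)

lemma smooth_fun_chart:
  "charted M \<Longrightarrow> smooth_fun M f \<Longrightarrow> c \<in> atlas M \<Longrightarrow> smooth_on (\<lambda>y. f (chart_inv c y)) (snd c ` fst c)"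
  by (simp add: smooth_fun_iff)

lemma form_eq_points:
  "charted M \<Longrightarrow> form_eq M (points M) \<alpha> \<beta> \<longleftrightarrow> (\<forall>c\<in>atlas M. \<forall>x\<in>fst c. \<alpha> c x = \<beta> c x)"
  by (simp add: form_eq_def charted_subset inf.absorb1 cong: ball_cong)

lemma one_form_cong:
  assumes M: "charted M" and \<beta>: "one_form M \<beta>" and eq: "form_eq M (points M) \<alpha> \<beta>"
  shows "one_form M \<alpha>"
  unfolding one_form_def
proof (intro ballI conjI allI)
  have eq: "\<alpha> c x = \<beta> c x" if "c \<in> atlas M" "x \<in> fst c" for c x
    using that eq M by (simp add: form_eq_points)
  fix c assume c: "c \<in> atlas M"
  show "linear (\<alpha> c x)" if "x \<in> fst c" for x
    using one_form_linear[OF \<beta> c that] eq[OF c that] by simp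
  show "smooth_on (\<lambda>y. \<alpha> c (chart_inv c y) v) (snd c ` fst c)" for v
    by (rule smooth_on_cong[OF chart_open[OF M c] _ one_form_smooth[OF \<beta> c, of v]])
      (simp add: eq[OF c] chart_inv_in)
  show "\<alpha> c x v = \<alpha> d x (fd (snd d \<circ> chart_inv c) (snd c x) v)"
    if "d \<in> atlas M" "x \<in> fst c \<inter> fst d" for d x v
    using one_form_change[OF \<beta> c that(1), of x v] eq c that by simp
qed

lemma one_form_mult:
  assumes M: "charted M" and \<alpha>: "one_form M \<alpha>" and f: "smooth_fun M f"
  shows "one_form M (\<lambda>c x v. f x * \<alpha> c x v)"
  unfolding one_form_def
proof (intro ballI conjI allI)
  fix c assume c: "c \<in> atlas M"
  show "linear (\<lambda>v. f x * \<alpha> c x v)" if "x \<in> fst c" for x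
    using one_form_linear[OF \<alpha> c that]
    by (auto intro!: linearI simp: linear_add linear_scale distrib_left)
  show "smooth_on (\<lambda>y. f (chart_inv c y) * \<alpha> c (chart_inv c y) v) (snd c ` fst c)" for v
    by (intro smooth_on_mult chart_open[OF M c] one_form_smooth[OF \<alpha> c] smooth_fun_chart[OF M f c])
  show "f x * \<alpha> c x v = f x * \<alpha> d x (fd (snd d \<circ> chart_inv c) (snd c x) v)"
    if "d \<in> atlas M" "x \<in> fst c \<inter> fst d" for d x v
    using one_form_change[OF \<alpha> c that(1), of x v] that by simp
qed

lemma one_form_cnj:
  assumes M: "charted M" and \<alpha>: "one_form M \<alpha>"
  shows "one_form M (cnj_form \<alpha>)"
  unfolding one_form_def cnj_form_def
proof (intro ballI conjI allI)
  fix c assume c: "c \<in> atlas M"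
  show "linear (\<lambda>v. cnj (\<alpha> c x v))" if "x \<in> fst c" for x
    using one_form_linear[OF \<alpha> c that] by (auto intro!: linearI simp: linear_add linear_scale)
  show "smooth_on (\<lambda>y. cnj (\<alpha> c (chart_inv c y) v)) (snd c ` fst c)" for v
    by (intro smooth_on_cnj chart_open[OF M c] one_form_smooth[OF \<alpha> c])
  show "cnj (\<alpha> c x v) = cnj (\<alpha> d x (fd (snd d \<circ> chart_inv c) (snd c x) v))"
    if "d \<in> atlas M" "x \<in> fst c \<inter> fst d" for d x v
    using one_form_change[OF \<alpha> c that(1), of x v] that by simp
qed

lemma one_form_add:
  assumes M: "charted M" and \<alpha>: "one_form M \<alpha>" and \<beta>: "one_form M \<beta>"
  shows "one_form M (\<lambda>c x v. \<alpha> c x v + \<beta> c x v)"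
  unfolding one_form_def
proof (intro ballI conjI allI)
  fix c assume c: "c \<in> atlas M"
  show "linear (\<lambda>v. \<alpha> c x v + \<beta> c x v)" if "x \<in> fst c" for x
    using one_form_linear[OF \<alpha> c that] one_form_linear[OF \<beta> c that] by (rule linear_compose_add)
  show "smooth_on (\<lambda>y. \<alpha> c (chart_inv c y) v + \<beta> c (chart_inv c y) v) (snd c ` fst c)" for v
    by (intro smooth_on_add chart_open[OF M c] one_form_smooth[OF \<alpha> c] one_form_smooth[OF \<beta> c])
  show "\<alpha> c x v + \<beta> c x v = \<alpha> d x (fd (snd d \<circ> chart_inv c) (snd c x) v)
      + \<beta> d x (fd (snd d \<circ> chart_inv c) (snd c x) v)"
    if "d \<in> atlas M" "x \<in> fst c \<inter> fst d" for d x v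
    using one_form_change[OF \<alpha> c that(1), of x v] one_form_change[OF \<beta> c that(1), of x v] that by simp
qed

lemma cframe_scale:
  assumes "cframe \<alpha> \<beta>" "f \<noteq> 0" "h \<noteq> 0"
  shows "cframe (\<lambda>v. of_real f * \<alpha> v) (\<lambda>v. h * \<beta> v)"
proof -
  have l: "linear \<alpha>" "linear \<beta>" and n: "vol \<alpha> \<beta> (\<lambda>v. cnj (\<beta> v)) e1 e2 e3 \<noteq> 0"
    using assms(1) frame_basis[of \<alpha> \<beta>] unfolding frame_def by blast+
  have "vol (\<lambda>v. of_real f * \<alpha> v) (\<lambda>v. h * \<beta> v) (\<lambda>v. cnj (h * \<beta> v)) e1 e2 e3
      = of_real f * h * cnj h * vol \<alpha> \<beta> (\<lambda>v. cnj (\<beta> v)) e1 e2 e3"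
    unfolding complex_cnj_mult by algebra
  then have "vol (\<lambda>v. of_real f * \<alpha> v) (\<lambda>v. h * \<beta> v) (\<lambda>v. cnj (h * \<beta> v)) e1 e2 e3 \<noteq> 0"
    using n assms(2,3) by simp
  moreover have "linear (\<lambda>v. of_real f * \<alpha> v)" "linear (\<lambda>v. h * \<beta> v)" "linear (\<lambda>v. cnj (h * \<beta> v))"
    using l by (auto intro!: linearI simp: linear_add linear_scale distrib_left)
  ultimately show ?thesis
    using assms(1) unfolding frame_def by (meson Reals_mult Reals_of_real)
qed

lemma oc_pair_cframe:
  assumes "oc_pair M lam \<mu>" "c \<in> atlas M" "x \<in> fst c"
  shows "cframe (lam c x) (\<mu> c x)"
proof -
  have o: "one_form M lam" "one_form M \<mu>" "\<And>v. lam c x v \<in> \<real>"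
    and n: "\<exists>u v w. wedge21 (lam \<^bold>\<and> \<mu>) (cnj_form \<mu>) c x u v w \<noteq> 0"
    using assms by (auto simp: oc_pair_def real_form_def)
  have "linear (\<lambda>v. cnj (\<mu> c x v))"
    using one_form_linear[OF o(2) assms(2,3)] by (auto intro!: linearI simp: linear_add linear_scale)
  then show ?thesis
    using one_form_linear[OF o(1) assms(2,3)] one_form_linear[OF o(2) assms(2,3)] n o(3)
    by (auto simp: frame_def wedge21_def wedge_def cnj_form_def)
qed

lemma oc_pairI:
  assumes "one_form M lam" "one_form M \<mu>" "\<And>c x. c \<in> atlas M \<Longrightarrow> x \<in> fst c \<Longrightarrow> cframe (lam c x) (\<mu> c x)"
  shows "oc_pair M lam \<mu>"
  using assms unfolding oc_pair_def real_form_def frame_def wedge21_def wedge_def cnj_form_def by blast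

lemma coframe3I:
  assumes "charted M" "one_form M lam" "one_form M \<mu>"
    "\<And>c x. c \<in> atlas M \<Longrightarrow> x \<in> fst c \<Longrightarrow> cframe (lam c x) (\<mu> c x)"
  shows "coframe M [lam, \<mu>, cnj_form \<mu>]"
  unfolding coframe_def
proof (intro conjI ballI allI impI)
  show "length [lam, \<mu>, cnj_form \<mu>] = DIM(real^3)" by simp
  show "one_form M \<alpha>" if "\<alpha> \<in> set [lam, \<mu>, cnj_form \<mu>]" for \<alpha>
    using that assms one_form_cnj by auto
  fix c x and k :: "nat \<Rightarrow> complex" and i assume c: "c \<in> atlas M" "x \<in> fst c"
    and *: "\<forall>v. (\<Sum>i<length [lam, \<mu>, cnj_form \<mu>]. k i * ([lam, \<mu>, cnj_form \<mu>] ! i) c x v) = 0"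
    and i: "i < length [lam, \<mu>, cnj_form \<mu>]"
  have fr: "frame (lam c x) (\<mu> c x) (\<lambda>v. cnj (\<mu> c x v))" using assms(4)[OF c] by blast
  have "k 0 * lam c x v + k 1 * \<mu> c x v + k 2 * cnj (\<mu> c x v) = 0" for v
    using *[rule_format, of v] by (simp add: numeral_3_eq_3 cnj_form_def numeral_2_eq_2)
  from frame_indep[OF fr this] show "k i = 0"
    using i by (auto simp: numeral_3_eq_3 less_Suc_eq numeral_2_eq_2)
qed

text \<open>Cramer's rule makes \<open>q\<close> a quotient of determinants of smooth functions.
  Through it A1 and B1, known only from pointwise relations between forms, become smooth.\<close>

lemma smooth_coeff:
  assumes M: "charted M" and \<alpha>: "one_form M \<alpha>" and \<beta>: "one_form M \<beta>"
    and fr: "\<And>c x. c \<in> atlas M \<Longrightarrow> x \<in> fst c \<Longrightarrow> cframe (\<alpha> c x) (\<beta> c x)"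
    and X: "\<And>c v. c \<in> atlas M \<Longrightarrow> smooth_on (\<lambda>y. X c (chart_inv c y) v) (snd c ` fst c)"
    and eq: "\<And>c x v. c \<in> atlas M \<Longrightarrow> x \<in> fst c \<Longrightarrow> X c x v = p x * \<alpha> c x v + q x * \<beta> c x v + r x * cnj (\<beta> c x v)"
  shows "smooth_fun M q"
  unfolding smooth_fun_iff[OF M]
proof
  fix c assume c: "c \<in> atlas M"
  let ?S = "snd c ` fst c" and ?a = "\<lambda>y. \<alpha> c (chart_inv c y)" and ?b = "\<lambda>y. \<beta> c (chart_inv c y)"
    and ?X = "\<lambda>y. X c (chart_inv c y)"
  have S: "open ?S" by (rule chart_open[OF M c])
  have fr': "frame (?a y) (?b y) (\<lambda>v. cnj (?b y v))" if "y \<in> ?S" for y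
    using fr[OF c chart_inv_in[OF that]] by blast
  have s: "smooth_on (\<lambda>y. ?a y v) ?S" "smooth_on (\<lambda>y. ?b y v) ?S"
    "smooth_on (\<lambda>y. cnj (?b y v)) ?S" "smooth_on (\<lambda>y. ?X y v) ?S" for v
    using one_form_smooth[OF \<alpha> c] one_form_smooth[OF \<beta> c] smooth_on_cnj[OF S] X[OF c] by auto
  have "smooth_on (\<lambda>y. vol (?a y) (?X y) (\<lambda>v. cnj (?b y v)) e1 e2 e3
      / vol (?a y) (?b y) (\<lambda>v. cnj (?b y v)) e1 e2 e3) ?S"
    using frame_basis[OF fr']
    by (intro smooth_on_divide smooth_on_add smooth_on_diff smooth_on_mult s S)
  then show "smooth_on (\<lambda>y. q (chart_inv c y)) ?S"
    by (rule smooth_on_cong[OF S, rotated]) (rule frame_coeff[OF fr' eq[OF c chart_inv_in], symmetric])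
qed

section \<open>The bundle and its sections\<close>

definition bundle_chart :: "('a, 'e) chart \<Rightarrow> ('a \<times> complex, 'e \<times> complex) chart" where
  "bundle_chart c = (fst c \<times> (- {0}), map_prod (snd c) id)"

lemma bundle_chart_simps [simp]:
  "fst (bundle_chart c) = fst c \<times> (- {0})" "snd (bundle_chart c) (x, w) = (snd c x, w)"
  "snd (bundle_chart c) ` (X \<times> Y) = snd c ` X \<times> Y"
  by (auto simp: bundle_chart_def map_prod_def image_iff) 

lemma atlas_bundle_P: "atlas (bundle_P M) = bundle_chart ` atlas M"
  by (simp add: bundle_P_def bundle_chart_def)

lemma points_bundle_P [simp]: "points (bundle_P M) = points M \<times> (- {0})"
  by (simp add: bundle_P_def)

lemma chart_inv_bundle_chart:
  assumes "charted M" "c \<in> atlas M" "y \<in> snd c ` fst c" "w \<noteq> 0"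
  shows "chart_inv (bundle_chart c) (y, w) = (chart_inv c y, w)"
proof -
  have "inj_on (snd (bundle_chart c)) (fst (bundle_chart c))"
    using assms by (auto simp: inj_on_def charted_def)
  from inv_into_f_f[OF this, of "(chart_inv c y, w)"] show ?thesis
    using assms chart_inv_in[OF assms(3)] chart_chart_inv[OF assms(3)] by (simp add: chart_inv_def)
qed

text \<open>The transition maps are those of M times the identity of the fibre.\<close>

lemma charted_bundle_P:
  assumes M: "charted M"
  shows "charted (bundle_P M)"
  unfolding charted_def
proof (intro conjI ballI)
  show "points (bundle_P M) = \<Union> (fst ` atlas (bundle_P M))"
    using M by (auto simp: atlas_bundle_P charted_def)
  fix c' assume "c' \<in> atlas (bundle_P M)"
  then obtain c where c: "c \<in> atlas M" "c' = bundle_chart c" by (auto simp: atlas_bundle_P)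
  show "open (snd c' ` fst c')" unfolding c(2) bundle_chart_simps by (intro open_Times chart_open[OF M c(1)]) auto
  show "inj_on (snd c') (fst c')" using M c by (auto simp: inj_on_def charted_def)
  fix d' assume "d' \<in> atlas (bundle_P M)"
  then obtain d where d: "d \<in> atlas M" "d' = bundle_chart d" by (auto simp: atlas_bundle_P)
  let ?T = "snd c ` (fst c \<inter> fst d)"
  have T: "open ?T" "smooth_on (snd d \<circ> chart_inv c) ?T" using M c d by (auto simp: charted_def)
  have int: "fst c' \<inter> fst d' = (fst c \<inter> fst d) \<times> (- {0})" by (auto simp: c(2) d(2))
  then have im: "snd c' ` (fst c' \<inter> fst d') = ?T \<times> (- {0})" by (simp add: c(2))
  have o: "open (?T \<times> (- {0::complex}))" by (intro open_Times T) auto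
  then show "open (snd c' ` (fst c' \<inter> fst d'))" by (simp add: im)
  have "smooth_on (\<lambda>p. ((snd d \<circ> chart_inv c) (fst p), snd p)) (?T \<times> (- {0::complex}))"
    by (intro smooth_on_Pair smooth_on_compose[OF o T(1) _ T(2)] smooth_on_bounded_linear o
        bounded_linear_fst bounded_linear_snd) auto
  then show "smooth_on (snd d' \<circ> chart_inv c') (snd c' ` (fst c' \<inter> fst d'))"
    unfolding im
  proof (rule smooth_on_cong[OF o, rotated])
    fix p assume "p \<in> ?T \<times> (- {0::complex})"
    then have "fst p \<in> snd c ` fst c" "snd p \<noteq> 0" by auto
    then show "((snd d \<circ> chart_inv c) (fst p), snd p) = (snd d' \<circ> chart_inv c') p"
      using chart_inv_bundle_chart[OF M c(1), of "fst p" "snd p"] by (simp add: c(2) d(2))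
  qed
qed

lemma chart_rep_fst:
  assumes M: "charted M" and c: "c \<in> atlas M"
  shows "chart_rep (bundle_P M) (bundle_chart c) (snd c ` fst c \<times> (- {0})) M c fst"
proof -
  have o: "open (snd c ` fst c \<times> (- {0::complex}))" by (intro open_Times chart_open[OF M c]) auto
  have eq: "(snd c \<circ> fst \<circ> chart_inv (bundle_chart c)) p = fst p" if "p \<in> snd c ` fst c \<times> (- {0})" for p
    using that chart_chart_inv[of "fst p" c] chart_inv_bundle_chart[OF M c, of "fst p" "snd p"]
    by (cases p) auto
  have "smooth_on (snd c \<circ> fst \<circ> chart_inv (bundle_chart c)) (snd c ` fst c \<times> (- {0}))"
    by (rule smooth_on_cong[OF o eq[symmetric] smooth_on_bounded_linear[OF o bounded_linear_fst]])
  then show ?thesis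
    unfolding chart_rep_def
    using c o chart_inv_bundle_chart[OF M c] chart_inv_in[of _ c] by (auto simp: atlas_bundle_P)
qed

text \<open>In product charts the projection is linear, hence its own derivative.\<close>

lemma pullback_fst:
  assumes M: "charted M" and c: "c \<in> atlas M" "x \<in> fst c" "w \<noteq> 0" and \<theta>: "one_form M \<theta>"
  shows "pullback M fst \<theta> (bundle_chart c) (x, w) v = \<theta> c x (fst v)"
proof -
  let ?T = "snd c ` fst c \<times> (- {0::complex})"
  have o: "open ?T" by (intro open_Times chart_open[OF M c(1)]) auto
  have x: "(snd c x, w) \<in> ?T" using c by simp
  have eq: "(snd c \<circ> fst \<circ> chart_inv (bundle_chart c)) p = fst p" if "p \<in> ?T" for p
    using that chart_chart_inv[of "fst p" c] chart_inv_bundle_chart[OF M c(1), of "fst p" "snd p"]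
    by (cases p) auto
  have "fd (snd c \<circ> fst \<circ> chart_inv (bundle_chart c)) (snd c x, w) = fd fst (snd c x, w)"
    by (rule fd_cong[OF o x eq])
  also have "\<dots> = fst" by (rule fd_eqI[OF bounded_linear_imp_has_derivative[OF bounded_linear_fst]])
  finally show ?thesis
    using pullback_eq[OF charted_bundle_P[OF M] M chart_rep_fst[OF M c(1)] \<theta>, of "(x, w)" v] c by simp
qed

section \<open>Sections of the bundle and the Cartan coframe pulled back along them\<close>

lemma chart_rep_section:
  assumes M: "charted M" and c: "c \<in> atlas M" and z: "smooth_fun M z" and z0: "\<And>x. x \<in> points M \<Longrightarrow> z x \<noteq> 0"
  shows "chart_rep M c (snd c ` fst c) (bundle_P M) (bundle_chart c) (\<lambda>x. (x, z x))"
    and "y \<in> snd c ` fst c \<Longrightarrow> (snd (bundle_chart c) \<circ> (\<lambda>x. (x, z x)) \<circ> chart_inv c) y = (y, z (chart_inv c y))"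
proof -
  have S: "open (snd c ` fst c)" by (rule chart_open[OF M c])
  have z0': "z (chart_inv c y) \<noteq> 0" if "y \<in> snd c ` fst c" for y
    using z0 chart_inv_in[OF that] charted_subset[OF M c] by blast
  show eq: "(snd (bundle_chart c) \<circ> (\<lambda>x. (x, z x)) \<circ> chart_inv c) y = (y, z (chart_inv c y))"
    if "y \<in> snd c ` fst c" for y
    using chart_chart_inv[OF that] by simp
  have "smooth_on (\<lambda>y. (y, z (chart_inv c y))) (snd c ` fst c)"
    by (intro smooth_on_Pair smooth_on_id S smooth_fun_chart[OF M z c])
  then have "smooth_on (snd (bundle_chart c) \<circ> (\<lambda>x. (x, z x)) \<circ> chart_inv c) (snd c ` fst c)"
    using smooth_on_cong[OF S, of "\<lambda>y. (y, z (chart_inv c y))"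
        "snd (bundle_chart c) \<circ> (\<lambda>x. (x, z x)) \<circ> chart_inv c"] eq by metis
  then show "chart_rep M c (snd c ` fst c) (bundle_P M) (bundle_chart c) (\<lambda>x. (x, z x))"
    unfolding chart_rep_def using c S z0' chart_inv_in[of _ c] by (simp add: atlas_bundle_P)
qed

text \<open>Positivity of \<open>\<A>\<close> along the section is not imposed, so that the locale
  covers the trial section as well as the rotated one.\<close>

locale section_N0 =
  fixes M :: "('a, real^3) mfd" and lam \<mu> a \<Omega> k1 \<A> and z :: "'a \<Rightarrow> complex"
  assumes M: "charted M" and oc: "oc_pair M lam \<mu>" and nd: "nondegenerate_data M lam \<mu> a \<Omega> k1 \<A>"
    and z: "smooth_fun M z" and zN0: "\<And>x. x \<in> points M \<Longrightarrow> (x, z x) \<in> N0 M k1"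
begin

abbreviation "P \<equiv> bundle_P M"
abbreviation "\<sigma> \<equiv> \<lambda>x. (x, z x)"
definition om :: "('a, real^3) form1" where "om c x v = of_real ((cmod (z x))\<^sup>2 / a x) * lam c x v"
definition om1 :: "('a, real^3) form1" where "om1 c x v = z x * \<mu> c x v"
definition \<tau> :: "('a, real^3) form1" where "\<tau> = pullback P \<sigma> \<Omega>"
text \<open>The differential of the section in charts, sending v to (v, dz v).\<close>

definition "L c x = fd (snd (bundle_chart c) \<circ> \<sigma> \<circ> chart_inv c) (snd c x)"

lemma z_nz: "x \<in> points M \<Longrightarrow> z x \<noteq> 0"
  using zN0 by (auto simp: N0_def)

lemma cmod_z: "x \<in> points M \<Longrightarrow> (cmod (z x))\<^sup>2 = \<bar>k1 x\<bar>"
  using zN0 by (auto simp: N0_def)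

lemma a_nz: "x \<in> points M \<Longrightarrow> a x \<noteq> 0" and a_smooth: "smooth_fun M a"
  using nd by (auto simp: nondegenerate_data_def structure_functions_def)

lemma k1_nz: assumes "x \<in> points M" shows "k1 x \<noteq> 0"
proof -
  have "K1_P k1 (x, 1) \<noteq> 0" using nd assms by (auto simp: nondegenerate_data_def)
  then show ?thesis by (simp add: K1_P_def)
qed

lemma k1_smooth: "smooth_fun M k1"
  using nd by (auto simp: nondegenerate_data_def cartan_coframe_def Let_def)

lemma P: "charted P" by (rule charted_bundle_P[OF M])

lemma forms_P: "one_form P (omega_P M a lam)" "one_form P (omega1_P M \<mu>)" "one_form P \<Omega>"
  using nd by (auto simp: nondegenerate_data_def cartan_coframe_def Let_def coframe_def)

lemma lam\<mu>: "one_form M lam" "one_form M \<mu>" using oc by (auto simp: oc_pair_def)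

lemma rep: "c \<in> atlas M \<Longrightarrow> chart_rep M c (snd c ` fst c) P (bundle_chart c) \<sigma>"
  by (rule chart_rep_section(1)[OF M _ z z_nz])

lemma \<tau>_smooth: "c \<in> atlas M \<Longrightarrow> smooth_on (\<lambda>y. \<tau> c (chart_inv c y) v) (snd c ` fst c)"
  unfolding \<tau>_def by (rule pullback_smooth[OF M P rep forms_P(3)])

context
  fixes c x assumes c: "c \<in> atlas M" and x: "x \<in> fst c"
begin

lemma xM: "x \<in> points M" using charted_subset[OF M c] x by blast

lemma sx: "snd c x \<in> snd c ` fst c" using x by simp

lemma fst_L: "fst (L c x v) = v"
proof -
  have S: "open (snd c ` fst c)" by (rule chart_open[OF M c])
  have "L c x = fd (\<lambda>y. (y, z (chart_inv c y))) (snd c x)"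
    unfolding L_def by (rule fd_cong[OF S sx chart_rep_section(2)[OF M c z z_nz]])
  also have "\<dots> = (\<lambda>v. (v, fd (\<lambda>y. z (chart_inv c y)) (snd c x) v))"
    by (intro fd_eqI has_derivative_Pair has_derivative_ident
        smooth_on_has_derivative[OF smooth_fun_chart[OF M z c] S sx])
  finally show ?thesis by simp
qed

lemma omega_P_section: "omega_P M a lam (bundle_chart c) (\<sigma> x) (L c x v) = om c x v"
  using pullback_fst[OF M c x z_nz[OF xM] lam\<mu>(1), of "L c x v"] fst_L by (simp add: omega_P_def om_def)

lemma omega1_P_section: "omega1_P M \<mu> (bundle_chart c) (\<sigma> x) (L c x v) = om1 c x v"
  using pullback_fst[OF M c x z_nz[OF xM] lam\<mu>(2), of "L c x v"] fst_L by (simp add: omega1_P_def om1_def)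

lemma \<Omega>_section: "\<Omega> (bundle_chart c) (\<sigma> x) (L c x v) = \<tau> c x v"
  unfolding \<tau>_def L_def by (rule pullback_eq[OF M P rep[OF c] forms_P(3) x sx, symmetric])

lemma pullback_om: "pullback P \<sigma> (omega_P M a lam) c x = om c x"
  by (rule ext, unfold omega_P_section[symmetric] L_def, rule pullback_eq[OF M P rep[OF c] forms_P(1) x sx])

lemma pullback_om1: "pullback P \<sigma> (omega1_P M \<mu>) c x = om1 c x"
  by (rule ext, unfold omega1_P_section[symmetric] L_def, rule pullback_eq[OF M P rep[OF c] forms_P(2) x sx])

lemma \<tau>_linear: "linear (\<tau> c x)"
  unfolding \<tau>_def by (rule pullback_linear[OF M P rep[OF c] forms_P(3) x sx])

lemma sP: "\<sigma> x \<in> fst (bundle_chart c) \<inter> points P" and cP: "bundle_chart c \<in> atlas P"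
  using x xM z_nz c by (auto simp: atlas_bundle_P)

text \<open>Along the section K2 vanishes, and K1 = k1 / |z|^2 is the sign of k1 because |z|^2 =
  |k1| on \<open>N0\<close>.\<close>

lemma d_\<tau>: "d1 \<tau> c x u v = of_real (sgn (k1 x)) * wed (om1 c x) (\<lambda>v. cnj (om1 c x v)) u v"
proof -
  obtain k2 where cart: "cartan_coframe M lam \<mu> a \<Omega> k1 k2" and K2: "\<And>y. y \<in> points P \<Longrightarrow> K2_P k2 y = 0"
    using nd by (auto simp: nondegenerate_data_def)
  have "d1 \<tau> c x u v = d1 \<Omega> (bundle_chart c) (\<sigma> x) (L c x u) (L c x v)"
    unfolding \<tau>_def L_def by (rule d1_pullback[OF M P rep[OF c] forms_P(3) x sx])
  also have "d1 \<Omega> (bundle_chart c) (\<sigma> x) = (\<lambda>u v. of_real (K1_P k1 (\<sigma> x)) *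
      (omega1_P M \<mu> \<^bold>\<and> cnj_form (omega1_P M \<mu>)) (bundle_chart c) (\<sigma> x) u v
           + K2_P k2 (\<sigma> x) * (omega1_P M \<mu> \<^bold>\<and> omega_P M a lam) (bundle_chart c) (\<sigma> x) u v)"
    using cart sP cP unfolding cartan_coframe_def Let_def form_eq_def by blast
  finally have "d1 \<tau> c x u v = of_real (K1_P k1 (\<sigma> x)) * wed (om1 c x) (\<lambda>v. cnj (om1 c x v)) u v"
    using K2[of "\<sigma> x"] xM z_nz by (simp add: wedge_def cnj_form_def omega1_P_section)
  moreover have "K1_P k1 (\<sigma> x) = sgn (k1 x)"
    using cmod_z[OF xM] k1_nz[OF xM] by (simp add: K1_P_def sgn_if)
  ultimately show ?thesis by simp
qed

lemma d_om1: "d1 om1 c x u v = wed (\<tau> c x) (om1 c x) u v"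
proof -
  obtain k2 where cart: "cartan_coframe M lam \<mu> a \<Omega> k1 k2"
    using nd by (auto simp: nondegenerate_data_def)
  have "d1 om1 c x u v = d1 (pullback P \<sigma> (omega1_P M \<mu>)) c x u v"
    \<comment> \<open>Exterior differentiation needs the identity at all neighbouring points,
      whereas this context fixes x; hence the appeal to the exported form of
      \<open>pullback_om1\<close>.\<close>
    by (rule d1_cong[OF M c chart_open[OF M c] order_refl x sx]) (use pullback_om1 c section_N0.pullback_om1[OF section_N0_axioms c] in auto)
  also have "\<dots> = d1 (omega1_P M \<mu>) (bundle_chart c) (\<sigma> x) (L c x u) (L c x v)"
    unfolding L_def by (rule d1_pullback[OF M P rep[OF c] forms_P(2) x sx])
  also have "d1 (omega1_P M \<mu>) (bundle_chart c) (\<sigma> x) = (\<Omega> \<^bold>\<and> omega1_P M \<mu>) (bundle_chart c) (\<sigma> x)"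
    using cart sP cP unfolding cartan_coframe_def Let_def form_eq_def by blast
  finally show ?thesis by (simp add: wedge_def omega1_P_section \<Omega>_section)
qed

lemma d_om: "d1 om c x u v = \<i> * wed (om1 c x) (\<lambda>v. cnj (om1 c x v)) u v
    + wed (\<lambda>v. \<tau> c x v + cnj (\<tau> c x v)) (om c x) u v"
proof -
  obtain k2 where cart: "cartan_coframe M lam \<mu> a \<Omega> k1 k2"
    using nd by (auto simp: nondegenerate_data_def)
  have "d1 om c x u v = d1 (pullback P \<sigma> (omega_P M a lam)) c x u v"
    by (rule d1_cong[OF M c chart_open[OF M c] order_refl x sx]) (use section_N0.pullback_om[OF section_N0_axioms c] in auto)
  also have "\<dots> = d1 (omega_P M a lam) (bundle_chart c) (\<sigma> x) (L c x u) (L c x v)"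
    unfolding L_def by (rule d1_pullback[OF M P rep[OF c] forms_P(1) x sx])
  also have "d1 (omega_P M a lam) (bundle_chart c) (\<sigma> x) = (\<lambda>u v.
      \<i> * (omega1_P M \<mu> \<^bold>\<and> cnj_form (omega1_P M \<mu>)) (bundle_chart c) (\<sigma> x) u v
      + (\<Omega> \<^bold>\<and> omega_P M a lam) (bundle_chart c) (\<sigma> x) u v
      + (cnj_form \<Omega> \<^bold>\<and> omega_P M a lam) (bundle_chart c) (\<sigma> x) u v)"
    using cart sP cP unfolding cartan_coframe_def Let_def form_eq_def by blast
  finally show ?thesis
    by (simp add: wedge_def cnj_form_def omega1_P_section omega_P_section \<Omega>_section algebra_simps)
qed

text \<open>The function defining \<open>N0\<close> vanishes along the section, and the chain rule
  transfers this to its differential. It is differentiable because k1 has no zero, so that |k1| is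
  smooth.\<close>

lemma tangent_N0: "d0 (\<lambda>(x, w). (cmod w)\<^sup>2 - \<bar>k1 x\<bar>) (bundle_chart c) (\<sigma> x) (L c x v) = 0"
proof -
  let ?F = "\<lambda>(x, w). (cmod w)\<^sup>2 - \<bar>k1 x\<bar>" and ?g = "snd (bundle_chart c) \<circ> \<sigma> \<circ> chart_inv c"
    and ?T = "snd c ` fst c \<times> (- {0::complex})" and ?S = "snd c ` fst c"
  let ?G = "?F \<circ> chart_inv (bundle_chart c)"
  have S: "open ?S" by (rule chart_open[OF M c])
  have T: "open ?T" by (intro open_Times S) auto
  have k: "smooth_on (\<lambda>p. \<bar>k1 (chart_inv c (fst p))\<bar>) ?T"
    using k1_nz charted_subset[OF M c] M c
    by (intro smooth_on_abs T smooth_on_compose[OF T S _ smooth_fun_chart[OF M k1_smooth c]]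
        smooth_on_bounded_linear bounded_linear_fst) auto
  have "smooth_on (\<lambda>p. Re (snd p) * Re (snd p) + Im (snd p) * Im (snd p) - \<bar>k1 (chart_inv c (fst p))\<bar>) ?T"
    by (intro smooth_on_diff smooth_on_add smooth_on_mult T k
        smooth_on_linear_compose[OF T bounded_linear_Re] smooth_on_linear_compose[OF T bounded_linear_Im]
        smooth_on_bounded_linear bounded_linear_snd)
  then have G: "smooth_on ?G ?T"
  proof (rule smooth_on_cong[OF T, rotated])
    fix p assume "p \<in> ?T"
    then have "fst p \<in> snd c ` fst c" "snd p \<noteq> 0" by auto
    then show "Re (snd p) * Re (snd p) + Im (snd p) * Im (snd p) - \<bar>k1 (chart_inv c (fst p))\<bar> = ?G p"
      using chart_inv_bundle_chart[OF M c, of "fst p" "snd p"] by (simp add: cmod_power2 flip: power2_eq_square)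
  qed
  have gx: "?g (snd c x) = (snd c x, z x)" using M c x by simp
  then have gT: "?g (snd c x) \<in> ?T" using x z_nz[OF xM] by simp
  have g: "?g differentiable (at (snd c x))"
    using rep[OF c] S sx by (auto simp: chart_rep_def intro: smooth_on_differentiable)
  have "fd ?G (?g (snd c x)) (fd ?g (snd c x) v) = fd (\<lambda>y. ?G (?g y)) (snd c x) v"
    by (simp only: fd_chain[OF g smooth_on_differentiable[OF G T gT]])
  also have "fd (\<lambda>y. ?G (?g y)) (snd c x) = fd (\<lambda>y. 0) (snd c x)"
  proof (rule fd_cong[OF S sx])
    fix y assume y: "y \<in> ?S"
    have p: "chart_inv c y \<in> points M" using chart_inv_in[OF y] charted_subset[OF M c] by blast
    show "?G (?g y) = 0"
      using chart_rep_section(2)[OF M c z z_nz y] chart_inv_bundle_chart[OF M c y z_nz[OF p]] cmod_z[OF p]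
      by simp
  qed
  finally have "fd ?G (?g (snd c x)) (fd ?g (snd c x) v) = 0" by (simp only: frechet_derivative_const)
  then show ?thesis unfolding L_def d0_def gx bundle_chart_simps .
qed

text \<open>\<open>eq_on_N0\<close> speaks only of vectors tangent to \<open>N0\<close>; by
  \<open>tangent_N0\<close> the vectors \<open>L c x v\<close> are among them.\<close>

lemma \<tau>_re: "\<tau> c x v + cnj (\<tau> c x v) = 2 * (\<A> (\<sigma> x) * om1 c x v + cnj (\<A> (\<sigma> x)) * cnj (om1 c x v))"
proof -
  have "\<sigma> x \<in> fst (bundle_chart c) \<inter> N0 M k1" using sP zN0[OF xM] by auto
  then have "\<Omega> (bundle_chart c) (\<sigma> x) (L c x v) + cnj (\<Omega> (bundle_chart c) (\<sigma> x) (L c x v)) =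
     2 * (\<A> (\<sigma> x) * omega1_P M \<mu> (bundle_chart c) (\<sigma> x) (L c x v)
       + cnj (\<A> (\<sigma> x)) * cnj (omega1_P M \<mu> (bundle_chart c) (\<sigma> x) (L c x v)))"
    using nd tangent_N0 cP unfolding nondegenerate_data_def eq_on_N0_def by blast
  then show ?thesis by (simp add: omega1_P_section \<Omega>_section)
qed

lemma frame_om: "cframe (om c x) (om1 c x)"
proof -
  have "(cmod (z x))\<^sup>2 / a x \<noteq> 0" using z_nz[OF xM] a_nz[OF xM] by simp
  from cframe_scale[OF oc_pair_cframe[OF oc c x] this z_nz[OF xM]] show ?thesis
    by (simp add: om_def[abs_def] om1_def[abs_def])
qed

end

lemma om_smooth: "smooth_fun M (\<lambda>x. (cmod (z x))\<^sup>2 / a x)"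
  unfolding smooth_fun_iff[OF M]
proof
  fix c assume c: "c \<in> atlas M"
  have p: "chart_inv c y \<in> points M" if "y \<in> snd c ` fst c" for y
    using chart_inv_in[OF that] charted_subset[OF M c] by blast
  show "smooth_on (\<lambda>y. (cmod (z (chart_inv c y)))\<^sup>2 / a (chart_inv c y)) (snd c ` fst c)"
    unfolding power2_eq_square
    by (intro smooth_on_divide smooth_on_mult smooth_on_cmod chart_open[OF M c] smooth_fun_chart[OF M _ c]
       z a_smooth a_nz p z_nz)
qed

lemma one_form_om: "one_form M om"
proof -
  have "smooth_fun M (\<lambda>x. complex_of_real ((cmod (z x))\<^sup>2 / a x))"
    using om_smooth smooth_on_of_real[OF chart_open[OF M]] unfolding smooth_fun_iff[OF M] by blast
  from one_form_mult[OF M lam\<mu>(1) this] show ?thesis by (simp add: om_def[abs_def])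
qed

lemma one_form_om1: "one_form M om1"
  using one_form_mult[OF M lam\<mu>(2) z] by (simp add: om1_def[abs_def])

text \<open>Twice this function is the \<open>om1\<close>-coefficient of the smooth form \<tau> +
  cnj \<tau>, which is the source of its smoothness.\<close>

lemma smooth_A: "smooth_fun M (\<lambda>x. \<A> (\<sigma> x))"
proof -
  have "smooth_fun M (\<lambda>x. 2 * \<A> (\<sigma> x))"
  proof (rule smooth_coeff[OF M one_form_om one_form_om1 frame_om])
    show "smooth_on (\<lambda>y. \<tau> c (chart_inv c y) v + cnj (\<tau> c (chart_inv c y) v)) (snd c ` fst c)"
      if "c \<in> atlas M" for c v
      by (intro smooth_on_add smooth_on_cnj \<tau>_smooth that chart_open[OF M])
    show "\<tau> c x v + cnj (\<tau> c x v) = 0 * om c x v + 2 * \<A> (\<sigma> x) * om1 c x v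
       + (2 * cnj (\<A> (\<sigma> x))) * cnj (om1 c x v)" if "c \<in> atlas M" "x \<in> fst c" for c x v
      using \<tau>_re[OF that] by (simp add: algebra_simps)
  qed
  then have "smooth_on (\<lambda>y. 2 * \<A> (\<sigma> (chart_inv c y)) / 2) (snd c ` fst c)" if "c \<in> atlas M" for c
    by (intro smooth_on_divide[OF chart_open[OF M that] smooth_fun_chart[OF M _ that] smooth_on_const]) simp_all
  then show ?thesis by (simp add: smooth_fun_iff[OF M])
qed

end

section \<open>Adapted coframes and positive sections\<close>

text \<open>The interface between the bundle and the rigidity argument: forms and functions on M
  alone, with the structure equations in every chart.\<close>

definition adapted :: "('a, real^3) mfd \<Rightarrow> ('a, real^3) form1 \<Rightarrow> ('a, real^3) form1 \<Rightarrow>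
    ('a \<Rightarrow> real) \<Rightarrow> ('a \<Rightarrow> complex) \<Rightarrow> ('a \<Rightarrow> real) \<Rightarrow> bool" where
  "adapted M \<omega> \<omega>\<^sub>1 A B \<epsilon> \<longleftrightarrow> one_form M \<omega> \<and> one_form M \<omega>\<^sub>1 \<and> smooth_fun M A \<and> smooth_fun M B \<and>
     (\<forall>c\<in>atlas M. \<forall>x\<in>fst c. cframe (\<omega> c x) (\<omega>\<^sub>1 c x)) \<and>
     (\<forall>c\<in>atlas M. \<forall>y\<in>snd c ` fst c. structure_eqs (\<lambda>y. \<omega> c (chart_inv c y)) (\<lambda>y. \<omega>\<^sub>1 c (chart_inv c y))
        (\<lambda>y. A (chart_inv c y)) (\<lambda>y. B (chart_inv c y)) (\<lambda>y. \<epsilon> (chart_inv c y)) y)"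

lemma structure_eqs_cong:
  assumes "structure_eqs \<alpha> \<beta> A B \<epsilon> y" "open U" "y \<in> U"
    "\<And>y v. y \<in> U \<Longrightarrow> \<alpha>' y v = \<alpha> y v" "\<And>y v. y \<in> U \<Longrightarrow> \<beta>' y v = \<beta> y v"
    "\<And>y. y \<in> U \<Longrightarrow> A' y = A y" "\<And>y. y \<in> U \<Longrightarrow> B' y = B y" "\<And>y. y \<in> U \<Longrightarrow> \<epsilon>' y = \<epsilon> y"
  shows "structure_eqs \<alpha>' \<beta>' A' B' \<epsilon>' y"
proof -
  have "ed \<alpha>' y u v = ed \<alpha> y u v" "ed \<beta>' y u v = ed \<beta> y u v"
    "ed (\<lambda>y v. B' y * \<beta>' y v + cnj (B' y) * cnj (\<beta>' y v)) y u v
      = ed (\<lambda>y v. B y * \<beta> y v + cnj (B y) * cnj (\<beta> y v)) y u v" for u v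
    by (rule ed_cong[OF assms(2,3)]; simp add: assms(4-8))+
  then show ?thesis
    using assms(1) unfolding structure_eqs_def assms(4-8)[OF assms(3)] by metis
qed

lemma adapted_cong:
  assumes M: "charted M" and ad: "adapted M \<omega> \<omega>\<^sub>1 A B \<epsilon>"
    and eq: "form_eq M (points M) \<omega>' \<omega>" "form_eq M (points M) \<omega>\<^sub>1' \<omega>\<^sub>1"
    and \<epsilon>: "\<And>x. x \<in> points M \<Longrightarrow> \<epsilon>' x = \<epsilon> x"
  shows "adapted M \<omega>' \<omega>\<^sub>1' A B \<epsilon>'"
  unfolding adapted_def
proof (intro conjI ballI)
  have e: "\<omega>' c x = \<omega> c x" "\<omega>\<^sub>1' c x = \<omega>\<^sub>1 c x" if "c \<in> atlas M" "x \<in> fst c" for c x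
    using eq that M by (simp_all add: form_eq_points)
  show "one_form M \<omega>'" "one_form M \<omega>\<^sub>1'"
    using one_form_cong[OF M _ eq(1)] one_form_cong[OF M _ eq(2)] ad by (simp_all add: adapted_def)
  show "smooth_fun M A" "smooth_fun M B" using ad by (simp_all add: adapted_def)
  fix c assume c: "c \<in> atlas M"
  show "frame (\<omega>' c x) (\<omega>\<^sub>1' c x) (\<lambda>v. cnj (\<omega>\<^sub>1' c x v))" "\<forall>v. \<omega>' c x v \<in> \<real>" if "x \<in> fst c" for x
    using e[OF c that] ad c that unfolding adapted_def by auto
  show "structure_eqs (\<lambda>y. \<omega>' c (chart_inv c y)) (\<lambda>y. \<omega>\<^sub>1' c (chart_inv c y))
        (\<lambda>y. A (chart_inv c y)) (\<lambda>y. B (chart_inv c y)) (\<lambda>y. \<epsilon>' (chart_inv c y)) y" if "y \<in> snd c ` fst c" for y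
  proof (rule structure_eqs_cong[OF _ chart_open[OF M c] that])
    show "structure_eqs (\<lambda>y. \<omega> c (chart_inv c y)) (\<lambda>y. \<omega>\<^sub>1 c (chart_inv c y))
        (\<lambda>y. A (chart_inv c y)) (\<lambda>y. B (chart_inv c y)) (\<lambda>y. \<epsilon> (chart_inv c y)) y"
      using ad c that unfolding adapted_def by blast
    show "\<omega>' c (chart_inv c z) v = \<omega> c (chart_inv c z) v" "\<omega>\<^sub>1' c (chart_inv c z) v = \<omega>\<^sub>1 c (chart_inv c z) v"
      "\<epsilon>' (chart_inv c z) = \<epsilon> (chart_inv c z)" if "z \<in> snd c ` fst c" for z v
      using e[OF c chart_inv_in[OF that]] \<epsilon>[OF subsetD[OF charted_subset[OF M c] chart_inv_in[OF that]]] by simp_all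
  qed simp_all
qed

section \<open>The invariants along a section where A1 is positive\<close>

context section_N0
begin

lemma \<tau>_change:
  assumes "c \<in> atlas M" "c' \<in> atlas M" "x \<in> fst c" "x \<in> fst c'"
  shows "\<tau> c x v = \<tau> c' x (fd (snd c' \<circ> chart_inv c) (snd c x) v)"
  unfolding \<tau>_def using assms
  by (intro pullback_change_chart[OF M P rep rep]) auto

context
  fixes A :: "'a \<Rightarrow> real"
  assumes A: "\<And>x. x \<in> points M \<Longrightarrow> \<A> (\<sigma> x) = of_real (A x)" and A_pos: "\<And>x. x \<in> points M \<Longrightarrow> A x > 0"
begin

lemma A_smooth: "smooth_fun M A"
  unfolding smooth_fun_iff[OF M]
proof
  fix c assume c: "c \<in> atlas M"
  show "smooth_on (\<lambda>y. A (chart_inv c y)) (snd c ` fst c)"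
    by (rule smooth_on_cong[OF chart_open[OF M c] _ smooth_on_linear_compose[OF chart_open[OF M c]
          bounded_linear_Re smooth_fun_chart[OF M smooth_A c]]])
      (use A M c charted_subset[OF M c] in auto)
qed

lemma \<tau>_Re: "c \<in> atlas M \<Longrightarrow> x \<in> fst c \<Longrightarrow> \<tau> c x v + cnj (\<tau> c x v) = 2 * of_real (A x) * (om1 c x v + cnj (om1 c x v))"
  using \<tau>_re[of c x v] A[of x] charted_subset[OF M, of c] by (auto simp: algebra_simps)

lemma \<tau>_decomp: "c \<in> atlas M \<Longrightarrow> x \<in> fst c \<Longrightarrow>
  \<tau> c x v = of_real (A x) * (om1 c x v + cnj (om1 c x v)) + \<i> * of_real (Im (\<tau> c x v))"
  using \<tau>_Re[of c x v] by (simp add: complex_eq_iff)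

text \<open>The real part A (\<open>om1\<close> + cnj \<open>om1\<close>) of \<tau> is closed. In
  its differential the coefficients of \<open>om1\<close> \<and> \<open>om\<close> and cnj
  \<open>om1\<close> \<and> \<open>om\<close> contain A b0 with opposite signs and the unknown
  derivative a0 of A with the same sign; subtracting them gives A b0 = 0.\<close>

lemma exists_B_chart:
  assumes c: "c \<in> atlas M" and x: "x \<in> fst c"
  shows "\<exists>b. \<forall>v. of_real (Im (\<tau> c x v)) = b * om1 c x v + cnj b * cnj (om1 c x v)"
proof -
  let ?S = "snd c ` fst c" and ?y = "snd c x"
  have S: "open ?S" and y: "?y \<in> ?S" using chart_open[OF M c] x by auto
  have xc: "chart_inv c ?y = x" using M c x by simp
  have fr: "frame (om c x) (om1 c x) (\<lambda>v. cnj (om1 c x v))" and re: "\<And>v. cnj (om c x v) = om c x v"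
    using frame_om[OF c x] by (auto simp: Reals_cnj_iff)
  have "linear (\<lambda>v. complex_of_real (Im (\<tau> c x v)))"
    using linear_compose[OF \<tau>_linear[OF c x] bounded_linear.linear[OF
        bounded_linear_compose[OF bounded_linear_of_real bounded_linear_Im]]] by (simp add: o_def)
  from frame_decomp[OF fr this] obtain b0 b1 b2 where
    b: "\<And>v. of_real (Im (\<tau> c x v)) = b0 * om c x v + b1 * om1 c x v + b2 * cnj (om1 c x v)" by blast
  \<comment> \<open>Both Im \<tau> and \<open>om\<close> are real, so conjugating the expansion must
    reproduce it.\<close>
  have "(b0 - cnj b0) * om c x v + (b1 - cnj b2) * om1 c x v + (b2 - cnj b1) * cnj (om1 c x v) = 0" for v
  proof -
    have "cnj (b0 * om c x v + b1 * om1 c x v + b2 * cnj (om1 c x v))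
        = b0 * om c x v + b1 * om1 c x v + b2 * cnj (om1 c x v)"
      unfolding b[of v, symmetric] by simp
    then show ?thesis by (simp add: re algebra_simps)
  qed
  from frame_indep[OF fr this] have b0: "cnj b0 = b0" and b2: "b2 = cnj b1" by simp_all
  have dA: "(\<lambda>y. complex_of_real (A (chart_inv c y))) differentiable (at ?y)"
    by (rule smooth_on_differentiable[OF smooth_on_of_real[OF S smooth_fun_chart[OF M A_smooth c]] S y])
  obtain a0 a1 a2 where a: "\<And>v. fd (\<lambda>y. complex_of_real (A (chart_inv c y))) ?y v =
      a0 * om c x v + a1 * om1 c x v + a2 * cnj (om1 c x v)"
    using frame_decomp[OF fr linear_fd[OF dA]] by blast
  have d1: "(\<lambda>y. om1 c (chart_inv c y) v) differentiable (at ?y)" for v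
    by (rule smooth_on_differentiable[OF one_form_smooth[OF one_form_om1 c] S y])
  have d2: "(\<lambda>y. cnj (om1 c (chart_inv c y) v)) differentiable (at ?y)" for v
    by (rule smooth_on_differentiable[OF smooth_on_cnj[OF S one_form_smooth[OF one_form_om1 c]] S y])
  have d\<tau>: "(\<lambda>y. \<tau> c (chart_inv c y) v) differentiable (at ?y)" for v
    by (rule smooth_on_differentiable[OF \<tau>_smooth[OF c] S y])
  have d12: "(\<lambda>y. om1 c (chart_inv c y) v + cnj (om1 c (chart_inv c y) v)) differentiable (at ?y)" for v
    by (intro differentiable_add d1 d2)
  have bl: "bounded_linear (\<lambda>w. complex_of_real (Re w))"
    by (rule bounded_linear_compose[OF bounded_linear_of_real bounded_linear_Re])
  have ed1: "ed (\<lambda>y. om1 c (chart_inv c y)) ?y u v = wed (\<tau> c x) (om1 c x) u v" for u v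
    using d_om1[OF c x, of u v] unfolding d1_def .
  have "0 = of_real (A x) * (wed (\<tau> c x) (om1 c x) u v + cnj (wed (\<tau> c x) (om1 c x) u v))
      + wed (fd (\<lambda>y. complex_of_real (A (chart_inv c y))) ?y) (\<lambda>v. om1 c x v + cnj (om1 c x v)) u v" for u v
  proof -
    \<comment> \<open>By \<open>d_\<tau>\<close> the form d\<tau> is a real multiple of
      \<open>om1\<close> \<and> cnj \<open>om1\<close>, whose values are imaginary.\<close>
    have "0 = complex_of_real (Re (d1 \<tau> c x u v))"
      unfolding d_\<tau>[OF c x] by (simp add: complex_eq_iff)
    also have "\<dots> = ed (\<lambda>y v. complex_of_real (Re (\<tau> c (chart_inv c y) v))) ?y u v"
      unfolding d1_def
      by (rule ed_linear_compose[where \<alpha> = "\<lambda>y. \<tau> c (chart_inv c y)", OF bl d\<tau>, symmetric])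
    also have "\<dots> = ed (\<lambda>y v. of_real (A (chart_inv c y)) * (om1 c (chart_inv c y) v + cnj (om1 c (chart_inv c y) v))) ?y u v"
    proof (rule ed_cong[OF S y])
      fix z v assume "z \<in> ?S"
      from \<tau>_Re[OF c chart_inv_in[OF this], of v]
      show "complex_of_real (Re (\<tau> c (chart_inv c z) v)) =
          of_real (A (chart_inv c z)) * (om1 c (chart_inv c z) v + cnj (om1 c (chart_inv c z) v))"
        by (simp add: complex_eq_iff)
    qed
    also have "\<dots> = of_real (A x) * ed (\<lambda>y v. om1 c (chart_inv c y) v + cnj (om1 c (chart_inv c y) v)) ?y u v
       + wed (fd (\<lambda>y. complex_of_real (A (chart_inv c y))) ?y) (\<lambda>v. om1 c x v + cnj (om1 c x v)) u v"
      using ed_scale[where \<alpha> = "\<lambda>y v. om1 c (chart_inv c y) v + cnj (om1 c (chart_inv c y) v)", OF dA d12, where u = u and v = v]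
      unfolding xc .
    also have "ed (\<lambda>y v. om1 c (chart_inv c y) v + cnj (om1 c (chart_inv c y) v)) ?y u v
      = ed (\<lambda>y. om1 c (chart_inv c y)) ?y u v + ed (\<lambda>y v. cnj (om1 c (chart_inv c y) v)) ?y u v"
      by (rule ed_add[OF d1 d2])
    also have "ed (\<lambda>y v. cnj (om1 c (chart_inv c y) v)) ?y u v = cnj (ed (\<lambda>y. om1 c (chart_inv c y)) ?y u v)"
      by (rule ed_linear_compose[where \<alpha> = "\<lambda>y. om1 c (chart_inv c y)", OF bounded_linear_cnj d1])
    finally show ?thesis unfolding ed1 .
  qed
  then have eq0: "0 = of_real (A x) * (wed (\<tau> c x) (om1 c x) u v
        + wed (\<lambda>v. cnj (\<tau> c x v)) (\<lambda>v. cnj (om1 c x v)) u v)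
      + wed (fd (\<lambda>y. complex_of_real (A (chart_inv c y))) ?y) (\<lambda>v. om1 c x v + cnj (om1 c x v)) u v" for u v
    by (simp only: complex_cnj_diff complex_cnj_mult)
  have t: "\<tau> c x v = of_real (A x) * (om1 c x v + cnj (om1 c x v)) + \<i> * (b0 * om c x v + b1 * om1 c x v + cnj b1 * cnj (om1 c x v))" for v
    using \<tau>_decomp[OF c x, of v] unfolding b b2 .
  have t': "cnj (\<tau> c x v) = of_real (A x) * (om1 c x v + cnj (om1 c x v)) - \<i> * (b0 * om c x v + b1 * om1 c x v + cnj b1 * cnj (om1 c x v))" for v
    using arg_cong[OF t[of v], of cnj] by (simp add: b0 re algebra_simps)
  have "(of_real (A x) * (- (of_real (A x) + \<i> * cnj b1) + (of_real (A x) - \<i> * b1)) + a1 - a2) * wed (om1 c x) (\<lambda>v. cnj (om1 c x v)) u v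
     + (- \<i> * of_real (A x) * b0 - a0) * wed (om1 c x) (om c x) u v
     + (\<i> * of_real (A x) * b0 - a0) * wed (\<lambda>v. cnj (om1 c x v)) (om c x) u v = 0" for u v
    using eq0[of u v] unfolding a t' unfolding t by algebra
  from frame_indep2(2,3)[OF fr this] have "2 * \<i> * (of_real (A x) * b0) = 0" by algebra
  then have "b0 = 0" using A_pos[of x] charted_subset[OF M c] x by force
  with b b2 show ?thesis by auto
qed

text \<open>The coefficient found in one chart serves in every other, as \<tau> and
  \<open>om1\<close> transform by the same Jacobian; hence B is a function on M.\<close>

lemma exists_B:
  "\<exists>B. \<forall>c\<in>atlas M. \<forall>x\<in>fst c. \<forall>v. of_real (Im (\<tau> c x v)) = B x * om1 c x v + cnj (B x) * cnj (om1 c x v)"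
proof -
  have "\<exists>b. \<forall>c\<in>atlas M. x \<in> fst c \<longrightarrow> (\<forall>v. of_real (Im (\<tau> c x v)) = b * om1 c x v + cnj b * cnj (om1 c x v))" for x
  proof (cases "x \<in> points M")
    case True
    then obtain c where c: "c \<in> atlas M" "x \<in> fst c" using charted_cover[OF M] by blast
    from exists_B_chart[OF this] obtain b
      where b: "\<And>v. of_real (Im (\<tau> c x v)) = b * om1 c x v + cnj b * cnj (om1 c x v)" by blast
    show ?thesis
    proof (intro exI ballI impI allI)
      fix c' v assume c': "c' \<in> atlas M" "x \<in> fst c'"
      show "of_real (Im (\<tau> c' x v)) = b * om1 c' x v + cnj b * cnj (om1 c' x v)"
        unfolding \<tau>_change[OF c'(1) c(1) c'(2) c(2)] one_form_change[OF one_form_om1 c'(1) c(1) c'(2) c(2)]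
        by (rule b)
    qed
  next
    case False
    then show ?thesis using charted_subset[OF M] by blast
  qed
  then show ?thesis by metis
qed

lemma adapted_section:
  assumes B: "\<And>c x v. c \<in> atlas M \<Longrightarrow> x \<in> fst c \<Longrightarrow>
    of_real (Im (\<tau> c x v)) = B x * om1 c x v + cnj (B x) * cnj (om1 c x v)"
  shows "adapted M om om1 A B (\<lambda>x. sgn (k1 x))"
  unfolding adapted_def
proof (intro conjI ballI one_form_om one_form_om1 A_smooth)
  have bl: "bounded_linear (\<lambda>w. complex_of_real (Im w))"
    by (rule bounded_linear_compose[OF bounded_linear_of_real bounded_linear_Im])
  show "smooth_fun M B"
  proof (rule smooth_coeff[OF M one_form_om one_form_om1 frame_om])
    show "smooth_on (\<lambda>y. complex_of_real (Im (\<tau> c (chart_inv c y) v))) (snd c ` fst c)" if "c \<in> atlas M" for c v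
      by (rule smooth_on_linear_compose[OF chart_open[OF M that] bl \<tau>_smooth[OF that]])
    show "complex_of_real (Im (\<tau> c x v)) = 0 * om c x v + B x * om1 c x v + cnj (B x) * cnj (om1 c x v)"
      if "c \<in> atlas M" "x \<in> fst c" for c x v
      using B[OF that] by simp
  qed
  fix c assume c: "c \<in> atlas M"
  show "frame (om c x) (om1 c x) (\<lambda>v. cnj (om1 c x v))" "\<forall>v. om c x v \<in> \<real>" if "x \<in> fst c" for x
    using frame_om[OF c that] by blast+
  fix y assume y: "y \<in> snd c ` fst c"
  define x where "x = chart_inv c y"
  have x: "x \<in> fst c" "snd c x = y" unfolding x_def using chart_inv_in[OF y] chart_chart_inv[OF y] .
  have xM: "x \<in> points M" using charted_subset[OF M c] x by blast
  have S: "open (snd c ` fst c)" by (rule chart_open[OF M c])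
  show "structure_eqs (\<lambda>y. om c (chart_inv c y)) (\<lambda>y. om1 c (chart_inv c y)) (\<lambda>y. A (chart_inv c y))
        (\<lambda>y. B (chart_inv c y)) (\<lambda>y. sgn (k1 (chart_inv c y))) y"
    unfolding structure_eqs_def x_def[symmetric]
  proof (intro conjI allI)
    show "A x > 0" using A_pos[OF xM] .
    show "sgn (k1 x) = 1 \<or> sgn (k1 x) = - 1" using k1_nz[OF xM] by (auto simp: sgn_if)
    fix u v
    show "ed (\<lambda>y. om c (chart_inv c y)) y u v = \<i> * wed (om1 c x) (\<lambda>v. cnj (om1 c x v)) u v
        + 2 * of_real (A x) * (wed (om1 c x) (om c x) u v + wed (\<lambda>v. cnj (om1 c x v)) (om c x) u v)"
      using d_om[OF c x(1), of u v] unfolding \<tau>_Re[OF c x(1)] d1_def x(2) by (simp add: algebra_simps)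
    have t: "\<tau> c x v = of_real (A x) * (om1 c x v + cnj (om1 c x v)) + \<i> * (B x * om1 c x v + cnj (B x) * cnj (om1 c x v))" for v
      using \<tau>_decomp[OF c x(1), of v] unfolding B[OF c x(1)] .
    \<comment> \<open>Wedging \<tau> with \<open>om1\<close> keeps only the terms along
      \<open>om\<close> and cnj \<open>om1\<close>, and the former is absent; the component A + i
      cnj B remains, with a minus sign from the order of the factors.\<close>
    show "ed (\<lambda>y. om1 c (chart_inv c y)) y u v
        = - (of_real (A x) + \<i> * cnj (B x)) * wed (om1 c x) (\<lambda>v. cnj (om1 c x v)) u v"
      using d_om1[OF c x(1), of u v] unfolding d1_def x(2) t by algebra
    have "ed (\<lambda>y v. B (chart_inv c y) * om1 c (chart_inv c y) v + cnj (B (chart_inv c y)) * cnj (om1 c (chart_inv c y) v)) y u v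
       = ed (\<lambda>y v. complex_of_real (Im (\<tau> c (chart_inv c y) v))) y u v"
      by (rule ed_cong[OF S y]) (rule B[OF c chart_inv_in, symmetric])
    also have "\<dots> = of_real (Im (ed (\<lambda>y. \<tau> c (chart_inv c y)) y u v))"
      by (rule ed_linear_compose[where \<alpha> = "\<lambda>y. \<tau> c (chart_inv c y)", OF bl smooth_on_differentiable[OF \<tau>_smooth[OF c] S y]])
    also have "ed (\<lambda>y. \<tau> c (chart_inv c y)) y u v = of_real (sgn (k1 x)) * wed (om1 c x) (\<lambda>v. cnj (om1 c x v)) u v"
      using d_\<tau>[OF c x(1), of u v] unfolding d1_def x(2) .
    \<comment> \<open>An imaginary w has Im w = - i w; this is the origin of the factor - \<epsilon>
      i.\<close>
    also have "of_real (Im (of_real (sgn (k1 x)) * wed (om1 c x) (\<lambda>v. cnj (om1 c x v)) u v))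
      = - of_real (sgn (k1 x)) * \<i> * wed (om1 c x) (\<lambda>v. cnj (om1 c x v)) u v"
      by (simp add: complex_eq_iff)
    finally show "ed (\<lambda>y v. B (chart_inv c y) * om1 c (chart_inv c y) v + cnj (B (chart_inv c y)) * cnj (om1 c (chart_inv c y) v)) y u v
       = - of_real (sgn (k1 x)) * \<i> * wed (om1 c x) (\<lambda>v. cnj (om1 c x v)) u v" .
  qed
qed

end

end

text \<open>The locale is instantiated twice: the trial section supplies the smooth function
  \<alpha> that defines the rotation, and at the rotated section the value of \<open>\<A>\<close>,
  which has no formula, is computed by comparing the two expressions for d\<open>om\<close>.\<close>

lemma exists_positive_section:
  assumes M: "charted M" and oc: "oc_pair M lam \<mu>" and nd: "nondegenerate_data M lam \<mu> a \<Omega> k1 \<A>"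
  obtains z A where "section_N0 M lam \<mu> a \<Omega> k1 \<A> z"
    "\<And>x. x \<in> points M \<Longrightarrow> \<A> (x, z x) = complex_of_real (A x)" "\<And>x. x \<in> points M \<Longrightarrow> A x > 0"
proof -
  have k1: "smooth_fun M k1" using nd by (auto simp: nondegenerate_data_def cartan_coframe_def Let_def)
  have k1_nz: "k1 x \<noteq> 0" if "x \<in> points M" for x
  proof -
    have "K1_P k1 (x, 1) \<noteq> 0" using nd that by (auto simp: nondegenerate_data_def)
    then show ?thesis by (simp add: K1_P_def)
  qed
  have p: "chart_inv c y \<in> points M" if "c \<in> atlas M" "y \<in> snd c ` fst c" for c y
    using chart_inv_in[OF that(2)] charted_subset[OF M that(1)] by blast
  define z0 where "z0 x = complex_of_real (sqrt \<bar>k1 x\<bar>)" for x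
  have z0: "smooth_fun M z0"
    unfolding smooth_fun_iff[OF M] z0_def
    using k1_nz p by (intro ballI smooth_on_of_real smooth_on_sqrt smooth_on_abs chart_open[OF M] smooth_fun_chart[OF M k1]) auto
  have z0_nz: "z0 x \<noteq> 0" if "x \<in> points M" for x using k1_nz[OF that] by (simp add: z0_def)
  have cz0: "(cmod (z0 x))\<^sup>2 = \<bar>k1 x\<bar>" for x by (simp add: z0_def)
  interpret s0: section_N0 M lam \<mu> a \<Omega> k1 \<A> z0
    by unfold_locales (use M oc nd z0 z0_nz cz0 in \<open>auto simp: N0_def\<close>)
  define \<alpha> where "\<alpha> x = \<A> (x, z0 x)" for x
  have \<alpha>: "smooth_fun M \<alpha>" using s0.smooth_A by (simp add: \<alpha>_def[abs_def])
  have \<alpha>_nz: "\<alpha> x \<noteq> 0" if "x \<in> points M" for x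
    using nd s0.zN0[OF that] by (auto simp: nondegenerate_data_def \<alpha>_def)
  \<comment> \<open>This phase is dictated by A1 z = \<alpha> z0, which holds for every section of
    the same modulus: dividing by this z leaves A1 = |\<alpha>|.\<close>
  define z where "z x = z0 x * \<alpha> x / of_real (cmod (\<alpha> x))" for x
  have z: "smooth_fun M z"
    unfolding smooth_fun_iff[OF M] z_def
    using \<alpha>_nz p by (intro ballI smooth_on_divide smooth_on_mult smooth_on_of_real smooth_on_cmod chart_open[OF M]
        smooth_fun_chart[OF M z0] smooth_fun_chart[OF M \<alpha>]) auto
  have z_nz: "z x \<noteq> 0" if "x \<in> points M" for x using z0_nz[OF that] \<alpha>_nz[OF that] by (simp add: z_def)
  have cz: "cmod (z x) = cmod (z0 x)" if "x \<in> points M" for x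
    using \<alpha>_nz[OF that] by (simp add: z_def norm_mult norm_divide)
  interpret s: section_N0 M lam \<mu> a \<Omega> k1 \<A> z
    by unfold_locales (use M oc nd z z_nz cz cz0 in \<open>auto simp: N0_def\<close>)
  have "\<A> (x, z x) = complex_of_real (cmod (\<alpha> x))" if x: "x \<in> points M" for x
  proof -
    obtain c where c: "c \<in> atlas M" "x \<in> fst c" using charted_cover[OF M x] by blast
    define k where "k = \<A> (x, z x) * z x - \<alpha> x * z0 x"
    have om: "s.om c x = s0.om c x" if "x \<in> fst c" for x
      using cz charted_subset[OF M c(1)] that by (auto simp: s.om_def s0.om_def fun_eq_iff)
    have zz: "z x * cnj (z x) = z0 x * cnj (z0 x)"
      using cz[OF x] by (metis complex_norm_square)
    have fr: "frame (s0.om c x) (\<mu> c x) (\<lambda>v. cnj (\<mu> c x v))"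
    proof -
      have "(cmod (z0 x))\<^sup>2 / a x \<noteq> 0" using z0_nz[OF x] s0.a_nz[OF x] by simp
      from cframe_scale[OF oc_pair_cframe[OF oc c] this, of 1] show ?thesis
        by (simp add: s0.om_def[abs_def])
    qed
    \<comment> \<open>The difference of the two expressions for d\<open>om\<close>, written in \<mu>
      and cnj \<mu>, which do not depend on the section.\<close>
    have "0 * wed (\<mu> c x) (\<lambda>v. cnj (\<mu> c x v)) u v + (2 * k) * wed (\<mu> c x) (s0.om c x) u v
      + (2 * cnj k) * wed (\<lambda>v. cnj (\<mu> c x v)) (s0.om c x) u v = 0" for u v
    proof -
      have "d1 s.om c x u v = d1 s0.om c x u v"
        by (rule d1_cong[OF M c(1) chart_open[OF M c(1)] order_refl c(2)]) (use c om in auto)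
      then have "\<i> * (z x * cnj (z x) * wed (\<mu> c x) (\<lambda>v. cnj (\<mu> c x v)) u v)
          + wed (\<lambda>v. 2 * (\<A> (x, z x) * z x * \<mu> c x v + cnj (\<A> (x, z x) * z x) * cnj (\<mu> c x v))) (s0.om c x) u v
        = \<i> * (z0 x * cnj (z0 x) * wed (\<mu> c x) (\<lambda>v. cnj (\<mu> c x v)) u v)
          + wed (\<lambda>v. 2 * (\<alpha> x * z0 x * \<mu> c x v + cnj (\<alpha> x * z0 x) * cnj (\<mu> c x v))) (s0.om c x) u v"
        unfolding s.d_om[OF c] s0.d_om[OF c] s.\<tau>_re[OF c] s0.\<tau>_re[OF c] om[OF c(2)] s.om1_def s0.om1_def \<alpha>_def[symmetric]
        by (simp add: algebra_simps)
      then show ?thesis unfolding zz k_def complex_cnj_diff by algebra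
    qed
    from frame_indep2(2)[OF fr this] have "\<A> (x, z x) * z x = \<alpha> x * z0 x" by (simp add: k_def)
    then show ?thesis using z0_nz[OF x] \<alpha>_nz[OF x] by (simp add: z_def field_simps)
  qed
  moreover have "cmod (\<alpha> x) > 0" if "x \<in> points M" for x using \<alpha>_nz[OF that] by simp
  ultimately show ?thesis by (rule that[OF s.section_N0_axioms])
qed

section \<open>Structures of an oriented congruence\<close>

lemma proportional_on_trans:
  assumes W: "chart_opens M W"
    and 1: "proportional_on M W lam \<mu> lam' \<mu>'" and 2: "proportional_on M W lam' \<mu>' lam'' \<mu>''"
  shows "proportional_on M W lam \<mu> lam'' \<mu>''"
proof -
  from 1 obtain f h where fh: "smooth_fun_on M W f" "smooth_fun_on M W h" "\<forall>x\<in>W. f x \<noteq> 0 \<and> h x \<noteq> 0"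
    "form_eq M W lam' (\<lambda>c x v. of_real (f x) * lam c x v)" "form_eq M W \<mu>' (\<lambda>c x v. h x * \<mu> c x v)"
    unfolding proportional_on_def by blast
  from 2 obtain f' h' where fh': "smooth_fun_on M W f'" "smooth_fun_on M W h'" "\<forall>x\<in>W. f' x \<noteq> 0 \<and> h' x \<noteq> 0"
    "form_eq M W lam'' (\<lambda>c x v. of_real (f' x) * lam' c x v)" "form_eq M W \<mu>'' (\<lambda>c x v. h' x * \<mu>' c x v)"
    unfolding proportional_on_def by blast
  show ?thesis
    unfolding proportional_on_def
  proof (intro exI conjI)
    show "smooth_fun_on M W (\<lambda>x. f' x * f x)" "smooth_fun_on M W (\<lambda>x. h' x * h x)"
      using fh(1,2) fh'(1,2) W smooth_on_mult unfolding smooth_fun_on_def chart_opens_def o_def by blast+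
    show "\<forall>x\<in>W. f' x * f x \<noteq> 0 \<and> h' x * h x \<noteq> 0" using fh(3) fh'(3) by simp
    show "form_eq M W lam'' (\<lambda>c x v. of_real (f' x * f x) * lam c x v)"
      "form_eq M W \<mu>'' (\<lambda>c x v. h' x * h x * \<mu> c x v)"
      using fh(4,5) fh'(4,5) by (auto simp: form_eq_def fun_eq_iff)
  qed
qed

lemma proportional_on_sym:
  assumes M: "charted M" and W: "chart_opens M W" and 1: "proportional_on M W lam \<mu> lam' \<mu>'"
  shows "proportional_on M W lam' \<mu>' lam \<mu>"
proof -
  from 1 obtain f h where fh: "smooth_fun_on M W f" "smooth_fun_on M W h" "\<forall>x\<in>W. f x \<noteq> 0 \<and> h x \<noteq> 0"
    "form_eq M W lam' (\<lambda>c x v. of_real (f x) * lam c x v)" "form_eq M W \<mu>' (\<lambda>c x v. h x * \<mu> c x v)"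
    unfolding proportional_on_def by blast
  have inv: "smooth_fun_on M W (\<lambda>x. 1 / g x)" if "smooth_fun_on M W g" "\<And>x. x \<in> W \<Longrightarrow> g x \<noteq> 0"
    for g :: "'a \<Rightarrow> 'k::real_normed_field"
    unfolding smooth_fun_on_def o_def
  proof
    fix c assume c: "c \<in> atlas M"
    have "chart_inv c y \<in> W" if "y \<in> snd c ` (fst c \<inter> W)" for y
    proof -
      obtain x where x: "x \<in> fst c" "x \<in> W" "y = snd c x" using \<open>y \<in> _\<close> by blast
      then show ?thesis using chart_inv_chart[OF M c] by simp
    qed
    then show "smooth_on (\<lambda>y. 1 / g (chart_inv c y)) (snd c ` (fst c \<inter> W))"
      using that c W unfolding smooth_fun_on_def chart_opens_def o_def
      by (intro smooth_on_divide smooth_on_const) auto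
  qed
  show ?thesis
    unfolding proportional_on_def
  proof (intro exI conjI)
    show "smooth_fun_on M W (\<lambda>x. 1 / f x)" "smooth_fun_on M W (\<lambda>x. 1 / h x)"
      using fh(1-3) inv by auto
    show "\<forall>x\<in>W. 1 / f x \<noteq> 0 \<and> 1 / h x \<noteq> 0" using fh(3) by simp
    show "form_eq M W lam (\<lambda>c x v. of_real (1 / f x) * lam' c x v)"
      "form_eq M W \<mu> (\<lambda>c x v. 1 / h x * \<mu>' c x v)"
      using fh(3-5) by (auto simp: form_eq_def fun_eq_iff)
  qed
qed

lemma oriented_congruence_oc_pair:
  assumes "oriented_congruence M S" "(lam, \<mu>) \<in> S"
  shows "oc_pair M lam \<mu>"
  using assms by (auto simp: oriented_congruence_def quotient_def oc_rel_def)

text \<open>Both pairs are images of the pair generating the class; one relation is inverted and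
  composed with the other.\<close>

lemma oriented_congruence_proportional:
  assumes S: "oriented_congruence M S" and m: "(lam, \<mu>) \<in> S" "(lam', \<mu>') \<in> S"
  shows "proportional_on M (points M) lam \<mu> lam' \<mu>'"
proof -
  have M: "charted M" using S smooth_manifold_charted by (auto simp: oriented_congruence_def)
  obtain lam0 \<mu>0 where "proportional_on M (points M) lam0 \<mu>0 lam \<mu>" "proportional_on M (points M) lam0 \<mu>0 lam' \<mu>'"
    using assms by (auto simp: oriented_congruence_def quotient_def oc_rel_def)
  then show ?thesis
    using proportional_on_trans[OF chart_opens_points[OF M]] proportional_on_sym[OF M chart_opens_points[OF M]] by blast
qed

lemma oriented_congruence_mem:
  assumes S: "oriented_congruence M S" and m: "(lam, \<mu>) \<in> S"
    and "oc_pair M lam' \<mu>'" "proportional_on M (points M) lam \<mu> lam' \<mu>'"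
  shows "(lam', \<mu>') \<in> S"
proof -
  have M: "charted M" using S smooth_manifold_charted by (auto simp: oriented_congruence_def)
  obtain lam0 \<mu>0 where 0: "oc_pair M lam0 \<mu>0" "S = oc_rel M `` {(lam0, \<mu>0)}"
    using S by (auto simp: oriented_congruence_def quotient_def)
  then have "proportional_on M (points M) lam0 \<mu>0 lam' \<mu>'"
    using m assms(4) proportional_on_trans[OF chart_opens_points[OF M]] by (auto simp: oc_rel_def)
  then show ?thesis using 0 assms(3) by (auto simp: oc_rel_def)
qed

section \<open>From the bundle data to adapted coframes representing the structure\<close>

context section_N0
begin

lemma pullback_\<Sigma>:
  "pullback P \<sigma> (\<lambda>c y v. (\<Omega> c y v - cnj (\<Omega> c y v)) / (2 * \<i>)) c x v = of_real (Im (\<tau> c x v))"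
proof -
  have "(w - cnj w) / (2 * \<i>) = complex_of_real (Im w)" for w
    by (simp add: complex_eq_iff Re_divide Im_divide)
  then show ?thesis by (simp add: pullback_def \<tau>_def Let_def)
qed

lemma form_eq_om:
  "form_eq M (points M) (pullback P \<sigma> (omega_P M a lam)) om"
  "form_eq M (points M) (pullback P \<sigma> (omega1_P M \<mu>)) om1"
  using pullback_om pullback_om1 by (simp_all add: form_eq_def)

lemma proportional_om: "proportional_on M (points M) lam \<mu> om om1"
  unfolding proportional_on_def
proof (intro exI conjI)
  show "smooth_fun M (\<lambda>x. (cmod (z x))\<^sup>2 / a x)" by (rule om_smooth)
  show "smooth_fun M z" by (rule z)
  show "\<forall>x\<in>points M. (cmod (z x))\<^sup>2 / a x \<noteq> 0 \<and> z x \<noteq> 0" using z_nz a_nz by simp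
qed (simp_all add: form_eq_def om_def[abs_def] om1_def[abs_def])

lemma sgn_K1: "x \<in> points M \<Longrightarrow> sgn (K1_P k1 (x, z x)) = sgn (k1 x)"
  using k1_nz[of x] cmod_z[of x] by (simp add: K1_P_def sgn_if)

end

lemma form_eq_trans: "form_eq M W \<alpha> \<beta> \<Longrightarrow> form_eq M W \<beta> \<gamma> \<Longrightarrow> form_eq M W \<alpha> \<gamma>"
  by (simp add: form_eq_def)

lemma form_eq_sym: "form_eq M W \<alpha> \<beta> \<Longrightarrow> form_eq M W \<beta> \<alpha>"
  by (simp add: form_eq_def)

lemma proportional_on_form_eq:
  "proportional_on M W lam \<mu> \<omega> \<omega>\<^sub>1 \<Longrightarrow> form_eq M W \<omega>' \<omega> \<Longrightarrow> form_eq M W \<omega>\<^sub>1' \<omega>\<^sub>1 \<Longrightarrow>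
   proportional_on M W lam \<mu> \<omega>' \<omega>\<^sub>1'"
  unfolding proportional_on_def using form_eq_trans by blast

text \<open>Besides satisfying the structure equations, the coframe is itself a representative of
  \<open>S\<close>. This membership lets statements about representatives be applied to
  coframes.\<close>

lemma invariant_coframe_adapted:
  assumes S: "oriented_congruence M S" and inv: "invariant_coframe M S \<omega> \<omega>\<^sub>1 A B \<epsilon>"
  shows "adapted M \<omega> \<omega>\<^sub>1 A B \<epsilon>" "(\<omega>, \<omega>\<^sub>1) \<in> S"
    "(lam', \<mu>') \<in> S \<Longrightarrow> proportional_on M (points M) lam' \<mu>' \<omega> \<omega>\<^sub>1"
proof -
  have M: "charted M" using S smooth_manifold_charted by (auto simp: oriented_congruence_def)
  from inv obtain lam \<mu> a \<Omega> k1 \<A> z where m: "(lam, \<mu>) \<in> S" and nd: "nondegenerate_data M lam \<mu> a \<Omega> k1 \<A>"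
    and z: "smooth_fun M z" "\<And>x. x \<in> points M \<Longrightarrow> (x, z x) \<in> N0 M k1"
    and A: "\<And>x. x \<in> points M \<Longrightarrow> \<A> (x, z x) = of_real (A x)" "\<And>x. x \<in> points M \<Longrightarrow> A x > 0"
    and \<epsilon>: "\<And>x. x \<in> points M \<Longrightarrow> \<epsilon> x = sgn (K1_P k1 (x, z x))"
    and eq: "form_eq M (points M) \<omega> (pullback (bundle_P M) (\<lambda>x. (x, z x)) (omega_P M a lam))"
      "form_eq M (points M) \<omega>\<^sub>1 (pullback (bundle_P M) (\<lambda>x. (x, z x)) (omega1_P M \<mu>))"
    and B: "form_eq M (points M) (pullback (bundle_P M) (\<lambda>x. (x, z x)) (\<lambda>c y v. (\<Omega> c y v - cnj (\<Omega> c y v)) / (2 * \<i>)))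
           (\<lambda>c x v. B x * \<omega>\<^sub>1 c x v + cnj (B x) * cnj (\<omega>\<^sub>1 c x v))"
    unfolding invariant_coframe_def Let_def by blast
  interpret section_N0 M lam \<mu> a \<Omega> k1 \<A> z
    by unfold_locales (use M oriented_congruence_oc_pair[OF S m] nd z in auto)
  have eq: "form_eq M (points M) \<omega> om" "form_eq M (points M) \<omega>\<^sub>1 om1"
    using eq form_eq_om form_eq_trans by blast+
  have "of_real (Im (\<tau> c x v)) = B x * om1 c x v + cnj (B x) * cnj (om1 c x v)" if c: "c \<in> atlas M" "x \<in> fst c" for c x v
  proof -
    have "pullback P \<sigma> (\<lambda>c y v. (\<Omega> c y v - cnj (\<Omega> c y v)) / (2 * \<i>)) c x = (\<lambda>v. B x * \<omega>\<^sub>1 c x v + cnj (B x) * cnj (\<omega>\<^sub>1 c x v))"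
      using B c unfolding form_eq_points[OF M] by blast
    moreover have "\<omega>\<^sub>1 c x = om1 c x" using eq(2) c unfolding form_eq_points[OF M] by blast
    ultimately show ?thesis by (metis (no_types, lifting) pullback_\<Sigma>)
  qed
  from adapted_section[OF A this] have "adapted M om om1 A B (\<lambda>x. sgn (k1 x))" .
  then show ad: "adapted M \<omega> \<omega>\<^sub>1 A B \<epsilon>"
    by (rule adapted_cong[OF M _ eq]) (simp add: \<epsilon> sgn_K1)
  have p: "proportional_on M (points M) lam \<mu> \<omega> \<omega>\<^sub>1"
    by (rule proportional_on_form_eq[OF proportional_om eq])
  show "proportional_on M (points M) lam' \<mu>' \<omega> \<omega>\<^sub>1" if "(lam', \<mu>') \<in> S"
    using proportional_on_trans[OF chart_opens_points[OF M] oriented_congruence_proportional[OF S that m] p] .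
  have "oc_pair M \<omega> \<omega>\<^sub>1" using ad by (intro oc_pairI) (auto simp: adapted_def)
  from oriented_congruence_mem[OF S m this p] show "(\<omega>, \<omega>\<^sub>1) \<in> S" .
qed

lemma exists_invariant_coframe:
  assumes nd: "nondegenerate_structure M S"
  shows "\<exists>\<omega> \<omega>\<^sub>1 A B \<epsilon>. invariant_coframe M S \<omega> \<omega>\<^sub>1 A B \<epsilon>"
proof -
  have S: "oriented_congruence M S" using nd by (simp add: nondegenerate_structure_def)
  then have M: "charted M" using smooth_manifold_charted by (auto simp: oriented_congruence_def)
  from nd obtain lam \<mu> a \<Omega> k1 \<A> where m: "(lam, \<mu>) \<in> S" and nd: "nondegenerate_data M lam \<mu> a \<Omega> k1 \<A>"
    unfolding nondegenerate_structure_def by blast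
  from exists_positive_section[OF M oriented_congruence_oc_pair[OF S m] nd]
  obtain z A where sec: "section_N0 M lam \<mu> a \<Omega> k1 \<A> z"
    and A: "\<And>x. x \<in> points M \<Longrightarrow> \<A> (x, z x) = complex_of_real (A x)" "\<And>x. x \<in> points M \<Longrightarrow> A x > 0" by blast
  interpret section_N0 M lam \<mu> a \<Omega> k1 \<A> z by (rule sec)
  obtain B where B: "\<And>c x v. c \<in> atlas M \<Longrightarrow> x \<in> fst c \<Longrightarrow>
      of_real (Im (\<tau> c x v)) = B x * om1 c x v + cnj (B x) * cnj (om1 c x v)"
    using exists_B[OF A] by blast
  have "form_eq M (points M) (pullback P \<sigma> (\<lambda>c y v. (\<Omega> c y v - cnj (\<Omega> c y v)) / (2 * \<i>)))
           (\<lambda>c x v. B x * om1 c x v + cnj (B x) * cnj (om1 c x v))"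
    unfolding form_eq_points[OF M] by (intro ballI ext) (simp only: pullback_\<Sigma> B)
  then have "invariant_coframe M S om om1 A B (\<lambda>x. sgn (K1_P k1 (x, z x)))"
    unfolding invariant_coframe_def Let_def
    using m nd z zN0 A form_eq_om[THEN form_eq_sym] by blast
  then show ?thesis by blast
qed

section \<open>Rigidity for coframes compared by a map or on one manifold\<close>

lemma pullback_form_eq:
  assumes M: "charted M" "charted M'" and rep: "chart_rep M c U M' d \<phi>" and y: "y \<in> U"
    and eq: "form_eq M' (points M') \<alpha> \<beta>"
  shows "pullback M' \<phi> \<alpha> c (chart_inv c y) v = pullback M' \<phi> \<beta> c (chart_inv c y) v"
proof -
  have "chart_inv c y \<in> fst c" "snd c (chart_inv c y) \<in> U"
    using chart_rep_at[OF M rep y] y by simp_all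
  from some_chart[OF M rep this] eq show ?thesis
    unfolding form_eq_points[OF M(2)] pullback_def Let_def by simp
qed

text \<open>Naturality of d reduces each equation to the one at the image point, evaluated on the
  pushed-forward vectors.\<close>

lemma pullback_structure_eqs:
  assumes M: "charted M" "charted M'" and ad: "adapted M' \<omega> \<omega>\<^sub>1 A B \<epsilon>"
    and rep: "chart_rep M c U M' d \<phi>" and y: "y \<in> U"
  shows "structure_eqs (\<lambda>y. pullback M' \<phi> \<omega> c (chart_inv c y)) (\<lambda>y. pullback M' \<phi> \<omega>\<^sub>1 c (chart_inv c y))
    (\<lambda>y. A (\<phi> (chart_inv c y))) (\<lambda>y. B (\<phi> (chart_inv c y))) (\<lambda>y. \<epsilon> (\<phi> (chart_inv c y))) y"
proof -
  define x where "x = chart_inv c y"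
  have x: "x \<in> fst c" "snd c x = y" "snd c x \<in> U" using chart_rep_at[OF M rep y] y by (simp_all add: x_def)
  have d: "d \<in> atlas M'" and px: "\<phi> x \<in> fst d" using chart_rep_point[OF M rep x(1,3)] by auto
  define L where "L = fd (snd d \<circ> \<phi> \<circ> chart_inv c) y"
  \<comment> \<open>The third equation differentiates this combination, so it is made a 1-form of
    its own to which naturality applies.\<close>
  define \<theta> where "\<theta> = (\<lambda>c x v. B x * \<omega>\<^sub>1 c x v + cnj (B x) * cnj (\<omega>\<^sub>1 c x v))"
  have o: "one_form M' \<omega>" "one_form M' \<omega>\<^sub>1" "smooth_fun M' B" using ad by (auto simp: adapted_def)
  have "smooth_fun M' (\<lambda>x. cnj (B x))"
    unfolding smooth_fun_iff[OF M(2)] by (intro ballI smooth_on_cnj chart_open[OF M(2)] smooth_fun_chart[OF M(2) o(3)])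
  then have \<theta>: "one_form M' \<theta>"
    using one_form_add[OF M(2) one_form_mult[OF M(2) o(2,3)] one_form_mult[OF M(2) one_form_cnj[OF M(2) o(2)]]]
    unfolding \<theta>_def cnj_form_def by blast
  have e: "ed (\<lambda>y. pullback M' \<phi> \<alpha> c (chart_inv c y)) y u v = ed (\<lambda>z. \<alpha> d (chart_inv d z)) (snd d (\<phi> x)) (L u) (L v)"
    if "one_form M' \<alpha>" for \<alpha> u v
    using d1_pullback[OF M rep that x(1,3), of u v] unfolding d1_def x(2) L_def .
  have p: "pullback M' \<phi> \<alpha> c x v = \<alpha> d (\<phi> x) (L v)" if "one_form M' \<alpha>" for \<alpha> v
    using pullback_eq[OF M rep that x(1,3), of v] unfolding x(2) L_def .
  have \<theta>': "B (\<phi> (chart_inv c y)) * pullback M' \<phi> \<omega>\<^sub>1 c (chart_inv c y) v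
      + cnj (B (\<phi> (chart_inv c y))) * cnj (pullback M' \<phi> \<omega>\<^sub>1 c (chart_inv c y) v)
      = pullback M' \<phi> \<theta> c (chart_inv c y) v" for y v
    by (simp add: pullback_def Let_def \<theta>_def)
  have "structure_eqs (\<lambda>z. \<omega> d (chart_inv d z)) (\<lambda>z. \<omega>\<^sub>1 d (chart_inv d z)) (\<lambda>z. A (chart_inv d z))
      (\<lambda>z. B (chart_inv d z)) (\<lambda>z. \<epsilon> (chart_inv d z)) (snd d (\<phi> x))"
    using ad d px unfolding adapted_def by blast
  then show ?thesis
    unfolding structure_eqs_def \<theta>' e[OF o(1)] e[OF o(2)] e[OF \<theta>] x_def[symmetric] p[OF o(1)] p[OF o(2)]
    unfolding chart_inv_chart[OF M(2) d px] \<theta>_def by blast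
qed

lemma coframes_agree:
  assumes M: "charted M" "charted M'" and ad: "adapted M \<omega> \<omega>\<^sub>1 A B \<epsilon>" and ad': "adapted M' \<omega>' \<omega>\<^sub>1' A' B' \<epsilon>'"
    and rep: "chart_rep M c U M' d \<phi>" and y: "y \<in> U"
    and fh: "smooth_on f U" "smooth_on h U" "\<And>y. y \<in> U \<Longrightarrow> f y \<noteq> 0" "\<And>y. y \<in> U \<Longrightarrow> h y \<noteq> 0"
    and eq: "\<And>y v. y \<in> U \<Longrightarrow> pullback M' \<phi> \<omega>' c (chart_inv c y) v = of_real (f y) * \<omega> c (chart_inv c y) v"
      "\<And>y v. y \<in> U \<Longrightarrow> pullback M' \<phi> \<omega>\<^sub>1' c (chart_inv c y) v = h y * \<omega>\<^sub>1 c (chart_inv c y) v"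
  shows "f y = 1" "h y = 1" "A' (\<phi> (chart_inv c y)) = A (chart_inv c y)" "B' (\<phi> (chart_inv c y)) = B (chart_inv c y)"
proof -
  have c: "c \<in> atlas M" and U: "open U" "U \<subseteq> snd c ` fst c" using rep by (auto simp: chart_rep_def)
  have o: "one_form M \<omega>" "one_form M \<omega>\<^sub>1" "smooth_fun M B" using ad by (auto simp: adapted_def)
  interpret two_coframes U "\<lambda>y. \<omega> c (chart_inv c y)" "\<lambda>y. \<omega>\<^sub>1 c (chart_inv c y)"
    "\<lambda>y. pullback M' \<phi> \<omega>' c (chart_inv c y)" "\<lambda>y. pullback M' \<phi> \<omega>\<^sub>1' c (chart_inv c y)"
    "\<lambda>y. A (chart_inv c y)" "\<lambda>y. A' (\<phi> (chart_inv c y))" "\<lambda>y. B (chart_inv c y)" "\<lambda>y. B' (\<phi> (chart_inv c y))"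
    "\<lambda>y. \<epsilon> (chart_inv c y)" "\<lambda>y. \<epsilon>' (\<phi> (chart_inv c y))" f h
  proof
    show "smooth_on (\<lambda>y. \<omega> c (chart_inv c y) v) U" "smooth_on (\<lambda>y. \<omega>\<^sub>1 c (chart_inv c y) v) U" for v
      using one_form_smooth[OF o(1) c] one_form_smooth[OF o(2) c] smooth_on_subset U(2) by blast+
    show "smooth_on (\<lambda>y. B (chart_inv c y)) U"
      using smooth_fun_chart[OF M(1) o(3) c] smooth_on_subset U(2) by blast
    show "structure_eqs (\<lambda>y. pullback M' \<phi> \<omega>' c (chart_inv c y)) (\<lambda>y. pullback M' \<phi> \<omega>\<^sub>1' c (chart_inv c y))
       (\<lambda>y. A' (\<phi> (chart_inv c y))) (\<lambda>y. B' (\<phi> (chart_inv c y))) (\<lambda>y. \<epsilon>' (\<phi> (chart_inv c y))) y" if "y \<in> U" for y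
      by (rule pullback_structure_eqs[OF M ad' rep that])
    fix y assume "y \<in> U"
    then have y: "y \<in> snd c ` fst c" using U(2) by blast
    show "frame (\<omega> c (chart_inv c y)) (\<omega>\<^sub>1 c (chart_inv c y)) (\<lambda>v. cnj (\<omega>\<^sub>1 c (chart_inv c y) v)) \<and>
        (\<forall>v. \<omega> c (chart_inv c y) v \<in> \<real>)"
      using ad c chart_inv_in[OF y] unfolding adapted_def by blast
    show "structure_eqs (\<lambda>y. \<omega> c (chart_inv c y)) (\<lambda>y. \<omega>\<^sub>1 c (chart_inv c y))
        (\<lambda>y. A (chart_inv c y)) (\<lambda>y. B (chart_inv c y)) (\<lambda>y. \<epsilon> (chart_inv c y)) y"
      using ad c y unfolding adapted_def by blast
  qed (use U fh eq in auto)
  show "f y = 1" "h y = 1" "A' (\<phi> (chart_inv c y)) = A (chart_inv c y)" "B' (\<phi> (chart_inv c y)) = B (chart_inv c y)"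
    by (rule coframes_equal[OF y])+
qed

text \<open>Rigidity on a single manifold. It is what makes the result independent of the
  representative, the Cartan coframe and the section quantified in
  \<open>invariant_coframe\<close>.\<close>

lemma adapted_unique:
  assumes M: "charted M" and ad: "adapted M \<omega> \<omega>\<^sub>1 A B \<epsilon>" and ad': "adapted M \<eta> \<eta>\<^sub>1 A' B' \<epsilon>'"
    and pr: "proportional_on M (points M) \<omega> \<omega>\<^sub>1 \<eta> \<eta>\<^sub>1" and c: "c \<in> atlas M" and x: "x \<in> fst c"
  shows "\<eta> c x = \<omega> c x" "\<eta>\<^sub>1 c x = \<omega>\<^sub>1 c x" "A' x = A x" "B' x = B x" "\<epsilon>' x = \<epsilon> x"
proof -
  let ?U = "snd c ` fst c"
  obtain f h where fh: "smooth_fun M f" "smooth_fun M h" "\<And>x. x \<in> points M \<Longrightarrow> f x \<noteq> 0 \<and> h x \<noteq> 0"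
    and eq: "form_eq M (points M) \<eta> (\<lambda>c x v. of_real (f x) * \<omega> c x v)" "form_eq M (points M) \<eta>\<^sub>1 (\<lambda>c x v. h x * \<omega>\<^sub>1 c x v)"
    using pr unfolding proportional_on_def by blast
  have eq: "\<eta> c x v = of_real (f x) * \<omega> c x v" "\<eta>\<^sub>1 c x v = h x * \<omega>\<^sub>1 c x v" if "x \<in> fst c" for x v
    using eq c that unfolding form_eq_points[OF M] by auto
  have o: "one_form M \<omega>" "one_form M \<omega>\<^sub>1" "smooth_fun M B" using ad by (auto simp: adapted_def)
  interpret two_coframes ?U "\<lambda>y. \<omega> c (chart_inv c y)" "\<lambda>y. \<omega>\<^sub>1 c (chart_inv c y)"
    "\<lambda>y. \<eta> c (chart_inv c y)" "\<lambda>y. \<eta>\<^sub>1 c (chart_inv c y)"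
    "\<lambda>y. A (chart_inv c y)" "\<lambda>y. A' (chart_inv c y)" "\<lambda>y. B (chart_inv c y)" "\<lambda>y. B' (chart_inv c y)"
    "\<lambda>y. \<epsilon> (chart_inv c y)" "\<lambda>y. \<epsilon>' (chart_inv c y)" "\<lambda>y. f (chart_inv c y)" "\<lambda>y. h (chart_inv c y)"
  proof
    show "open ?U" by (rule chart_open[OF M c])
    show "smooth_on (\<lambda>y. \<omega> c (chart_inv c y) v) ?U" "smooth_on (\<lambda>y. \<omega>\<^sub>1 c (chart_inv c y) v) ?U" for v
      using one_form_smooth[OF o(1) c] one_form_smooth[OF o(2) c] by blast+
    show "smooth_on (\<lambda>y. B (chart_inv c y)) ?U" "smooth_on (\<lambda>y. f (chart_inv c y)) ?U"
      "smooth_on (\<lambda>y. h (chart_inv c y)) ?U"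
      by (intro smooth_fun_chart[OF M _ c] o fh)+
    fix y assume y: "y \<in> ?U"
    show "frame (\<omega> c (chart_inv c y)) (\<omega>\<^sub>1 c (chart_inv c y)) (\<lambda>v. cnj (\<omega>\<^sub>1 c (chart_inv c y) v)) \<and>
        (\<forall>v. \<omega> c (chart_inv c y) v \<in> \<real>)"
      using ad c chart_inv_in[OF y] unfolding adapted_def by blast
    show "f (chart_inv c y) \<noteq> 0" "h (chart_inv c y) \<noteq> 0"
      using fh(3)[OF subsetD[OF charted_subset[OF M c] chart_inv_in[OF y]]] by auto
    show "\<eta> c (chart_inv c y) v = of_real (f (chart_inv c y)) * \<omega> c (chart_inv c y) v"
      "\<eta>\<^sub>1 c (chart_inv c y) v = h (chart_inv c y) * \<omega>\<^sub>1 c (chart_inv c y) v" for v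
      by (rule eq[OF chart_inv_in[OF y]])+
    show "structure_eqs (\<lambda>y. \<omega> c (chart_inv c y)) (\<lambda>y. \<omega>\<^sub>1 c (chart_inv c y))
        (\<lambda>y. A (chart_inv c y)) (\<lambda>y. B (chart_inv c y)) (\<lambda>y. \<epsilon> (chart_inv c y)) y"
      "structure_eqs (\<lambda>y. \<eta> c (chart_inv c y)) (\<lambda>y. \<eta>\<^sub>1 c (chart_inv c y))
        (\<lambda>y. A' (chart_inv c y)) (\<lambda>y. B' (chart_inv c y)) (\<lambda>y. \<epsilon>' (chart_inv c y)) y"
      using ad ad' c y unfolding adapted_def by blast+
  qed
  have xc: "snd c x \<in> ?U" "chart_inv c (snd c x) = x" using M c x by simp_all
  note * = coframes_equal[OF xc(1), unfolded xc(2)]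
  show "\<eta> c x = \<omega> c x" "\<eta>\<^sub>1 c x = \<omega>\<^sub>1 c x" using eq[OF x] *(1,2) by (simp_all add: fun_eq_iff)
  show "A' x = A x" "B' x = B x" "\<epsilon>' x = \<epsilon> x" by (rule *(3-5))+
qed

text \<open>Continuity of \<open>F\<close> and openness of \<open>W\<close> make the coordinate
  domain open, so that derivatives there are local.\<close>

lemma smooth_map_chart_rep:
  assumes M: "smooth_manifold M" and N: "smooth_manifold N" and W: "openin (mfd_top M) W"
    and F: "smooth_map_on M W N F" and c: "c \<in> atlas M" and d: "d \<in> atlas N"
  shows "chart_rep M c (snd c ` (fst c \<inter> W \<inter> F -` fst d)) N d F"
proof -
  have "openin (mfd_top N) (fst d)" using N d by (auto simp: smooth_manifold_def)
  then have "openin (subtopology (mfd_top M) W) {x \<in> topspace (subtopology (mfd_top M) W). F x \<in> fst d}"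
    using F by (auto simp: smooth_map_on_def dest: openin_continuous_map_preimage)
  moreover have "{x \<in> topspace (subtopology (mfd_top M) W). F x \<in> fst d} = W \<inter> F -` fst d"
    using openin_subset[OF W] by auto
  ultimately have "openin (mfd_top M) (W \<inter> F -` fst d)"
    using W openin_trans_full by fastforce
  from chart_image_open[OF M c this]
  have o: "open (snd c ` (fst c \<inter> W \<inter> F -` fst d))" by (simp add: Int_assoc)
  have "smooth_on (snd d \<circ> F \<circ> chart_inv c) (snd c ` (fst c \<inter> W \<inter> F -` fst d))"
    using F c d by (auto simp: smooth_map_on_def)
  then show ?thesis
    using o c d chart_inv_chart[OF smooth_manifold_charted[OF M] c] by (auto simp: chart_rep_def)
qed

section \<open>Equivalences are the maps that carry the invariant coframes\<close>

context
  fixes M :: "('a, real^3) mfd" and M' :: "('b, real^3) mfd" and S S' \<omega> \<omega>\<^sub>1 A B \<epsilon> \<omega>' \<omega>\<^sub>1' A' B' \<epsilon>'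
  assumes S: "oriented_congruence M S" and S': "oriented_congruence M' S'"
    and inv: "invariant_coframe M S \<omega> \<omega>\<^sub>1 A B \<epsilon>" and inv': "invariant_coframe M' S' \<omega>' \<omega>\<^sub>1' A' B' \<epsilon>'"
begin

lemma sm: "smooth_manifold M" "smooth_manifold M'" and ch: "charted M" "charted M'"
  using S S' smooth_manifold_charted by (auto simp: oriented_congruence_def)

lemma diffeo_chart_rep:
  assumes \<phi>: "diffeo_between M W M' W' \<phi>" and c: "c \<in> atlas M" and x: "x \<in> fst c" "x \<in> W"
  obtains d where "chart_rep M c (snd c ` (fst c \<inter> W \<inter> \<phi> -` fst d)) M' d \<phi>"
    "snd c x \<in> snd c ` (fst c \<inter> W \<inter> \<phi> -` fst d)"
proof -
  have W: "openin (mfd_top M) W" "openin (mfd_top M') W'" "bij_betw \<phi> W W'" "smooth_map_on M W M' \<phi>"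
    using \<phi> by (auto simp: diffeo_between_def)
  have "\<phi> x \<in> points M'" using subsetD[OF openin_subset[OF W(2)] bspec[OF bij_betwE[OF W(3)] x(2)]] .
  then obtain d where d: "d \<in> atlas M'" "\<phi> x \<in> fst d" using charted_cover[OF ch(2)] by blast
  show ?thesis
    by (rule that[OF smooth_map_chart_rep[OF sm W(1,4) c d(1)]]) (intro imageI IntI vimageI2 x d)
qed

text \<open>Rigidity with the constant factors f = h = 1, whose conclusion includes equality of the
  invariants.\<close>

lemma carries_invariants:
  assumes car: "carries_coframe M W \<omega> \<omega>\<^sub>1 M' W' \<omega>' \<omega>\<^sub>1' \<phi>" and x: "x \<in> W"
  shows "A' (\<phi> x) = A x \<and> B' (\<phi> x) = B x"
proof -
  have \<phi>: "diffeo_between M W M' W' \<phi>" and eq: "form_eq M W (pullback M' \<phi> \<omega>') \<omega>" "form_eq M W (pullback M' \<phi> \<omega>\<^sub>1') \<omega>\<^sub>1"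
    using car by (auto simp: carries_coframe_def)
  have "x \<in> points M" using x \<phi> openin_subset unfolding diffeo_between_def by blast
  then obtain c where c: "c \<in> atlas M" "x \<in> fst c" using charted_cover[OF ch(1)] by blast
  obtain d where rep: "chart_rep M c (snd c ` (fst c \<inter> W \<inter> \<phi> -` fst d)) M' d \<phi>"
    and y: "snd c x \<in> snd c ` (fst c \<inter> W \<inter> \<phi> -` fst d)"
    using diffeo_chart_rep[OF \<phi> c x] by blast
  have e: "pullback M' \<phi> \<omega>' c (chart_inv c y) v = of_real 1 * \<omega> c (chart_inv c y) v"
    "pullback M' \<phi> \<omega>\<^sub>1' c (chart_inv c y) v = 1 * \<omega>\<^sub>1 c (chart_inv c y) v"
    if "y \<in> snd c ` (fst c \<inter> W \<inter> \<phi> -` fst d)" for y v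
    using that eq c(1) chart_inv_chart[OF ch(1) c(1)] by (auto simp: form_eq_def)
  show ?thesis
    using coframes_agree(3,4)[OF ch invariant_coframe_adapted(1)[OF S inv] invariant_coframe_adapted(1)[OF S' inv'] rep y
        smooth_on_const smooth_on_const _ _ e] chart_inv_chart[OF ch(1) c] by simp
qed

lemma equivalence_iff_carries:
  "equivalence_between M W S M' W' S' \<phi> \<longleftrightarrow> carries_coframe M W \<omega> \<omega>\<^sub>1 M' W' \<omega>' \<omega>\<^sub>1' \<phi>"
proof
  assume car: "carries_coframe M W \<omega> \<omega>\<^sub>1 M' W' \<omega>' \<omega>\<^sub>1' \<phi>"
  \<comment> \<open>A carried coframe is proportional with factors 1, and both coframes are
    representatives of their structures.\<close>
  have "proportional_on M W \<omega> \<omega>\<^sub>1 (pullback M' \<phi> \<omega>') (pullback M' \<phi> \<omega>\<^sub>1')"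
    unfolding proportional_on_def
  proof (intro exI conjI)
    show "smooth_fun_on M W (\<lambda>x. 1)" "smooth_fun_on M W (\<lambda>x. 1)"
      by (simp_all add: smooth_fun_on_def o_def smooth_on_const)
  qed (use car in \<open>simp_all add: carries_coframe_def\<close>)
  moreover have "diffeo_between M W M' W' \<phi>" using car by (simp add: carries_coframe_def)
  ultimately show "equivalence_between M W S M' W' S' \<phi>"
    unfolding equivalence_between_def
    using invariant_coframe_adapted(2)[OF S inv] invariant_coframe_adapted(2)[OF S' inv'] by blast
next
  assume "equivalence_between M W S M' W' S' \<phi>"
  then obtain lam \<mu> lam' \<mu>' where \<phi>: "diffeo_between M W M' W' \<phi>" and m: "(lam, \<mu>) \<in> S" "(lam', \<mu>') \<in> S'"
    and pr: "proportional_on M W lam \<mu> (pullback M' \<phi> lam') (pullback M' \<phi> \<mu>')"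
    unfolding equivalence_between_def by blast
  have W: "openin (mfd_top M) W" using \<phi> by (auto simp: diffeo_between_def)
  have WM: "W \<subseteq> points M" by (rule openin_subset[OF W])
  obtain f h where fh: "smooth_fun_on M W f" "smooth_fun_on M W h" "\<And>x. x \<in> W \<Longrightarrow> f x \<noteq> 0" "\<And>x. x \<in> W \<Longrightarrow> h x \<noteq> 0"
    and fheq: "form_eq M W (pullback M' \<phi> lam') (\<lambda>c x v. of_real (f x) * lam c x v)"
      "form_eq M W (pullback M' \<phi> \<mu>') (\<lambda>c x v. h x * \<mu> c x v)"
    using pr unfolding proportional_on_def by blast
  obtain F H where FH: "smooth_fun M F" "smooth_fun M H" "\<And>x. x \<in> points M \<Longrightarrow> F x \<noteq> 0" "\<And>x. x \<in> points M \<Longrightarrow> H x \<noteq> 0"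
    and FHeq: "form_eq M (points M) \<omega> (\<lambda>c x v. of_real (F x) * lam c x v)"
      "form_eq M (points M) \<omega>\<^sub>1 (\<lambda>c x v. H x * \<mu> c x v)"
    using invariant_coframe_adapted(3)[OF S inv m(1)] unfolding proportional_on_def by blast
  obtain F' H' where FH': "smooth_fun M' F'" "smooth_fun M' H'" "\<And>x. x \<in> points M' \<Longrightarrow> F' x \<noteq> 0" "\<And>x. x \<in> points M' \<Longrightarrow> H' x \<noteq> 0"
    and FHeq': "form_eq M' (points M') \<omega>' (\<lambda>c x v. of_real (F' x) * lam' c x v)"
      "form_eq M' (points M') \<omega>\<^sub>1' (\<lambda>c x v. H' x * \<mu>' c x v)"
    using invariant_coframe_adapted(3)[OF S' inv' m(2)] unfolding proportional_on_def by blast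
  have main: "pullback M' \<phi> \<omega>' c x = \<omega> c x \<and> pullback M' \<phi> \<omega>\<^sub>1' c x = \<omega>\<^sub>1 c x"
    if c: "c \<in> atlas M" and x: "x \<in> fst c" "x \<in> W" for c x
  proof -
    obtain d where rep: "chart_rep M c (snd c ` (fst c \<inter> W \<inter> \<phi> -` fst d)) M' d \<phi>" (is "chart_rep _ _ ?U _ _ _")
      and xU: "snd c x \<in> snd c ` (fst c \<inter> W \<inter> \<phi> -` fst d)"
      using diffeo_chart_rep[OF \<phi> c x] by blast
    have U: "open ?U" "d \<in> atlas M'" "smooth_on (snd d \<circ> \<phi> \<circ> chart_inv c) ?U" using rep by (auto simp: chart_rep_def)
    have in_U: "chart_inv c y \<in> fst c" "chart_inv c y \<in> W" "chart_inv c y \<in> points M"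
      "\<phi> (chart_inv c y) \<in> fst d" "\<phi> (chart_inv c y) \<in> points M'"
      if "y \<in> ?U" for y
      using that WM chart_inv_chart[OF ch(1) c] charted_subset[OF ch(2) U(2)] by auto
    have sW: "smooth_on (\<lambda>y. f (chart_inv c y)) ?U" "smooth_on (\<lambda>y. h (chart_inv c y)) ?U"
      using fh(1,2) c unfolding smooth_fun_on_def o_def by (blast intro: smooth_on_subset)+
    have sM: "smooth_on (\<lambda>y. F (chart_inv c y)) ?U" "smooth_on (\<lambda>y. H (chart_inv c y)) ?U"
      using smooth_fun_chart[OF ch(1) FH(1) c] smooth_fun_chart[OF ch(1) FH(2) c] by (blast intro: smooth_on_subset)+
    have sM': "smooth_on (\<lambda>y. G (\<phi> (chart_inv c y))) ?U" if "smooth_fun M' G" for G :: "'b \<Rightarrow> 'k::real_normed_vector"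
    proof -
      have "smooth_on (\<lambda>y. G (chart_inv d ((snd d \<circ> \<phi> \<circ> chart_inv c) y))) ?U"
        by (rule smooth_on_compose[OF U(1) chart_open[OF ch(2) U(2)] _ smooth_fun_chart[OF ch(2) that U(2)] U(3)])
          (use in_U in simp)
      then show ?thesis
        by (rule smooth_on_cong[OF U(1), rotated]) (simp add: chart_rep_at(3)[OF ch rep, unfolded o_apply])
    qed
    \<comment> \<open>Composed from \<omega>' = F' lam', pullback of lam' = f lam, and \<omega> = F
      lam: the factor between the pulled-back form and \<omega>. Rigidity makes it, and its
      counterpart for \<mu>, equal to 1.\<close>
    let ?f = "\<lambda>y. F' (\<phi> (chart_inv c y)) * f (chart_inv c y) / F (chart_inv c y)"
    let ?h = "\<lambda>y. H' (\<phi> (chart_inv c y)) * h (chart_inv c y) / H (chart_inv c y)"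
    have nz: "?f y \<noteq> 0" "?h y \<noteq> 0" if "y \<in> ?U" for y
      using in_U[OF that] fh FH FH' by auto
    have sfh: "smooth_on ?f ?U" "smooth_on ?h ?U"
      using in_U FH by (intro smooth_on_divide smooth_on_mult U sW sM sM' FH'; blast)+
    have eqf: "pullback M' \<phi> \<omega>' c (chart_inv c y) v = of_real (?f y) * \<omega> c (chart_inv c y) v" if y: "y \<in> ?U" for y v
    proof -
      have "pullback M' \<phi> \<omega>' c (chart_inv c y) v = of_real (F' (\<phi> (chart_inv c y))) * pullback M' \<phi> lam' c (chart_inv c y) v"
        unfolding pullback_form_eq[OF ch rep y FHeq'(1)] by (simp add: pullback_def Let_def)
      moreover have "pullback M' \<phi> lam' c (chart_inv c y) v = of_real (f (chart_inv c y)) * lam c (chart_inv c y) v"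
        using fheq(1) c in_U[OF y] by (simp add: form_eq_def)
      moreover have "\<omega> c (chart_inv c y) v = of_real (F (chart_inv c y)) * lam c (chart_inv c y) v"
        using FHeq(1) c in_U[OF y] by (simp add: form_eq_def)
      ultimately show ?thesis using FH(3)[OF in_U(3)[OF y]] by simp
    qed
    have eqh: "pullback M' \<phi> \<omega>\<^sub>1' c (chart_inv c y) v = ?h y * \<omega>\<^sub>1 c (chart_inv c y) v" if y: "y \<in> ?U" for y v
    proof -
      have "pullback M' \<phi> \<omega>\<^sub>1' c (chart_inv c y) v = H' (\<phi> (chart_inv c y)) * pullback M' \<phi> \<mu>' c (chart_inv c y) v"
        unfolding pullback_form_eq[OF ch rep y FHeq'(2)] by (simp add: pullback_def Let_def)
      moreover have "pullback M' \<phi> \<mu>' c (chart_inv c y) v = h (chart_inv c y) * \<mu> c (chart_inv c y) v"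
        using fheq(2) c in_U[OF y] by (simp add: form_eq_def)
      moreover have "\<omega>\<^sub>1 c (chart_inv c y) v = H (chart_inv c y) * \<mu> c (chart_inv c y) v"
        using FHeq(2) c in_U[OF y] by (simp add: form_eq_def)
      ultimately show ?thesis using FH(4)[OF in_U(3)[OF y]] by simp
    qed
    have 1: "?f (snd c x) = 1" "?h (snd c x) = 1"
      using coframes_agree(1,2)[OF ch invariant_coframe_adapted(1)[OF S inv] invariant_coframe_adapted(1)[OF S' inv'] rep xU
        sfh nz eqf eqh] by blast+
    show ?thesis
      using eqf[OF xU, unfolded 1] eqh[OF xU, unfolded 1] unfolding chart_inv_chart[OF ch(1) c x(1)]
      by (simp add: fun_eq_iff)
  qed
  have pc: "pullback M' \<phi> (cnj_form \<omega>\<^sub>1') = cnj_form (pullback M' \<phi> \<omega>\<^sub>1')"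
    by (simp add: pullback_def cnj_form_def Let_def)
  show "carries_coframe M W \<omega> \<omega>\<^sub>1 M' W' \<omega>' \<omega>\<^sub>1' \<phi>"
    unfolding carries_coframe_def form_eq_def pc using main \<phi> by (simp add: cnj_form_def)
qed

end

section \<open>The structure equations as identities of forms on M, and the final assembly\<close>

lemma adapted_equations:
  assumes M: "charted M" and ad: "adapted M \<omega> \<omega>\<^sub>1 A B \<epsilon>"
  shows "coframe M [\<omega>, \<omega>\<^sub>1, cnj_form \<omega>\<^sub>1]" "real_form M \<omega>" "smooth_fun M A" "smooth_fun M B"
    "\<forall>x\<in>points M. A x > 0 \<and> (\<epsilon> x = 1 \<or> \<epsilon> x = - 1)"
    "form_eq M (points M) (d1 \<omega>)
          (\<lambda>c x u v. \<i> * (\<omega>\<^sub>1 \<^bold>\<and> cnj_form \<omega>\<^sub>1) c x u v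
             + 2 * of_real (A x) * ((\<omega>\<^sub>1 \<^bold>\<and> \<omega>) c x u v + (cnj_form \<omega>\<^sub>1 \<^bold>\<and> \<omega>) c x u v))"
    "form_eq M (points M) (d1 \<omega>\<^sub>1)
          (\<lambda>c x u v. - (of_real (A x) + \<i> * cnj (B x)) * (\<omega>\<^sub>1 \<^bold>\<and> cnj_form \<omega>\<^sub>1) c x u v)"
    "form_eq M (points M)
          (d1 (\<lambda>c x v. B x * \<omega>\<^sub>1 c x v + cnj (B x) * cnj_form \<omega>\<^sub>1 c x v))
          (\<lambda>c x u v. - of_real (\<epsilon> x) * \<i> * (\<omega>\<^sub>1 \<^bold>\<and> cnj_form \<omega>\<^sub>1) c x u v)"
proof -
  have o: "one_form M \<omega>" "one_form M \<omega>\<^sub>1" and fr: "\<And>c x. c \<in> atlas M \<Longrightarrow> x \<in> fst c \<Longrightarrow> cframe (\<omega> c x) (\<omega>\<^sub>1 c x)"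
    and sm: "smooth_fun M A" "smooth_fun M B"
    using ad unfolding adapted_def by blast+
  show "coframe M [\<omega>, \<omega>\<^sub>1, cnj_form \<omega>\<^sub>1]" by (rule coframe3I[OF M o fr])
  show "real_form M \<omega>" using fr by (auto simp: real_form_def)
  show "smooth_fun M A" "smooth_fun M B" by (rule sm)+
  have se: "structure_eqs (\<lambda>y. \<omega> c (chart_inv c y)) (\<lambda>y. \<omega>\<^sub>1 c (chart_inv c y))
        (\<lambda>y. A (chart_inv c y)) (\<lambda>y. B (chart_inv c y)) (\<lambda>y. \<epsilon> (chart_inv c y)) (snd c x)"
    if "c \<in> atlas M" "x \<in> fst c" for c x
    using ad that unfolding adapted_def by blast
  note se = se[unfolded structure_eqs_def]
  show "\<forall>x\<in>points M. A x > 0 \<and> (\<epsilon> x = 1 \<or> \<epsilon> x = - 1)"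
  proof
    fix x assume "x \<in> points M"
    then obtain c where c: "c \<in> atlas M" "x \<in> fst c" using charted_cover[OF M] by blast
    from se[OF c] show "A x > 0 \<and> (\<epsilon> x = 1 \<or> \<epsilon> x = - 1)"
      unfolding chart_inv_chart[OF M c] by blast
  qed
  show "form_eq M (points M) (d1 \<omega>)
          (\<lambda>c x u v. \<i> * (\<omega>\<^sub>1 \<^bold>\<and> cnj_form \<omega>\<^sub>1) c x u v
             + 2 * of_real (A x) * ((\<omega>\<^sub>1 \<^bold>\<and> \<omega>) c x u v + (cnj_form \<omega>\<^sub>1 \<^bold>\<and> \<omega>) c x u v))"
    unfolding form_eq_points[OF M]
  proof (intro ballI ext)
    fix c x u v assume c: "c \<in> atlas M" "x \<in> fst c"
    from se[OF c] show "d1 \<omega> c x u v = \<i> * (\<omega>\<^sub>1 \<^bold>\<and> cnj_form \<omega>\<^sub>1) c x u v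
             + 2 * of_real (A x) * ((\<omega>\<^sub>1 \<^bold>\<and> \<omega>) c x u v + (cnj_form \<omega>\<^sub>1 \<^bold>\<and> \<omega>) c x u v)"
      unfolding chart_inv_chart[OF M c] d1_def wedge_def cnj_form_def by blast
  qed
  show "form_eq M (points M) (d1 \<omega>\<^sub>1)
          (\<lambda>c x u v. - (of_real (A x) + \<i> * cnj (B x)) * (\<omega>\<^sub>1 \<^bold>\<and> cnj_form \<omega>\<^sub>1) c x u v)"
    unfolding form_eq_points[OF M]
  proof (intro ballI ext)
    fix c x u v assume c: "c \<in> atlas M" "x \<in> fst c"
    from se[OF c] show "d1 \<omega>\<^sub>1 c x u v = - (of_real (A x) + \<i> * cnj (B x)) * (\<omega>\<^sub>1 \<^bold>\<and> cnj_form \<omega>\<^sub>1) c x u v"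
      unfolding chart_inv_chart[OF M c] d1_def wedge_def cnj_form_def by blast
  qed
  show "form_eq M (points M)
          (d1 (\<lambda>c x v. B x * \<omega>\<^sub>1 c x v + cnj (B x) * cnj_form \<omega>\<^sub>1 c x v))
          (\<lambda>c x u v. - of_real (\<epsilon> x) * \<i> * (\<omega>\<^sub>1 \<^bold>\<and> cnj_form \<omega>\<^sub>1) c x u v)"
    unfolding form_eq_points[OF M]
  proof (intro ballI ext)
    fix c x u v assume c: "c \<in> atlas M" "x \<in> fst c"
    from se[OF c] show "d1 (\<lambda>c x v. B x * \<omega>\<^sub>1 c x v + cnj (B x) * cnj_form \<omega>\<^sub>1 c x v) c x u v
        = - of_real (\<epsilon> x) * \<i> * (\<omega>\<^sub>1 \<^bold>\<and> cnj_form \<omega>\<^sub>1) c x u v"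
      unfolding chart_inv_chart[OF M c] d1_def wedge_def cnj_form_def by blast
  qed
qed

text \<open>Existence and uniqueness are separate clauses because \<open>invariant_coframe\<close>
  is a relation: representative, Cartan coframe and section are existentially quantified in it, and
  forms are determined only up to \<open>form_eq\<close>.\<close>

theorem theorem7p15:
  fixes M :: "('a, real^3) mfd" and S :: "'a form_pair set"
    and M' :: "('b, real^3) mfd" and S' :: "'b form_pair set"
  assumes "nondegenerate_structure M S" and "nondegenerate_structure M' S'"
  shows
    "(\<exists>\<omega> \<omega>\<^sub>1 A\<^sub>1 B\<^sub>1 \<epsilon>. invariant_coframe M S \<omega> \<omega>\<^sub>1 A\<^sub>1 B\<^sub>1 \<epsilon>) \<and>
     (\<forall>\<omega> \<omega>\<^sub>1 A\<^sub>1 B\<^sub>1 \<epsilon> \<eta> \<eta>\<^sub>1 C\<^sub>1 D\<^sub>1 \<delta>.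
        invariant_coframe M S \<omega> \<omega>\<^sub>1 A\<^sub>1 B\<^sub>1 \<epsilon> \<and> invariant_coframe M S \<eta> \<eta>\<^sub>1 C\<^sub>1 D\<^sub>1 \<delta> \<longrightarrow>
        form_eq M (points M) \<omega> \<eta> \<and> form_eq M (points M) \<omega>\<^sub>1 \<eta>\<^sub>1 \<and>
        (\<forall>x\<in>points M. A\<^sub>1 x = C\<^sub>1 x \<and> B\<^sub>1 x = D\<^sub>1 x \<and> \<epsilon> x = \<delta> x)) \<and>
     (\<forall>\<omega> \<omega>\<^sub>1 A\<^sub>1 B\<^sub>1 \<epsilon>. invariant_coframe M S \<omega> \<omega>\<^sub>1 A\<^sub>1 B\<^sub>1 \<epsilon> \<longrightarrow>
        coframe M [\<omega>, \<omega>\<^sub>1, cnj_form \<omega>\<^sub>1] \<and> real_form M \<omega> \<and>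
        (\<forall>(lam, \<mu>)\<in>S. proportional_on M (points M) lam \<mu> \<omega> \<omega>\<^sub>1) \<and>
        smooth_fun M A\<^sub>1 \<and> smooth_fun M B\<^sub>1 \<and>
        (\<forall>x\<in>points M. A\<^sub>1 x > 0 \<and> (\<epsilon> x = 1 \<or> \<epsilon> x = -1)) \<and>
        form_eq M (points M) (d1 \<omega>)
          (\<lambda>c x u v. \<i> * (\<omega>\<^sub>1 \<^bold>\<and> cnj_form \<omega>\<^sub>1) c x u v
             + 2 * of_real (A\<^sub>1 x) * ((\<omega>\<^sub>1 \<^bold>\<and> \<omega>) c x u v + (cnj_form \<omega>\<^sub>1 \<^bold>\<and> \<omega>) c x u v)) \<and>
        form_eq M (points M) (d1 \<omega>\<^sub>1)
          (\<lambda>c x u v. - (of_real (A\<^sub>1 x) + \<i> * cnj (B\<^sub>1 x)) * (\<omega>\<^sub>1 \<^bold>\<and> cnj_form \<omega>\<^sub>1) c x u v) \<and>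
        form_eq M (points M)
          (d1 (\<lambda>c x v. B\<^sub>1 x * \<omega>\<^sub>1 c x v + cnj (B\<^sub>1 x) * cnj_form \<omega>\<^sub>1 c x v))
          (\<lambda>c x u v. - of_real (\<epsilon> x) * \<i> * (\<omega>\<^sub>1 \<^bold>\<and> cnj_form \<omega>\<^sub>1) c x u v)) \<and>
     (\<forall>\<omega> \<omega>\<^sub>1 A\<^sub>1 B\<^sub>1 \<epsilon> \<omega>' \<omega>\<^sub>1' A\<^sub>1' B\<^sub>1' \<epsilon>'.
        invariant_coframe M S \<omega> \<omega>\<^sub>1 A\<^sub>1 B\<^sub>1 \<epsilon> \<and> invariant_coframe M' S' \<omega>' \<omega>\<^sub>1' A\<^sub>1' B\<^sub>1' \<epsilon>' \<longrightarrow>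
        (equivalent_structures M S M' S' \<longleftrightarrow>
           (\<exists>\<phi>. carries_coframe M (points M) \<omega> \<omega>\<^sub>1 M' (points M') \<omega>' \<omega>\<^sub>1' \<phi>)) \<and>
        (\<forall>x\<in>points M. \<forall>x'\<in>points M'.
           locally_equivalent_at M S x M' S' x' \<longleftrightarrow>
           (\<exists>W W' \<phi>. x \<in> W \<and> x' \<in> W' \<and> \<phi> x = x' \<and>
              carries_coframe M W \<omega> \<omega>\<^sub>1 M' W' \<omega>' \<omega>\<^sub>1' \<phi>)) \<and>
        (\<forall>W W' \<phi>. carries_coframe M W \<omega> \<omega>\<^sub>1 M' W' \<omega>' \<omega>\<^sub>1' \<phi> \<longrightarrow>
           (\<forall>x\<in>W. A\<^sub>1' (\<phi> x) = A\<^sub>1 x \<and> B\<^sub>1' (\<phi> x) = B\<^sub>1 x)))"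
proof -
  have S: "oriented_congruence M S" and S': "oriented_congruence M' S'"
    using assms by (simp_all add: nondegenerate_structure_def)
  have M: "charted M" using S smooth_manifold_charted by (auto simp: oriented_congruence_def)
  have 2: "form_eq M (points M) \<omega> \<eta> \<and> form_eq M (points M) \<omega>\<^sub>1 \<eta>\<^sub>1 \<and>
        (\<forall>x\<in>points M. A\<^sub>1 x = C\<^sub>1 x \<and> B\<^sub>1 x = D\<^sub>1 x \<and> \<epsilon> x = \<delta> x)"
    if inv: "invariant_coframe M S \<omega> \<omega>\<^sub>1 A\<^sub>1 B\<^sub>1 \<epsilon>" "invariant_coframe M S \<eta> \<eta>\<^sub>1 C\<^sub>1 D\<^sub>1 \<delta>"
    for \<omega> \<omega>\<^sub>1 A\<^sub>1 B\<^sub>1 \<epsilon> \<eta> \<eta>\<^sub>1 C\<^sub>1 D\<^sub>1 \<delta>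
  proof -
    \<comment> \<open>The first coframe is a member of \<open>S\<close> and the second is
      proportional to every member, hence to the first.\<close>
    note u = adapted_unique[OF M invariant_coframe_adapted(1)[OF S inv(1)] invariant_coframe_adapted(1)[OF S inv(2)]
      invariant_coframe_adapted(3)[OF S inv(2) invariant_coframe_adapted(2)[OF S inv(1)]]]
    show ?thesis
    proof (intro conjI ballI)
      show "form_eq M (points M) \<omega> \<eta>" "form_eq M (points M) \<omega>\<^sub>1 \<eta>\<^sub>1"
        using u(1,2) by (simp_all add: form_eq_points[OF M])
      fix x assume "x \<in> points M"
      then obtain c where "c \<in> atlas M" "x \<in> fst c" using charted_cover[OF M] by blast
      from u(3-5)[OF this] show "A\<^sub>1 x = C\<^sub>1 x" "B\<^sub>1 x = D\<^sub>1 x" "\<epsilon> x = \<delta> x" by simp_all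
    qed
  qed
  have 3: "coframe M [\<omega>, \<omega>\<^sub>1, cnj_form \<omega>\<^sub>1] \<and> real_form M \<omega> \<and>
        (\<forall>(lam, \<mu>)\<in>S. proportional_on M (points M) lam \<mu> \<omega> \<omega>\<^sub>1) \<and>
        smooth_fun M A\<^sub>1 \<and> smooth_fun M B\<^sub>1 \<and>
        (\<forall>x\<in>points M. A\<^sub>1 x > 0 \<and> (\<epsilon> x = 1 \<or> \<epsilon> x = -1)) \<and>
        form_eq M (points M) (d1 \<omega>)
          (\<lambda>c x u v. \<i> * (\<omega>\<^sub>1 \<^bold>\<and> cnj_form \<omega>\<^sub>1) c x u v
             + 2 * of_real (A\<^sub>1 x) * ((\<omega>\<^sub>1 \<^bold>\<and> \<omega>) c x u v + (cnj_form \<omega>\<^sub>1 \<^bold>\<and> \<omega>) c x u v)) \<and>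
        form_eq M (points M) (d1 \<omega>\<^sub>1)
          (\<lambda>c x u v. - (of_real (A\<^sub>1 x) + \<i> * cnj (B\<^sub>1 x)) * (\<omega>\<^sub>1 \<^bold>\<and> cnj_form \<omega>\<^sub>1) c x u v) \<and>
        form_eq M (points M)
          (d1 (\<lambda>c x v. B\<^sub>1 x * \<omega>\<^sub>1 c x v + cnj (B\<^sub>1 x) * cnj_form \<omega>\<^sub>1 c x v))
          (\<lambda>c x u v. - of_real (\<epsilon> x) * \<i> * (\<omega>\<^sub>1 \<^bold>\<and> cnj_form \<omega>\<^sub>1) c x u v)"
    if inv: "invariant_coframe M S \<omega> \<omega>\<^sub>1 A\<^sub>1 B\<^sub>1 \<epsilon>" for \<omega> \<omega>\<^sub>1 A\<^sub>1 B\<^sub>1 \<epsilon>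
    using invariant_coframe_adapted(3)[OF S inv]
    by (intro conjI adapted_equations[OF M invariant_coframe_adapted(1)[OF S inv]]) blast
  have 4: "(equivalent_structures M S M' S' \<longleftrightarrow>
           (\<exists>\<phi>. carries_coframe M (points M) \<omega> \<omega>\<^sub>1 M' (points M') \<omega>' \<omega>\<^sub>1' \<phi>)) \<and>
        (\<forall>x\<in>points M. \<forall>x'\<in>points M'.
           locally_equivalent_at M S x M' S' x' \<longleftrightarrow>
           (\<exists>W W' \<phi>. x \<in> W \<and> x' \<in> W' \<and> \<phi> x = x' \<and>
              carries_coframe M W \<omega> \<omega>\<^sub>1 M' W' \<omega>' \<omega>\<^sub>1' \<phi>)) \<and>
        (\<forall>W W' \<phi>. carries_coframe M W \<omega> \<omega>\<^sub>1 M' W' \<omega>' \<omega>\<^sub>1' \<phi> \<longrightarrow>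
           (\<forall>x\<in>W. A\<^sub>1' (\<phi> x) = A\<^sub>1 x \<and> B\<^sub>1' (\<phi> x) = B\<^sub>1 x))"
    if inv: "invariant_coframe M S \<omega> \<omega>\<^sub>1 A\<^sub>1 B\<^sub>1 \<epsilon>" "invariant_coframe M' S' \<omega>' \<omega>\<^sub>1' A\<^sub>1' B\<^sub>1' \<epsilon>'"
    for \<omega> \<omega>\<^sub>1 A\<^sub>1 B\<^sub>1 \<epsilon> \<omega>' \<omega>\<^sub>1' A\<^sub>1' B\<^sub>1' \<epsilon>'
    unfolding equivalent_structures_def locally_equivalent_at_def equivalence_iff_carries[OF S S' inv]
    by (intro conjI[OF refl] conjI[of "\<forall>x\<in>points M. _ x"] ballI refl allI impI carries_invariants[OF S S' inv])
  show ?thesis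
    by (rule conjI[OF exists_invariant_coframe[OF assms(1)] conjI[OF _ conjI]]; intro allI impI; (elim conjE)?)
      (rule 2 3 4; assumption)+
qed

end
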